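(* Let $(R,\mathfrak m)$ be a commutative noetherian local ring, $I$ an ideal of $R$, and let $\mathcal P$ be the class of all $I$-generated $R$-modules. Then $\mathcal P$ is closed under (a) pure submodules: if $B\in\mathcal P$ and $A$ is a pure submodule of $B$, then $A\in\mathcal P$; (b) pure extensions: if $0\to A\to B\to C\to 0$ is a pure exact sequence of $R$-modules with $A,C\in\mathcal P$, then $B\in\mathcal P$; (c) pure-injective hulls: if $M\in\mathcal P$ and $M\subset N$ is a pure-injective hull of $M$, then $N\in\mathcal P$.
   Context: An $R$-module $M$ is $I$-generated if there is an epimorphism $I^{(\Lambda)}\twoheadrightarrow M$ for some index set $\Lambda$ (where $I^{(\Lambda)}$ is the direct sum of copies of $I$). *)

theory Defs
  imports "HOL-Algebra.Algebra" "HOL-Analysis.Analysis"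
begin

section \<open>Local rings and homomorphisms of modules\<close>

definition local_ring :: "('r, 'x) ring_scheme \<Rightarrow> 'r set \<Rightarrow> bool" where
  "local_ring R m \<longleftrightarrow> cring R \<and> (\<forall>J. maximalideal J R \<longleftrightarrow> J = m)"

definition mod_hom ::
  "('r, 'x) ring_scheme \<Rightarrow> ('r, 'a) module \<Rightarrow> ('r, 'b) module \<Rightarrow> ('a \<Rightarrow> 'b) set" where
  "mod_hom R M N =
     {h \<in> carrier M \<rightarrow> carrier N.
        (\<forall>x\<in>carrier M. \<forall>y\<in>carrier M. h (x \<oplus>\<^bsub>M\<^esub> y) = h x \<oplus>\<^bsub>N\<^esub> h y) \<and>
        (\<forall>r\<in>carrier R. \<forall>x\<in>carrier M. h (r \<odot>\<^bsub>M\<^esub> x) = r \<odot>\<^bsub>N\<^esub> h x)}"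


section \<open>\<open>I\<close>-generated modules\<close>

text \<open>
  The record type of modules extends that of rings; its fields \<open>mult\<close> and \<open>one\<close> play no
  role for modules and are filled arbitrarily below.
\<close>

definition ideal_module :: "('r, 'x) ring_scheme \<Rightarrow> 'r set \<Rightarrow> ('r, 'r) module" where
  "ideal_module R I =
     \<lparr>carrier = I, monoid.mult = (\<otimes>\<^bsub>R\<^esub>), one = \<one>\<^bsub>R\<^esub>, ring.zero = \<zero>\<^bsub>R\<^esub>, ring.add = (\<oplus>\<^bsub>R\<^esub>), Module.module.smult = (\<otimes>\<^bsub>R\<^esub>)\<rparr>"

text \<open>The direct sum \<open>M\<^sup>(\<^sup>\<Lambda>\<^sup>)\<close>, as the finitely supported functions on \<open>\<Lambda>\<close>.\<close>

definition copower :: "'i set \<Rightarrow> ('r, 'a) module \<Rightarrow> ('r, 'i \<Rightarrow> 'a) module" where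
  "copower \<Lambda> M =
     \<lparr>carrier = {f \<in> \<Lambda> \<rightarrow>\<^sub>E carrier M. finite {i \<in> \<Lambda>. f i \<noteq> \<zero>\<^bsub>M\<^esub>}},
      monoid.mult = undefined, one = undefined,
      ring.zero = (\<lambda>i\<in>\<Lambda>. \<zero>\<^bsub>M\<^esub>),
      ring.add = (\<lambda>f g. \<lambda>i\<in>\<Lambda>. f i \<oplus>\<^bsub>M\<^esub> g i),
      Module.module.smult = (\<lambda>r f. \<lambda>i\<in>\<Lambda>. r \<odot>\<^bsub>M\<^esub> f i)\<rparr>"

text \<open>
  A definition cannot quantify over all types from which the index set could be drawn.
  The type \<open>'r \<Rightarrow> 'a\<close>, which has room for all homomorphisms from \<open>I\<close> to \<open>M\<close>, is
  large enough: see \<open>I_generatedI\<close> below.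
\<close>

definition I_generated :: "('r, 'x) ring_scheme \<Rightarrow> 'r set \<Rightarrow> ('r, 'a) module \<Rightarrow> bool" where
  "I_generated R I M \<longleftrightarrow> module R M \<and>
     (\<exists>(\<Lambda> :: ('r \<Rightarrow> 'a) set) h.
        h \<in> mod_hom R (copower \<Lambda> (ideal_module R I)) M \<and>
        h ` carrier (copower \<Lambda> (ideal_module R I)) = carrier M)"


section \<open>Purity\<close>

text \<open>
  Purity by finite systems of linear equations: a system with right-hand sides in \<open>A\<close>
  that is solvable in \<open>B\<close> is solvable in \<open>A\<close>.
\<close>

definition pure_submodule :: "('r, 'x) ring_scheme \<Rightarrow> 'a set \<Rightarrow> ('r, 'a) module \<Rightarrow> bool" where
  "pure_submodule R A B \<longleftrightarrow> submodule A R B \<and>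
     (\<forall>(m :: nat) (n :: nat) r a.
        (\<forall>i<m. \<forall>j<n. r i j \<in> carrier R) \<longrightarrow> (\<forall>i<m. a i \<in> A) \<longrightarrow>
        (\<exists>b. (\<forall>j<n. b j \<in> carrier B) \<and> (\<forall>i<m. (\<Oplus>\<^bsub>B\<^esub>j\<in>{..<n}. r i j \<odot>\<^bsub>B\<^esub> b j) = a i)) \<longrightarrow>
        (\<exists>b. (\<forall>j<n. b j \<in> A) \<and> (\<forall>i<m. (\<Oplus>\<^bsub>B\<^esub>j\<in>{..<n}. r i j \<odot>\<^bsub>B\<^esub> b j) = a i)))"

definition pure_exact ::
  "('r, 'x) ring_scheme \<Rightarrow> ('r, 'a) module \<Rightarrow> ('a \<Rightarrow> 'b) \<Rightarrow> ('r, 'b) module \<Rightarrow>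
   ('b \<Rightarrow> 'c) \<Rightarrow> ('r, 'c) module \<Rightarrow> bool" where
  "pure_exact R A f B g C \<longleftrightarrow>
     module R A \<and> module R B \<and> module R C \<and>
     f \<in> mod_hom R A B \<and> inj_on f (carrier A) \<and>
     g \<in> mod_hom R B C \<and> g ` carrier B = carrier C \<and>
     f ` carrier A = {b \<in> carrier B. g b = \<zero>\<^bsub>C\<^esub>} \<and>
     pure_submodule R (f ` carrier A) B"

text \<open>
  \<open>N\<close> is pure-injective if homomorphisms into \<open>N\<close> extend along pure embeddings.  The
  ambient modules \<open>B\<close> in the definition have to be carried by one fixed type.  The one
  chosen accommodates the double character module of \<open>N\<close>, which contains \<open>N\<close> as a pure
  submodule and is pure-injective; by \<open>pure_injective_extend\<close> below the extension
  property then holds for modules \<open>B\<close> carried by any type.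
\<close>

definition pure_injective :: "('r, 'x) ring_scheme \<Rightarrow> ('r, 'a) module \<Rightarrow> bool" where
  "pure_injective R N \<longleftrightarrow> module R N \<and>
     (\<forall>(B :: ('r, ('a \<Rightarrow> complex) \<Rightarrow> complex) module) A h.
        module R B \<longrightarrow> pure_submodule R A B \<longrightarrow> h \<in> mod_hom R (B\<lparr>carrier := A\<rparr>) N \<longrightarrow>
        (\<exists>k \<in> mod_hom R B N. \<forall>x\<in>A. k x = h x))"

text \<open>
  The hull as a pure-injective envelope: minimality of \<open>N\<close> over \<open>M\<close> says that every
  endomorphism of \<open>N\<close> fixing \<open>M\<close> pointwise is an automorphism.
\<close>

definition pure_injective_hull :: "('r, 'x) ring_scheme \<Rightarrow> 'a set \<Rightarrow> ('r, 'a) module \<Rightarrow> bool" where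
  "pure_injective_hull R M N \<longleftrightarrow>
     pure_injective R N \<and> pure_submodule R M N \<and>
     (\<forall>e \<in> mod_hom R N N. (\<forall>x\<in>M. e x = x) \<longrightarrow> bij_betw e (carrier N) (carrier N))"


section \<open>Independence of the type of the index set\<close>

lemma I_generatedI:
  fixes R :: "('r, 'x) ring_scheme" and M :: "('r, 'a) module" and \<Lambda> :: "'i set"
  assumes I: "ideal I R" and M: "module R M"
    and h: "h \<in> mod_hom R (copower \<Lambda> (ideal_module R I)) M"
    and surj: "h ` carrier (copower \<Lambda> (ideal_module R I)) = carrier M"
  shows "I_generated R I M"
proof -
  interpret M: module R M by fact
  interpret I: ideal I R by fact
  have IR: "\<And>x. x \<in> I \<Longrightarrow> x \<in> carrier R" by (rule I.a_Hcarr)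
  let ?z = "\<zero>\<^bsub>R\<^esub>"
  let ?P = "\<lambda>L. copower L (ideal_module R I)"
  have mem: "f \<in> carrier (?P L) \<longleftrightarrow> f \<in> L \<rightarrow>\<^sub>E I \<and> finite {i\<in>L. f i \<noteq> ?z}" for f and L :: "'z set"
    by (simp add: copower_def ideal_module_def)
  have add: "f \<oplus>\<^bsub>?P L\<^esub> g = (\<lambda>i\<in>L. f i \<oplus>\<^bsub>R\<^esub> g i)" for f g and L :: "'z set"
    by (simp add: copower_def ideal_module_def)
  have sm: "r \<odot>\<^bsub>?P L\<^esub> f = (\<lambda>i\<in>L. r \<otimes>\<^bsub>R\<^esub> f i)" for r f and L :: "'z set"
    by (simp add: copower_def ideal_module_def)
  have addcl: "f \<oplus>\<^bsub>?P L\<^esub> g \<in> carrier (?P L)"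
    if "f \<in> carrier (?P L)" "g \<in> carrier (?P L)" for f g and L :: "'z set"
  proof -
    have "{i\<in>L. f i \<oplus>\<^bsub>R\<^esub> g i \<noteq> ?z} \<subseteq> {i\<in>L. f i \<noteq> ?z} \<union> {i\<in>L. g i \<noteq> ?z}" by auto
    then have "finite {i\<in>L. f i \<oplus>\<^bsub>R\<^esub> g i \<noteq> ?z}"
      by (rule finite_subset) (use that in \<open>simp add: mem\<close>)
    then show ?thesis using that
      by (auto simp: mem add PiE_iff intro!: I.a_closed cong: conj_cong)
  qed
  define single :: "'i \<Rightarrow> 'r \<Rightarrow> 'i \<Rightarrow> 'r" where "single l x = (\<lambda>i\<in>\<Lambda>. if i = l then x else ?z)" for l x
  have single: "single l x \<in> carrier (?P \<Lambda>)" if "x \<in> I" for l x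
  proof -
    have "finite {i \<in> \<Lambda>. single l x i \<noteq> ?z}"
      by (rule finite_subset[of _ "{l}"]) (auto simp: single_def)
    then show ?thesis using that by (auto simp: mem single_def)
  qed
  define cmp where "cmp l = (\<lambda>x\<in>I. h (single l x))" for l
  define L' where "L' = cmp ` \<Lambda>"
  define s where "s = inv_into \<Lambda> cmp"
  have s: "s g \<in> \<Lambda>" "cmp (s g) = g" if "g \<in> L'" for g
    using that by (auto simp: L'_def s_def inv_into_into f_inv_into_f)
  define p where "p f = (\<lambda>i\<in>\<Lambda>. if s (cmp i) = i then f (cmp i) else ?z)" for f :: "('r \<Rightarrow> 'a) \<Rightarrow> 'r"
  have cL: "cmp i \<in> L'" if "i \<in> \<Lambda>" for i using that by (simp add: L'_def)
  have pcl: "p f \<in> carrier (?P \<Lambda>)" if f: "f \<in> carrier (?P L')" for f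
  proof -
    have "{i\<in>\<Lambda>. p f i \<noteq> ?z} \<subseteq> s ` {g\<in>L'. f g \<noteq> ?z}"
      using cL by (force simp: p_def split: if_splits)
    then have "finite {i\<in>\<Lambda>. p f i \<noteq> ?z}" by (rule finite_subset) (use f in \<open>simp add: mem\<close>)
    moreover have "p f \<in> \<Lambda> \<rightarrow>\<^sub>E I" using f cL by (auto simp: mem p_def PiE_iff)
    ultimately show ?thesis by (simp add: mem)
  qed
  have padd: "p (f \<oplus>\<^bsub>?P L'\<^esub> g) = p f \<oplus>\<^bsub>?P \<Lambda>\<^esub> p g" for f g
    using cL by (auto simp: p_def add fun_eq_iff)
  have psm: "p (r \<odot>\<^bsub>?P L'\<^esub> f) = r \<odot>\<^bsub>?P \<Lambda>\<^esub> p f" if "r \<in> carrier R" for r f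
    using cL that by (auto simp: p_def sm fun_eq_iff)
  have hcl: "h f \<in> carrier M" if "f \<in> carrier (?P \<Lambda>)" for f
    using h that by (auto simp: mod_hom_def)
  have hadd: "h (f \<oplus>\<^bsub>?P \<Lambda>\<^esub> g) = h f \<oplus>\<^bsub>M\<^esub> h g"
    if "f \<in> carrier (?P \<Lambda>)" "g \<in> carrier (?P \<Lambda>)" for f g
    using h that by (auto simp: mod_hom_def)
  have hsm: "h (r \<odot>\<^bsub>?P \<Lambda>\<^esub> f) = r \<odot>\<^bsub>M\<^esub> h f" if "r \<in> carrier R" "f \<in> carrier (?P \<Lambda>)" for r f
    using h that by (auto simp: mod_hom_def)
  have hp: "h \<circ> p \<in> mod_hom R (?P L') M"
    using pcl hcl hadd hsm padd psm by (auto simp: mod_hom_def)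
  let ?Im = "(h \<circ> p) ` carrier (?P L')"
  have Imadd: "x \<oplus>\<^bsub>M\<^esub> y \<in> ?Im" if xy: "x \<in> ?Im" "y \<in> ?Im" for x y
  proof -
    obtain f g where fg: "f \<in> carrier (?P L')" "x = h (p f)" "g \<in> carrier (?P L')" "y = h (p g)"
      using xy by (elim imageE) (simp add: comp_def)
    then have "x \<oplus>\<^bsub>M\<^esub> y = (h \<circ> p) (f \<oplus>\<^bsub>?P L'\<^esub> g)" using pcl by (simp add: padd hadd)
    then show ?thesis using addcl fg by blast
  qed
  have Imsg: "h (single l x) \<in> ?Im" if "l \<in> \<Lambda>" "x \<in> I" for l x
  proof -
    note lx = that
    let ?f = "\<lambda>g\<in>L'. if g = cmp l then x else ?z"
    have "finite {g \<in> L'. ?f g \<noteq> ?z}"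
      by (rule finite_subset[of _ "{cmp l}"]) auto
    then have "?f \<in> carrier (?P L')" using that by (auto simp: mem)
    moreover have "p ?f = single (s (cmp l)) x"
    proof (rule extensionalityI[of _ \<Lambda>])
      fix i assume i: "i \<in> \<Lambda>"
      have c: "cmp (s (cmp l)) = cmp l" using s(2)[OF cL] that by blast
      show "p ?f i = single (s (cmp l)) x i"
        using i cL[OF i] c by (cases "i = s (cmp l)") (auto simp: p_def single_def)
    qed (simp_all add: p_def single_def)
    moreover have "h (single (s (cmp l)) x) = cmp (s (cmp l)) x" using that by (simp add: cmp_def)
    moreover have "cmp (s (cmp l)) x = h (single l x)" using s(2)[OF cL] that by (simp add: cmp_def)
    ultimately show ?thesis by (intro image_eqI[of _ _ ?f]) simp_all
  qed
  have Im: "h f \<in> ?Im" if "finite F" "F \<subseteq> \<Lambda>" "f \<in> carrier (?P \<Lambda>)" "\<forall>i\<in>\<Lambda> - F. f i = ?z" for f F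
    using that
  proof (induction F arbitrary: f rule: finite_induct)
    case empty
    have z: "(\<lambda>g\<in>L'. ?z) \<in> carrier (?P L')" by (auto simp: mem)
    have "p (\<lambda>g\<in>L'. ?z) = f"
      using empty cL by (auto simp: p_def mem fun_eq_iff PiE_iff extensional_def)
    then show ?case using z by (intro image_eqI[of _ _ "\<lambda>g\<in>L'. ?z"]) (simp_all only: comp_apply)
  next
    case (insert l F)
    define g where "g = (\<lambda>i\<in>\<Lambda>. if i = l then ?z else f i)"
    have fP: "f \<in> \<Lambda> \<rightarrow>\<^sub>E I" "finite {i\<in>\<Lambda>. f i \<noteq> ?z}" and l: "l \<in> \<Lambda>" "F \<subseteq> \<Lambda>"
      using insert.prems by (simp_all add: mem)
    have lI: "f l \<in> I" using fP l by auto
    have "finite {i\<in>\<Lambda>. g i \<noteq> ?z}"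
      by (rule finite_subset[OF _ fP(2)]) (auto simp: g_def)
    then have g: "g \<in> carrier (?P \<Lambda>)" using fP by (auto simp: mem g_def PiE_iff)
    have fI: "\<And>i. i \<in> \<Lambda> \<Longrightarrow> f i \<in> carrier R" using fP IR by (auto simp: PiE_iff)
    have "f = single l (f l) \<oplus>\<^bsub>?P \<Lambda>\<^esub> g"
    proof (rule extensionalityI[of _ \<Lambda>])
      show "f \<in> extensional \<Lambda>" using fP by (auto simp: PiE_iff)
    qed (use fI in \<open>auto simp: add single_def g_def\<close>)
    then have "h f = h (single l (f l)) \<oplus>\<^bsub>M\<^esub> h g" by (rule trans[OF arg_cong[of _ _ h] hadd[OF single[OF lI] g]])
    moreover have "h g \<in> ?Im" 
    proof (rule insert.IH[OF l(2) g])
      show "\<forall>i\<in>\<Lambda> - F. g i = ?z" using insert.prems(3) by (simp add: g_def)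
    qed
    ultimately show ?case using Imadd[OF Imsg[OF l(1) lI]] by simp
  qed
  have "?Im = carrier M"
  proof
    show "?Im \<subseteq> carrier M" using hcl pcl by auto
    show "carrier M \<subseteq> ?Im"
    proof
      fix x assume "x \<in> carrier M"
      then obtain f where f: "f \<in> carrier (?P \<Lambda>)" "x = h f" using surj by blast
      have "h f \<in> ?Im"
      proof (rule Im)
        show "finite {i\<in>\<Lambda>. f i \<noteq> ?z}" using f(1) by (simp add: mem)
      qed (use f(1) in auto)
      then show "x \<in> ?Im" by (simp only: f(2))
    qed
  qed
  then show ?thesis
    unfolding I_generated_def by (intro conjI M exI[of _ L'] exI[of _ "h \<circ> p"] hp)
qed


section \<open>Independence of the type of the test modules\<close>

text \<open>
  The double character module of \<open>N\<close> contains \<open>N\<close> as a pure submodule, and maps into it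
  extend along pure embeddings of modules of any type, by compactness of a power of the
  unit circle.  If \<open>N\<close> is pure-injective, it is a retract of its double character module
  and inherits this extension property.
\<close>

lemma circle_compactness:
  fixes F :: "(('x \<Rightarrow> complex) \<Rightarrow> complex) set"
  assumes cont: "\<And>f. f \<in> F \<Longrightarrow> continuous_on UNIV f"
    and fin: "\<And>F'. finite F' \<Longrightarrow> F' \<subseteq> F \<Longrightarrow> \<exists>v. (\<forall>x. cmod (v x) = 1) \<and> (\<forall>f\<in>F'. f v = 0)"
  shows "\<exists>v. (\<forall>x. cmod (v x) = 1) \<and> (\<forall>f\<in>F. f v = 0)"
proof -
  have eq: "PiE UNIV (\<lambda>_. sphere 0 1) = {v :: 'x \<Rightarrow> complex. \<forall>x. cmod (v x) = 1}"
    by (auto simp: PiE_def extensional_def)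
  have "compactin (product_topology (\<lambda>_::'x. euclidean) UNIV) (PiE UNIV (\<lambda>_. sphere (0::complex) 1))"
    by (simp add: compactin_PiE)
  then have "compact {v :: 'x \<Rightarrow> complex. \<forall>x. cmod (v x) = 1}"
    by (simp add: euclidean_product_topology eq)
  then have "{v :: 'x \<Rightarrow> complex. \<forall>x. cmod (v x) = 1} \<inter> (\<Inter>f\<in>F. {v. f v = 0}) \<noteq> {}"
  proof (rule compact_imp_fip_image)
    show "closed {v. f v = 0}" if "f \<in> F" for f
      using cont[OF that] by (intro closed_Collect_eq continuous_on_const)
    show "{v. \<forall>x. cmod (v x) = 1} \<inter> (\<Inter>f\<in>F'. {v. f v = 0}) \<noteq> {}"
      if "finite F'" "F' \<subseteq> F" for F'
      using fin[OF that] by auto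
  qed
  then show ?thesis by auto
qed

text \<open>Partial characters of an abelian group, defined on a subgroup.\<close>

definition pchar :: "('a, 'm) monoid_scheme \<Rightarrow> 'a set \<Rightarrow> ('a \<Rightarrow> complex) \<Rightarrow> bool" where
  "pchar G K c \<longleftrightarrow> subgroup K G \<and> (\<forall>x\<in>K. cmod (c x) = 1) \<and>
     (\<forall>x\<in>K. \<forall>y\<in>K. c (x \<otimes>\<^bsub>G\<^esub> y) = c x * c y)"

lemma (in comm_group) pchar_one: "pchar G K c \<Longrightarrow> c \<one> = 1"
proof -
  assume p: "pchar G K c"
  then have "\<one> \<in> K" by (simp add: pchar_def subgroup.one_closed)
  then have "c \<one> = c \<one> * c \<one>" "cmod (c \<one>) = 1"
    using p by (force simp: pchar_def subgroup.subset[THEN subsetD])+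
  then show ?thesis by auto
qed

lemma (in comm_group) pchar_extend1:
  assumes p: "pchar G K c" and y: "y \<in> carrier G" and z: "cmod z = 1"
    and zc: "\<And>j::int. y [^] j \<in> K \<Longrightarrow> c (y [^] j) = z powi j"
  shows "\<exists>K' c'. pchar G K' c' \<and> K \<subseteq> K' \<and> y \<in> K' \<and> (\<forall>x\<in>K. c' x = c x) \<and> c' y = z"
proof -
  have K: "subgroup K G" using p by (simp add: pchar_def)
  note Kc = subgroup.mem_carrier[OF K] and Km = subgroup.m_closed[OF K]
    and Ki = subgroup.m_inv_closed[OF K] and K1 = subgroup.one_closed[OF K]
  have z0: "z \<noteq> 0" using z by auto
  have cm: "c (a \<otimes> b) = c a * c b" if "a \<in> K" "b \<in> K" for a b
    using p that by (simp add: pchar_def)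
  have cn: "cmod (c a) = 1" if "a \<in> K" for a using p that by (simp add: pchar_def)
  define K' where "K' = {k \<otimes> y [^] (j::int) | k j. k \<in> K}"
  have wd: "c k * z powi i = c k' * z powi j"
    if "k \<in> K" "k' \<in> K" and e: "k \<otimes> y [^] (i::int) = k' \<otimes> y [^] (j::int)" for k k' i j
  proof -
    have kc: "k \<in> carrier G" "k' \<in> carrier G" using that Kc by auto
    have "y [^] (i - j) = inv k \<otimes> k'"
    proof -
      have "inv k \<otimes> k' = inv k \<otimes> (k' \<otimes> y [^] j \<otimes> inv (y [^] j))"
        using kc y by (simp add: m_assoc)
      also have "\<dots> = inv k \<otimes> (k \<otimes> y [^] i \<otimes> inv (y [^] j))" by (simp add: e)
      also have "\<dots> = inv k \<otimes> (k \<otimes> (y [^] i \<otimes> inv (y [^] j)))"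
        using kc y by (simp add: m_assoc)
      also have "\<dots> = y [^] i \<otimes> inv (y [^] j)"
        using kc y by (subst inv_solve_left') auto
      also have "\<dots> = y [^] (i - j)" using kc y by (simp add: int_pow_diff)
      finally show ?thesis ..
    qed
    moreover have "inv k \<otimes> k' \<in> K" using that Km Ki by auto
    ultimately have a: "c (inv k \<otimes> k') = z powi (i - j)" using zc by metis
    have "c k * c (inv k \<otimes> k') = c k'"
      using cm[OF that(1) \<open>inv k \<otimes> k' \<in> K\<close>] kc by (simp flip: m_assoc)
    then have "c k' * z powi j = c k * (z powi (i - j) * z powi j)" by (simp add: a)
    also have "z powi (i - j) * z powi j = z powi i" using z0 by (simp flip: power_int_add)
    finally show ?thesis ..
  qed
  have "\<exists>w. \<forall>k\<in>K. \<forall>j::int. x = k \<otimes> y [^] j \<longrightarrow> w = c k * z powi j" for x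
  proof (cases "x \<in> K'")
    case True
    then obtain k j where k: "k \<in> K" "x = k \<otimes> y [^] (j::int)" by (auto simp: K'_def)
    have "c k * z powi j = c k' * z powi j'" if "k' \<in> K" "x = k' \<otimes> y [^] (j'::int)" for k' j'
      by (rule wd) (use k that in simp_all)
    then show ?thesis by blast
  next
    case False
    then show ?thesis by (auto simp: K'_def)
  qed
  then obtain c' where c': "\<And>k j. k \<in> K \<Longrightarrow> c' (k \<otimes> y [^] (j::int)) = c k * z powi j" by metis
  have mul: "(k \<otimes> y [^] i) \<otimes> (k' \<otimes> y [^] j) = (k \<otimes> k') \<otimes> y [^] (i + j)"
    if "k \<in> K" "k' \<in> K" for k k' and i j :: int
    using that Kc y by (simp add: int_pow_mult m_ac)
  have sub: "subgroup K' G"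
  proof (rule subgroupI)
    show "K' \<subseteq> carrier G" using Kc y by (auto simp: K'_def)
    show "K' \<noteq> {}" using K1 by (auto simp: K'_def)
    show "inv a \<in> K'" if "a \<in> K'" for a
    proof -
      obtain k j where k: "k \<in> K" "a = k \<otimes> y [^] (j::int)" using \<open>a \<in> K'\<close> by (auto simp: K'_def)
      have "inv a = inv k \<otimes> y [^] (-j)" using k Kc y by (simp add: inv_mult int_pow_neg)
      then show ?thesis using k Ki unfolding K'_def by blast
    qed
    show "a \<otimes> b \<in> K'" if ab: "a \<in> K'" "b \<in> K'" for a b
    proof -
      obtain k j where k: "k \<in> K" "a = k \<otimes> y [^] (j::int)" using ab by (auto simp: K'_def)
      obtain k' j' where k': "k' \<in> K" "b = k' \<otimes> y [^] (j'::int)" using ab by (auto simp: K'_def)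
      have "a \<otimes> b = (k \<otimes> k') \<otimes> y [^] (j + j')" using mul k k' by simp
      then show ?thesis using k k' Km unfolding K'_def by blast
    qed
  qed
  have KK': "k \<in> K' \<and> c' k = c k" if "k \<in> K" for k
  proof -
    have e: "k = k \<otimes> y [^] (0::int)" using that Kc by simp
    have "k \<in> K'" unfolding K'_def using that e by blast
    moreover have "c' k = c k" using c'[OF that, of 0] e by simp
    ultimately show ?thesis ..
  qed
  have e: "y = \<one> \<otimes> y [^] (1::int)" using y by simp
  have yK': "y \<in> K'" unfolding K'_def using K1 e by blast
  have c'y: "c' y = z" using c'[OF K1, of 1] e pchar_one[OF p] by simp
  have norm: "cmod (c' x) = 1" if "x \<in> K'" for x
    using that c' cn z by (auto simp: K'_def norm_mult norm_power_int)
  have mult: "c' (a \<otimes> b) = c' a * c' b" if ab: "a \<in> K'" "b \<in> K'" for a b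
  proof -
    obtain k j where k: "k \<in> K" "a = k \<otimes> y [^] (j::int)" using ab by (auto simp: K'_def)
    obtain k' j' where k': "k' \<in> K" "b = k' \<otimes> y [^] (j'::int)" using ab by (auto simp: K'_def)
    show ?thesis
      using mul[OF k(1) k'(1)] k k' c' Km cm z0 by (simp add: power_int_add)
  qed
  have "pchar G K' c'" unfolding pchar_def using sub norm mult by blast
  then show ?thesis using KK' yK' c'y by blast
qed

lemma (in comm_group) powers_in_subgroup:
  assumes K: "subgroup K G" and y: "y \<in> carrier G"
  shows "\<exists>n::nat. \<forall>j::int. y [^] j \<in> K \<longleftrightarrow> int n dvd j"
proof (cases "\<exists>n::nat. n > 0 \<and> y [^] int n \<in> K")
  case False
  have "j = 0" if "y [^] j \<in> K" for j :: int
  proof (rule ccontr)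
    assume "j \<noteq> 0"
    have "y [^] (-j) \<in> K" using subgroup.m_inv_closed[OF K that] y by (simp add: int_pow_neg)
    then have "y [^] int (nat \<bar>j\<bar>) \<in> K" using that by (auto simp: abs_if)
    then show False using False \<open>j \<noteq> 0\<close> by (meson zero_less_nat_eq zero_less_abs_iff)
  qed
  then show ?thesis using subgroup.one_closed[OF K] by (intro exI[of _ 0]) auto
next
  case True
  define n where "n = (LEAST n::nat. n > 0 \<and> y [^] int n \<in> K)"
  have n: "n > 0" "y [^] int n \<in> K" using LeastI_ex[OF True] by (auto simp: n_def)
  have least: "\<not> (m > 0 \<and> y [^] int m \<in> K)" if "m < n" for m
    using not_less_Least[of m] that unfolding n_def by blast
  have pw: "y [^] (int n * i) \<in> K" for i
  proof -
    have "(y [^] int n) [^] i \<in> K"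
      using n(2) K by (metis subgroup_int_pow_closed)
    then show ?thesis using y by (simp add: int_pow_pow)
  qed
  have "int n dvd j" if "y [^] j \<in> K" for j
  proof -
    have "y [^] (j mod int n) = y [^] j \<otimes> inv (y [^] (int n * (j div int n)))"
      using y by (metis int_pow_diff minus_mult_div_eq_mod)
    then have "y [^] (j mod int n) \<in> K"
      using that pw K by (simp add: subgroup.m_closed subgroup.m_inv_closed)
    moreover have "j mod int n = int (nat (j mod int n))" using n by simp
    moreover have "nat (j mod int n) < n" using n by (simp add: nat_less_iff)
    ultimately have "nat (j mod int n) = 0" using least by (metis neq0_conv)
    then show ?thesis using n by (simp add: dvd_eq_mod_eq_0) (use \<open>j mod int n = int (nat (j mod int n))\<close> in linarith)
  qed
  then show ?thesis using pw by (metis dvdE)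
qed

lemma circle_root:
  assumes "cmod w = 1" "n > 0"
  shows "\<exists>z. z ^ n = w \<and> cmod z = 1"
proof -
  have "w \<noteq> 0" using assms by auto
  then have "w = cis (Arg w)" using assms by (simp add: cis_Arg sgn_eq)
  then obtain t where t: "w = cis t" by blast
  have "real n * (t / n) = t" using assms by simp
  then have "cis (t / n) ^ n = w" using t by (simp only: Complex.DeMoivre)
  then show ?thesis by (metis norm_cis)
qed

lemma (in comm_group) pchar_extend:
  assumes p: "pchar G K c" and y: "y \<in> carrier G"
  shows "\<exists>K' c'. pchar G K' c' \<and> K \<subseteq> K' \<and> y \<in> K' \<and> (\<forall>x\<in>K. c' x = c x)"
proof -
  have K: "subgroup K G" using p by (simp add: pchar_def)
  obtain n :: nat where n: "\<And>j::int. y [^] j \<in> K \<longleftrightarrow> int n dvd j"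
    using powers_in_subgroup[OF K y] by blast
  have yn: "y [^] int n \<in> K" using n by simp
  then have c1: "cmod (c (y [^] int n)) = 1" using p by (simp add: pchar_def)
  have "\<exists>z. z ^ n = c (y [^] int n) \<and> cmod z = 1"
  proof (cases "n = 0")
    case True
    then show ?thesis using pchar_one[OF p] by (auto intro: exI[of _ 1])
  next
    case False
    then show ?thesis using circle_root[OF c1] by auto
  qed
  then obtain z where z: "z ^ n = c (y [^] int n)" "cmod z = 1" by blast
  have nat: "c (x [^] (m::nat)) = c x ^ m" if "x \<in> K" for x m
  proof (induction m)
    case 0 then show ?case using pchar_one[OF p] by simp
  next
    case (Suc m)
    have "x [^] m \<in> K" using that by (induction m) (auto simp: subgroup.one_closed[OF K] subgroup.m_closed[OF K])
    then show ?case using Suc p that by (simp add: pchar_def)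
  qed
  have inv: "c (inv x) = inverse (c x)" if "x \<in> K" for x
  proof -
    have "c (x \<otimes> inv x) = c x * c (inv x)"
      using p that subgroup.m_inv_closed[OF K that] by (simp add: pchar_def)
    then show ?thesis
      using pchar_one[OF p] subgroup.mem_carrier[OF K that]
      by (simp add: inverse_unique)
  qed
  have int: "c (x [^] (i::int)) = c x powi i" if "x \<in> K" for x i
  proof (cases i rule: int_cases2)
    case (nonneg m) then show ?thesis using nat[OF that] by (simp add: int_pow_int)
  next
    case (nonpos m)
    have "x [^] m \<in> K" using that by (induction m) (auto simp: subgroup.one_closed[OF K] subgroup.m_closed[OF K])
    then show ?thesis using nonpos nat[OF that] inv subgroup.mem_carrier[OF K that]
      by (simp add: int_pow_neg_int power_int_minus)
  qed
  have "c (y [^] j) = z powi j" if j: "y [^] j \<in> K" for j :: int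
  proof -
    obtain i where i: "j = int n * i" using n j by (auto elim: dvdE)
    have "c (y [^] j) = c ((y [^] int n) [^] i)" using y by (simp add: i int_pow_pow)
    also have "\<dots> = (z ^ n) powi i" using int[OF yn] by (simp add: z)
    also have "\<dots> = z powi j" by (simp add: i power_int_mult)
    finally show ?thesis .
  qed
  then show ?thesis using pchar_extend1[OF p y z(2)] by blast
qed

lemma (in comm_group) pchar_separate:
  assumes H: "subgroup H G" and x: "x \<in> carrier G" "x \<notin> H"
  shows "\<exists>K c. pchar G K c \<and> H \<subseteq> K \<and> x \<in> K \<and> (\<forall>h\<in>H. c h = 1) \<and> c x \<noteq> 1"
proof -
  have p: "pchar G H (\<lambda>_. 1)" using H by (simp add: pchar_def)
  obtain n :: nat where n: "\<And>j::int. x [^] j \<in> H \<longleftrightarrow> int n dvd j"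
    using powers_in_subgroup[OF H x(1)] by blast
  have n1: "n \<noteq> 1" using n[of 1] x by auto
  have "\<exists>z. z ^ n = 1 \<and> cmod z = 1 \<and> z \<noteq> 1"
  proof (cases "n = 0")
    case True
    then show ?thesis by (intro exI[of _ "-1"]) auto
  next
    case False
    then have n2: "n \<ge> 2" using n1 by linarith
    have "real n * (2 * pi / n) = 2 * pi" using False by simp
    then have "cis (2 * pi / n) ^ n = 1" by (simp only: Complex.DeMoivre cis_2pi)
    moreover have "cis (2 * pi / n) \<noteq> 1"
    proof
      assume "cis (2 * pi / n) = 1"
      then have "cos (2 * pi / n) = 1" by (simp add: complex_eq_iff)
      then obtain k :: int where "2 * pi / n = of_int k * 2 * pi" by (auto simp: cos_one_2pi_int)
      then have "1 = real_of_int k * n" using False by (simp add: field_simps)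
      then have "1 = k * int n" by (metis of_int_1 of_int_eq_iff of_int_mult of_int_of_nat_eq)
      then have "int n dvd 1" by (metis dvd_triv_right)
      then show False using n2 by simp
    qed
    ultimately show ?thesis by (metis norm_cis)
  qed
  then obtain z where z: "z ^ n = 1" "cmod z = 1" "z \<noteq> 1" by blast
  have "1 = z powi j" if j: "x [^] j \<in> H" for j :: int
  proof -
    obtain i where "j = int n * i" using n j by (auto elim: dvdE)
    then show ?thesis using z by (simp add: power_int_mult)
  qed
  from pchar_extend1[OF p x(1) z(2) this] z(3) show ?thesis by metis
qed

lemma (in comm_group) char_separate:
  assumes H: "subgroup H G" and x: "x \<in> carrier G" "x \<notin> H"
  shows "\<exists>c. (\<forall>a\<in>carrier G. cmod (c a) = 1) \<and>
     (\<forall>a\<in>carrier G. \<forall>b\<in>carrier G. c (a \<otimes> b) = c a * c b) \<and> (\<forall>h\<in>H. c h = 1) \<and> c x \<noteq> 1"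
proof -
  obtain K0 c0 where 0: "pchar G K0 c0" "H \<subseteq> K0" "x \<in> K0" "\<And>h. h \<in> H \<Longrightarrow> c0 h = 1" "c0 x \<noteq> 1"
    using pchar_separate[OF assms] by metis
  have ext: "\<exists>K c. pchar G K c \<and> K0 \<subseteq> K \<and> S \<subseteq> K \<and> (\<forall>a\<in>K0. c a = c0 a)"
    if "finite S" "S \<subseteq> carrier G" for S
    using that
  proof (induction S rule: finite_induct)
    case empty then show ?case using 0 by blast
  next
    case (insert y S)
    then obtain K c where Kc: "pchar G K c" "K0 \<subseteq> K" "S \<subseteq> K" "\<forall>a\<in>K0. c a = c0 a" by auto
    obtain K' c' where "pchar G K' c'" "K \<subseteq> K'" "y \<in> K'" "\<forall>x\<in>K. c' x = c x"
      using pchar_extend[OF Kc(1), of y] insert by auto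
    then show ?case using Kc by (intro exI[of _ K'] exI[of _ c']) auto
  qed
  define f1 where "f1 = (\<lambda>(a, b) (v :: 'a \<Rightarrow> complex). v (a \<otimes> b) - v a * v b)"
  define f2 where "f2 = (\<lambda>a (v :: 'a \<Rightarrow> complex). v a - c0 a)"
  let ?F = "f1 ` (carrier G \<times> carrier G) \<union> f2 ` K0"
  have "\<exists>v. (\<forall>x. cmod (v x) = 1) \<and> (\<forall>f\<in>?F. f v = 0)"
  proof (rule circle_compactness)
    show "continuous_on UNIV f" if "f \<in> ?F" for f
      using that by (auto simp: f1_def f2_def intro!: continuous_intros)
    show "\<exists>v. (\<forall>x. cmod (v x) = 1) \<and> (\<forall>f\<in>F'. f v = 0)" if F': "finite F'" "F' \<subseteq> ?F" for F'
    proof -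
      have "finite (F' \<inter> f1 ` (carrier G \<times> carrier G))" using F' by simp
      from finite_subset_image[OF this, of f1] obtain P
        where P: "finite P" "P \<subseteq> carrier G \<times> carrier G" "F' \<inter> f1 ` (carrier G \<times> carrier G) = f1 ` P"
        by (metis inf_le2)
      define S where "S = fst ` P \<union> snd ` P \<union> (\<lambda>(a,b). a \<otimes> b) ` P"
      have "finite S" "S \<subseteq> carrier G" using P by (auto simp: S_def)
      from ext[OF this] obtain K c where Kc: "pchar G K c" "K0 \<subseteq> K" "S \<subseteq> K" "\<forall>a\<in>K0. c a = c0 a"
        by blast
      define v where "v a = (if a \<in> K then c a else 1)" for a
      have "cmod (v a) = 1" for a using Kc(1) by (simp add: v_def pchar_def)
      moreover have "f v = 0" if "f \<in> F'" for f
      proof (cases "f \<in> f1 ` (carrier G \<times> carrier G)")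
        case True
        then obtain a b where ab: "(a, b) \<in> P" "f = f1 (a, b)" using P \<open>f \<in> F'\<close> by blast
        then have "a \<in> S" "b \<in> S" "a \<otimes> b \<in> S" by (force simp: S_def)+
        then have "a \<in> K" "b \<in> K" "a \<otimes> b \<in> K" using Kc(3) by auto
        then show ?thesis using Kc(1) by (simp add: ab f1_def v_def pchar_def)
      next
        case False
        then have "f \<in> f2 ` K0" using F' that by auto
        then show ?thesis using Kc by (auto simp: f2_def v_def)
      qed
      ultimately show ?thesis by blast
    qed
  qed
  then obtain v where v: "\<And>x. cmod (v x) = 1" "\<And>f. f \<in> ?F \<Longrightarrow> f v = 0" by blast
  have "v (a \<otimes> b) = v a * v b" if "a \<in> carrier G" "b \<in> carrier G" for a b
  proof -
    have "f1 (a, b) \<in> ?F" using that by blast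
    from v(2)[OF this] show ?thesis by (simp add: f1_def)
  qed
  moreover have "v a = c0 a" if "a \<in> K0" for a
  proof -
    have "f2 a \<in> ?F" using that by blast
    from v(2)[OF this] show ?thesis by (simp add: f2_def)
  qed
  ultimately show ?thesis using v(1) 0 by (intro exI[of _ v]) auto
qed

lemma pure_finite:
  fixes R :: "('r, 'x) ring_scheme" and B :: "('r, 'b) module"
  assumes B: "module R B" and pure: "pure_submodule R A B"
    and S: "finite S" "S \<subseteq> carrier B" and C: "finite C"
    and c: "\<And>c s. c \<in> C \<Longrightarrow> s \<in> S \<Longrightarrow> c s \<in> carrier R"
    and e: "\<And>c. c \<in> C \<Longrightarrow> (\<Oplus>\<^bsub>B\<^esub>s\<in>S. c s \<odot>\<^bsub>B\<^esub> s) \<in> A"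
  shows "\<exists>t. (\<forall>s\<in>S. t s \<in> A) \<and>
    (\<forall>c\<in>C. (\<Oplus>\<^bsub>B\<^esub>s\<in>S. c s \<odot>\<^bsub>B\<^esub> t s) = (\<Oplus>\<^bsub>B\<^esub>s\<in>S. c s \<odot>\<^bsub>B\<^esub> s))"
proof -
  interpret module R B by fact
  obtain h n where h: "bij_betw h {..<n::nat} S"
    using ex_bij_betw_nat_finite[OF S(1)] by (auto simp: atLeast0LessThan)
  obtain g m where g: "bij_betw g {..<m::nat} C"
    using ex_bij_betw_nat_finite[OF C] by (auto simp: atLeast0LessThan)
  have hS: "h j \<in> S" if "j < n" for j using h that by (auto dest: bij_betwE)
  have gC: "g i \<in> C" if "i < m" for i using g that by (auto dest: bij_betwE)
  have AB: "A \<subseteq> carrier B"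
    using pure submoduleE(1) by (simp add: pure_submodule_def)
  have re: "(\<Oplus>\<^bsub>B\<^esub>s\<in>S. c s \<odot>\<^bsub>B\<^esub> t s) = (\<Oplus>\<^bsub>B\<^esub>j\<in>{..<n}. c (h j) \<odot>\<^bsub>B\<^esub> t (h j))"
    if "c \<in> C" "\<And>s. s \<in> S \<Longrightarrow> t s \<in> carrier B" for c t
  proof -
    have "S = h ` {..<n}" using h by (simp add: bij_betw_def)
    moreover have "inj_on h {..<n}" using h by (simp add: bij_betw_def)
    moreover have "(\<lambda>s. c s \<odot>\<^bsub>B\<^esub> t s) \<in> S \<rightarrow> carrier B" using that assms by auto
    ultimately show ?thesis using M.finsum_reindex[of "\<lambda>s. c s \<odot>\<^bsub>B\<^esub> t s" h "{..<n}"] by simp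
  qed
  have "\<exists>b. (\<forall>j<n. b j \<in> A) \<and>
     (\<forall>i<m. (\<Oplus>\<^bsub>B\<^esub>j\<in>{..<n}. g i (h j) \<odot>\<^bsub>B\<^esub> b j) = (\<Oplus>\<^bsub>B\<^esub>s\<in>S. g i s \<odot>\<^bsub>B\<^esub> s))"
  proof (rule pure[unfolded pure_submodule_def, THEN conjunct2, rule_format])
    show "g i (h j) \<in> carrier R" if "i < m" "j < n" for i j using that c gC hS by blast
    show "(\<Oplus>\<^bsub>B\<^esub>s\<in>S. g i s \<odot>\<^bsub>B\<^esub> s) \<in> A" if "i < m" for i using that e gC by blast
    show "\<exists>b. (\<forall>j<n. b j \<in> carrier B) \<and>
       (\<forall>i<m. (\<Oplus>\<^bsub>B\<^esub>j\<in>{..<n}. g i (h j) \<odot>\<^bsub>B\<^esub> b j) = (\<Oplus>\<^bsub>B\<^esub>s\<in>S. g i s \<odot>\<^bsub>B\<^esub> s))"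
    proof (intro exI[of _ h] conjI allI impI)
      show "h j \<in> carrier B" if "j < n" for j using hS[OF that] S by auto
      show "(\<Oplus>\<^bsub>B\<^esub>j\<in>{..<n}. g i (h j) \<odot>\<^bsub>B\<^esub> h j) = (\<Oplus>\<^bsub>B\<^esub>s\<in>S. g i s \<odot>\<^bsub>B\<^esub> s)"
        if "i < m" for i
        by (rule re[OF gC[OF that], of "\<lambda>s. s", symmetric]) (use S in auto)
    qed
  qed
  then obtain b where b: "\<And>j. j < n \<Longrightarrow> b j \<in> A"
    "\<And>i. i < m \<Longrightarrow> (\<Oplus>\<^bsub>B\<^esub>j\<in>{..<n}. g i (h j) \<odot>\<^bsub>B\<^esub> b j) = (\<Oplus>\<^bsub>B\<^esub>s\<in>S. g i s \<odot>\<^bsub>B\<^esub> s)"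
    by blast
  define t where "t s = b (the_inv_into {..<n} h s)" for s
  have th: "t (h j) = b j" if "j < n" for j
    using h that by (simp add: t_def bij_betw_def the_inv_into_f_f)
  have Sh: "\<exists>j<n. s = h j" if "s \<in> S" for s
    using h that by (force simp: bij_betw_def)
  have tA: "t s \<in> A" if "s \<in> S" for s using Sh[OF that] th b by metis
  moreover have "(\<Oplus>\<^bsub>B\<^esub>s\<in>S. c s \<odot>\<^bsub>B\<^esub> t s) = (\<Oplus>\<^bsub>B\<^esub>s\<in>S. c s \<odot>\<^bsub>B\<^esub> s)" if cC: "c \<in> C" for c
  proof -
    obtain i where i: "i < m" "c = g i" using g cC by (force simp: bij_betw_def)
    have "(\<Oplus>\<^bsub>B\<^esub>s\<in>S. c s \<odot>\<^bsub>B\<^esub> t s) = (\<Oplus>\<^bsub>B\<^esub>j\<in>{..<n}. c (h j) \<odot>\<^bsub>B\<^esub> t (h j))"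
      using re[OF cC] tA AB by blast
    also have "\<dots> = (\<Oplus>\<^bsub>B\<^esub>j\<in>{..<n}. c (h j) \<odot>\<^bsub>B\<^esub> b j)"
    proof (rule M.finsum_cong')
      show "(\<lambda>j. c (h j) \<odot>\<^bsub>B\<^esub> b j) \<in> {..<n} \<rightarrow> carrier B"
        using b AB c[OF cC] hS by (auto intro!: smult_closed)
    qed (auto simp: th)
    finally show ?thesis using b i by simp
  qed
  ultimately show ?thesis by blast
qed

lemma pure_retract_finite:
  fixes R :: "('r, 'x) ring_scheme" and B :: "('r, 'b) module"
  assumes B: "module R B" and pure: "pure_submodule R A B"
    and EA: "finite EA" "EA \<subseteq> carrier B \<times> carrier B"
    and ES: "finite ES" "ES \<subseteq> carrier R \<times> carrier B"
    and EF: "finite EF" "EF \<subseteq> A"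
  shows "\<exists>t. (\<forall>x. t x \<in> A) \<and>
     (\<forall>(b, b')\<in>EA. t (b \<oplus>\<^bsub>B\<^esub> b') = t b \<oplus>\<^bsub>B\<^esub> t b') \<and>
     (\<forall>(r, b)\<in>ES. t (r \<odot>\<^bsub>B\<^esub> b) = r \<odot>\<^bsub>B\<^esub> t b) \<and> (\<forall>a\<in>EF. t a = a)"
proof -
  interpret module R B by fact
  have sub: "submodule A R B" using pure by (simp add: pure_submodule_def)
  have AB: "A \<subseteq> carrier B" using submoduleE(1)[OF sub] .
  have A0: "\<zero>\<^bsub>B\<^esub> \<in> A" using sub by (metis subgroup.one_closed submodule.axioms(1) monoid.simps(2))
  define S where "S = fst ` EA \<union> snd ` EA \<union> (\<lambda>(b, b'). b \<oplus>\<^bsub>B\<^esub> b') ` EA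
     \<union> snd ` ES \<union> (\<lambda>(r, b). r \<odot>\<^bsub>B\<^esub> b) ` ES \<union> EF"
  have S: "finite S" "S \<subseteq> carrier B" using EA ES EF AB by (auto simp: S_def)
  define \<delta> where "\<delta> p s = (if s = p then \<one>\<^bsub>R\<^esub> else \<zero>\<^bsub>R\<^esub>)" for p s :: 'b
  define lin where "lin r c d s = c s \<oplus>\<^bsub>R\<^esub> r \<otimes>\<^bsub>R\<^esub> d s" for r and c d :: "'b \<Rightarrow> 'r" and s
  define ca where "ca = (\<lambda>(b, b'). lin (\<ominus>\<^bsub>R\<^esub> \<one>\<^bsub>R\<^esub>) (\<delta> (b \<oplus>\<^bsub>B\<^esub> b')) (lin \<one>\<^bsub>R\<^esub> (\<delta> b) (\<delta> b')))"
  define cs where "cs = (\<lambda>(r, b). lin (\<ominus>\<^bsub>R\<^esub> r) (\<delta> (r \<odot>\<^bsub>B\<^esub> b)) (\<delta> b))"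
  have \<delta>R: "\<delta> p s \<in> carrier R" for p s by (simp add: \<delta>_def)
  have linR: "lin r c d s \<in> carrier R"
    if "r \<in> carrier R" "\<And>s. c s \<in> carrier R" "\<And>s. d s \<in> carrier R" for r c d s
    using that by (simp add: lin_def)
  define ev where "ev c t = (\<Oplus>\<^bsub>B\<^esub>s\<in>S. c s \<odot>\<^bsub>B\<^esub> t s)" for c :: "'b \<Rightarrow> 'r" and t
  have ev\<delta>: "ev (\<delta> p) t = t p" if "p \<in> S" "\<And>s. s \<in> S \<Longrightarrow> t s \<in> carrier B" for p t
  proof -
    have "ev (\<delta> p) t = (\<Oplus>\<^bsub>B\<^esub>s\<in>S. if p = s then t s else \<zero>\<^bsub>B\<^esub>)"
      unfolding ev_def by (rule M.finsum_cong') (use that in \<open>auto simp: \<delta>_def\<close>)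
    also have "\<dots> = t p"
      by (rule M.finsum_singleton) (use that S in auto)
    finally show ?thesis .
  qed
  have evC: "ev c t \<in> carrier B"
    if "\<And>s. c s \<in> carrier R" "\<And>s. s \<in> S \<Longrightarrow> t s \<in> carrier B" for c t
    unfolding ev_def using that by (intro M.finsum_closed) auto
  have evlin: "ev (lin r c d) t = ev c t \<oplus>\<^bsub>B\<^esub> r \<odot>\<^bsub>B\<^esub> ev d t"
    if "r \<in> carrier R" "\<And>s. c s \<in> carrier R" "\<And>s. d s \<in> carrier R" "\<And>s. s \<in> S \<Longrightarrow> t s \<in> carrier B"
    for r c d t
  proof -
    have "ev (lin r c d) t = (\<Oplus>\<^bsub>B\<^esub>s\<in>S. c s \<odot>\<^bsub>B\<^esub> t s \<oplus>\<^bsub>B\<^esub> r \<odot>\<^bsub>B\<^esub> (d s \<odot>\<^bsub>B\<^esub> t s))"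
      unfolding ev_def
      by (rule M.finsum_cong') (use that in \<open>auto simp: lin_def smult_l_distr smult_assoc1\<close>)
    also have "\<dots> = ev c t \<oplus>\<^bsub>B\<^esub> (\<Oplus>\<^bsub>B\<^esub>s\<in>S. r \<odot>\<^bsub>B\<^esub> (d s \<odot>\<^bsub>B\<^esub> t s))"
      unfolding ev_def by (rule M.finsum_addf) (use that in auto)
    also have "(\<Oplus>\<^bsub>B\<^esub>s\<in>S. r \<odot>\<^bsub>B\<^esub> (d s \<odot>\<^bsub>B\<^esub> t s)) = r \<odot>\<^bsub>B\<^esub> ev d t"
      unfolding ev_def by (rule finsum_smult_ldistr[symmetric]) (use that S in auto)
    finally show ?thesis .
  qed
  have mem: "fst p \<in> S" "snd p \<in> S" "fst p \<oplus>\<^bsub>B\<^esub> snd p \<in> S" if "p \<in> EA" for p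
    using that by (force simp: S_def)+
  have mems: "snd p \<in> S" "fst p \<odot>\<^bsub>B\<^esub> snd p \<in> S" if "p \<in> ES" for p
    using that by (force simp: S_def)+
  have caR: "ca p s \<in> carrier R" if "p \<in> EA" for p s
    using that \<delta>R by (auto simp: ca_def lin_def split: prod.splits)
  have csR: "cs p s \<in> carrier R" if "p \<in> ES" for p s
    using that \<delta>R ES by (auto simp: cs_def lin_def split: prod.splits)
  have eva: "ev (ca p) t = t (fst p \<oplus>\<^bsub>B\<^esub> snd p) \<oplus>\<^bsub>B\<^esub> \<ominus>\<^bsub>B\<^esub> (t (fst p) \<oplus>\<^bsub>B\<^esub> t (snd p))"
    if "p \<in> EA" and t: "\<And>s. s \<in> S \<Longrightarrow> t s \<in> carrier B" for p t
    using mem[OF that(1)] t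
    by (simp add: ca_def case_prod_unfold evlin linR \<delta>R ev\<delta> smult_l_minus)
  have evs: "ev (cs p) t = t (fst p \<odot>\<^bsub>B\<^esub> snd p) \<oplus>\<^bsub>B\<^esub> \<ominus>\<^bsub>B\<^esub> (fst p \<odot>\<^bsub>B\<^esub> t (snd p))"
    if "p \<in> ES" and t: "\<And>s. s \<in> S \<Longrightarrow> t s \<in> carrier B" for p t
  proof -
    have "fst p \<in> carrier R" using that ES by auto
    then show ?thesis
      using mems[OF that(1)] t
      by (simp add: cs_def case_prod_unfold evlin linR \<delta>R ev\<delta> smult_l_minus)
  qed
  let ?C = "ca ` EA \<union> cs ` ES \<union> \<delta> ` EF"
  have "\<exists>t. (\<forall>s\<in>S. t s \<in> A) \<and>
    (\<forall>c\<in>?C. (\<Oplus>\<^bsub>B\<^esub>s\<in>S. c s \<odot>\<^bsub>B\<^esub> t s) = (\<Oplus>\<^bsub>B\<^esub>s\<in>S. c s \<odot>\<^bsub>B\<^esub> s))"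
  proof (rule pure_finite[OF B pure S])
    show "finite ?C" using EA ES EF by auto
    show "c s \<in> carrier R" if "c \<in> ?C" "s \<in> S" for c s using that caR csR \<delta>R by auto
    show "(\<Oplus>\<^bsub>B\<^esub>s\<in>S. c s \<odot>\<^bsub>B\<^esub> s) \<in> A" if c: "c \<in> ?C" for c
    proof -
      have Sid: "\<And>s. s \<in> S \<Longrightarrow> (\<lambda>s. s) s \<in> carrier B" using S by auto
      consider p where "p \<in> EA" "c = ca p" | p where "p \<in> ES" "c = cs p" | a where "a \<in> EF" "c = \<delta> a"
        using c by auto
      then have "ev c (\<lambda>s. s) \<in> A"
      proof cases
        case 1
        then have "fst p \<in> carrier B" "snd p \<in> carrier B" using EA by auto
        then show ?thesis using eva[OF 1(1) Sid] 1 A0 by (simp add: M.r_neg)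
      next
        case 2
        then have "fst p \<in> carrier R" "snd p \<in> carrier B" using ES by auto
        then show ?thesis using evs[OF 2(1) Sid] 2 A0 by (simp add: M.r_neg)
      next
        case 3
        then have "a \<in> S" by (simp add: S_def)
        then show ?thesis using ev\<delta>[OF _ Sid] 3 EF by auto
      qed
      then show ?thesis by (simp add: ev_def)
    qed
  qed
  then obtain t where t: "\<forall>s\<in>S. t s \<in> A" "\<forall>c\<in>?C. ev c t = ev c (\<lambda>s. s)"
    unfolding ev_def by (elim exE conjE)
  note tA = t(1)[THEN bspec] and tC = t(2)[THEN bspec]
  have tB: "\<And>s. s \<in> S \<Longrightarrow> t s \<in> carrier B" using tA AB by auto
  have Sid: "\<And>s. s \<in> S \<Longrightarrow> (\<lambda>s. s) s \<in> carrier B" using S by auto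
  have z: "x = y" if "x \<oplus>\<^bsub>B\<^esub> \<ominus>\<^bsub>B\<^esub> y = \<zero>\<^bsub>B\<^esub>" "x \<in> carrier B" "y \<in> carrier B" for x y
  proof -
    have "x = (x \<oplus>\<^bsub>B\<^esub> \<ominus>\<^bsub>B\<^esub> y) \<oplus>\<^bsub>B\<^esub> y" using that(2,3) by (simp add: M.a_assoc M.l_neg)
    then show ?thesis using that by simp
  qed
  have "t (b \<oplus>\<^bsub>B\<^esub> b') = t b \<oplus>\<^bsub>B\<^esub> t b'" if "(b, b') \<in> EA" for b b'
  proof (rule z)
    have "b \<in> carrier B" "b' \<in> carrier B" using that EA by auto
    then show "t (b \<oplus>\<^bsub>B\<^esub> b') \<oplus>\<^bsub>B\<^esub> \<ominus>\<^bsub>B\<^esub> (t b \<oplus>\<^bsub>B\<^esub> t b') = \<zero>\<^bsub>B\<^esub>"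
      using tC[of "ca (b, b')"] that eva[OF that tB] eva[OF that Sid] by (simp add: M.r_neg)
  qed (use mem[OF that] tB in auto)
  moreover have "t (r \<odot>\<^bsub>B\<^esub> b) = r \<odot>\<^bsub>B\<^esub> t b" if "(r, b) \<in> ES" for r b
  proof (rule z)
    have rb: "r \<in> carrier R" "b \<in> carrier B" using that ES by auto
    then show "t (r \<odot>\<^bsub>B\<^esub> b) \<oplus>\<^bsub>B\<^esub> \<ominus>\<^bsub>B\<^esub> (r \<odot>\<^bsub>B\<^esub> t b) = \<zero>\<^bsub>B\<^esub>"
      using tC[of "cs (r, b)"] that evs[OF that tB] evs[OF that Sid] by (simp add: M.r_neg)
    show "r \<odot>\<^bsub>B\<^esub> t b \<in> carrier B" using rb mems[OF that] tB by auto
  qed (use mems[OF that] tB in auto)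
  moreover have "t a = a" if "a \<in> EF" for a
    using tC[of "\<delta> a"] that ev\<delta>[OF _ tB] ev\<delta>[OF _ Sid] by (auto simp: S_def)
  moreover have "\<And>s. s \<in> S \<Longrightarrow> t s \<in> A" by (rule tA)
  ultimately show ?thesis
    using mem mems A0
    apply (intro exI[of _ "\<lambda>s. if s \<in> S then t s else \<zero>\<^bsub>B\<^esub>"])
    apply (auto split: if_splits)
    apply (auto simp: S_def)
    done
qed

text \<open>The character module, with values in the unit circle.\<close>

definition dual :: "('r, 'a) module \<Rightarrow> ('r, 'a \<Rightarrow> complex) module" where
  "dual N =
     \<lparr>carrier = {c \<in> extensional (carrier N). (\<forall>x\<in>carrier N. cmod (c x) = 1) \<and>
        (\<forall>x\<in>carrier N. \<forall>y\<in>carrier N. c (x \<oplus>\<^bsub>N\<^esub> y) = c x * c y)},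
      monoid.mult = undefined, one = undefined,
      ring.zero = (\<lambda>x\<in>carrier N. 1),
      ring.add = (\<lambda>c d. \<lambda>x\<in>carrier N. c x * d x),
      Module.module.smult = (\<lambda>r c. \<lambda>x\<in>carrier N. c (r \<odot>\<^bsub>N\<^esub> x))\<rparr>"

lemma dual_mem:
  assumes "c \<in> carrier (dual N)"
  shows "c \<in> extensional (carrier N)" "x \<in> carrier N \<Longrightarrow> cmod (c x) = 1"
    "x \<in> carrier N \<Longrightarrow> c x \<noteq> 0"
    "x \<in> carrier N \<Longrightarrow> y \<in> carrier N \<Longrightarrow> c (x \<oplus>\<^bsub>N\<^esub> y) = c x * c y"
  using assms by (force simp: dual_def)+

lemma dual_memI:
  assumes "c \<in> extensional (carrier N)" "\<And>x. x \<in> carrier N \<Longrightarrow> cmod (c x) = 1"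
    "\<And>x y. x \<in> carrier N \<Longrightarrow> y \<in> carrier N \<Longrightarrow> c (x \<oplus>\<^bsub>N\<^esub> y) = c x * c y"
  shows "c \<in> carrier (dual N)"
  using assms by (simp add: dual_def)

lemma dual_ops:
  "\<zero>\<^bsub>dual N\<^esub> \<in> extensional (carrier N)"
  "c \<oplus>\<^bsub>dual N\<^esub> d \<in> extensional (carrier N)"
  "r \<odot>\<^bsub>dual N\<^esub> c \<in> extensional (carrier N)"
  "x \<in> carrier N \<Longrightarrow> \<zero>\<^bsub>dual N\<^esub> x = 1"
  "x \<in> carrier N \<Longrightarrow> (c \<oplus>\<^bsub>dual N\<^esub> d) x = c x * d x"
  "x \<in> carrier N \<Longrightarrow> (r \<odot>\<^bsub>dual N\<^esub> c) x = c (r \<odot>\<^bsub>N\<^esub> x)"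
  by (simp_all add: dual_def)

lemma dual_module:
  assumes "module R N" shows "module R (dual N)"
proof -
  interpret module R N by fact
  note [simp] = dual_mem dual_ops norm_mult norm_inverse smult_l_distr smult_r_distr
  have add: "c \<oplus>\<^bsub>dual N\<^esub> d \<in> carrier (dual N)"
    if "c \<in> carrier (dual N)" "d \<in> carrier (dual N)" for c d
    using that by (intro dual_memI) simp_all
  have zero: "\<zero>\<^bsub>dual N\<^esub> \<in> carrier (dual N)" by (intro dual_memI) simp_all
  have smult: "r \<odot>\<^bsub>dual N\<^esub> c \<in> carrier (dual N)"
    if "r \<in> carrier R" "c \<in> carrier (dual N)" for r c
    using that by (intro dual_memI) simp_all
  note [simp] = add zero smult
  show ?thesis
  proof (rule moduleI)
    show "cring R" by (rule R.is_cring)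
    show "abelian_group (dual N)"
    proof (rule abelian_groupI)
      fix c assume c: "c \<in> carrier (dual N)"
      let ?d = "\<lambda>a\<in>carrier N. inverse (c a)"
      have "?d \<in> carrier (dual N)" using c by (intro dual_memI) simp_all
      moreover have "?d \<oplus>\<^bsub>dual N\<^esub> c = \<zero>\<^bsub>dual N\<^esub>"
        using c by (intro extensionalityI[of _ "carrier N"]) simp_all
      ultimately show "\<exists>d\<in>carrier (dual N). d \<oplus>\<^bsub>dual N\<^esub> c = \<zero>\<^bsub>dual N\<^esub>" by blast
    qed (auto intro!: extensionalityI[of _ "carrier N"])
  next
    fix r s c assume rs: "r \<in> carrier R" "s \<in> carrier R" and c: "c \<in> carrier (dual N)"
    show "(r \<otimes>\<^bsub>R\<^esub> s) \<odot>\<^bsub>dual N\<^esub> c = r \<odot>\<^bsub>dual N\<^esub> (s \<odot>\<^bsub>dual N\<^esub> c)"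
    proof (rule extensionalityI[of _ "carrier N"])
      fix x assume x: "x \<in> carrier N"
      have "(r \<otimes>\<^bsub>R\<^esub> s) \<odot>\<^bsub>N\<^esub> x = s \<odot>\<^bsub>N\<^esub> (r \<odot>\<^bsub>N\<^esub> x)"
        using rs x by (simp add: R.m_comm[of r s] smult_assoc1)
      then show "((r \<otimes>\<^bsub>R\<^esub> s) \<odot>\<^bsub>dual N\<^esub> c) x = (r \<odot>\<^bsub>dual N\<^esub> (s \<odot>\<^bsub>dual N\<^esub> c)) x"
        using rs x c by simp
    qed simp_all
  qed (auto intro!: extensionalityI[of _ "carrier N"])
qed

lemma dual_finsum:
  assumes N: "module R N" and J: "finite J" and y: "\<And>j. j \<in> J \<Longrightarrow> y j \<in> carrier (dual N)"
    and x: "x \<in> carrier N"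
  shows "(\<Oplus>\<^bsub>dual N\<^esub>j\<in>J. y j) x = (\<Prod>j\<in>J. y j x)"
proof -
  interpret D: module R "dual N" by (rule dual_module[OF N])
  show ?thesis
    using J y
  proof (induction J rule: finite_induct)
    case empty
    then show ?case using x by (simp add: dual_ops)
  next
    case (insert j J)
    have "(\<Oplus>\<^bsub>dual N\<^esub>j\<in>insert j J. y j) = y j \<oplus>\<^bsub>dual N\<^esub> (\<Oplus>\<^bsub>dual N\<^esub>j\<in>J. y j)"
      using insert by (intro D.finsum_insert) auto
    then show ?case using insert x by (simp add: dual_ops)
  qed
qed

lemma char_zero:
  assumes N: "module R N" and c: "c \<in> carrier (dual N)"
  shows "c \<zero>\<^bsub>N\<^esub> = 1"
proof -
  interpret module R N by fact
  have "c (\<zero>\<^bsub>N\<^esub> \<oplus>\<^bsub>N\<^esub> \<zero>\<^bsub>N\<^esub>) = c \<zero>\<^bsub>N\<^esub> * c \<zero>\<^bsub>N\<^esub>" using c by (intro dual_mem) auto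
  then show ?thesis using dual_mem(3)[OF c, of "\<zero>\<^bsub>N\<^esub>"] by simp
qed

lemma char_finsum:
  assumes N: "module R N" and c: "c \<in> carrier (dual N)" and J: "finite J"
    and x: "\<And>j. j \<in> J \<Longrightarrow> x j \<in> carrier N"
  shows "c (\<Oplus>\<^bsub>N\<^esub>j\<in>J. x j) = (\<Prod>j\<in>J. c (x j))"
proof -
  interpret module R N by fact
  show ?thesis
    using J x
  proof (induction J rule: finite_induct)
    case empty
    then show ?case using char_zero[OF N c] by simp
  next
    case (insert j J)
    have "(\<Oplus>\<^bsub>N\<^esub>j\<in>insert j J. x j) = x j \<oplus>\<^bsub>N\<^esub> (\<Oplus>\<^bsub>N\<^esub>j\<in>J. x j)"
      using insert by (intro M.finsum_insert) auto
    moreover have "(\<Oplus>\<^bsub>N\<^esub>j\<in>J. x j) \<in> carrier N" using insert by (intro M.finsum_closed) auto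
    ultimately show ?case using insert dual_mem(4)[OF c] by simp
  qed
qed

definition evaluation :: "('r, 'a) module \<Rightarrow> 'a \<Rightarrow> ('a \<Rightarrow> complex) \<Rightarrow> complex" where
  "evaluation N x = (\<lambda>c\<in>carrier (dual N). c x)"

lemma evaluation_hom:
  assumes N: "module R N"
  shows "evaluation N \<in> mod_hom R N (dual (dual N))"
proof -
  interpret module R N by fact
  interpret D: module R "dual N" by (rule dual_module[OF N])
  have 1: "evaluation N x \<in> carrier (dual (dual N))" if "x \<in> carrier N" for x
    using that by (intro dual_memI) (auto simp: evaluation_def dual_ops dual_mem)
  have 2: "evaluation N (x \<oplus>\<^bsub>N\<^esub> y) = evaluation N x \<oplus>\<^bsub>dual (dual N)\<^esub> evaluation N y"
    if "x \<in> carrier N" "y \<in> carrier N" for x y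
    by (rule extensionalityI[of _ "carrier (dual N)"])
       (use that in \<open>auto simp: dual_ops evaluation_def dual_mem\<close>)
  have 3: "evaluation N (r \<odot>\<^bsub>N\<^esub> x) = r \<odot>\<^bsub>dual (dual N)\<^esub> evaluation N x"
    if "r \<in> carrier R" "x \<in> carrier N" for r x
    by (rule extensionalityI[of _ "carrier (dual N)"])
       (use that in \<open>auto simp: dual_ops evaluation_def\<close>)
  show ?thesis using 1 2 3 by (auto simp: mod_hom_def)
qed

lemma evaluation_pure:
  fixes R :: "('r, 'x) ring_scheme" and N :: "('r, 'a) module" and m n :: nat
  assumes N: "module R N"
    and r: "\<And>i j. i < m \<Longrightarrow> j < n \<Longrightarrow> r i j \<in> carrier R"
    and a: "\<And>i. i < m \<Longrightarrow> a i \<in> carrier N"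
    and y: "\<And>j. j < n \<Longrightarrow> y j \<in> carrier (dual (dual N))"
    and e: "\<And>i. i < m \<Longrightarrow> (\<Oplus>\<^bsub>dual (dual N)\<^esub>j\<in>{..<n}. r i j \<odot>\<^bsub>dual (dual N)\<^esub> y j) = evaluation N (a i)"
  shows "\<exists>b. (\<forall>j<n. b j \<in> carrier N) \<and> (\<forall>i<m. (\<Oplus>\<^bsub>N\<^esub>j\<in>{..<n}. r i j \<odot>\<^bsub>N\<^esub> b j) = a i)"
proof (rule ccontr)
  assume neg: "\<not> ?thesis"
  interpret module R N by fact
  interpret D: module R "dual N" by (rule dual_module[OF N])
  interpret DD: module R "dual (dual N)" by (rule dual_module[OF D.module_axioms])
  define G where "G = product_group {..<m} (\<lambda>_. add_monoid N)"
  have carG: "carrier G = {..<m} \<rightarrow>\<^sub>E carrier N" by (simp add: G_def)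
  have mulG: "f \<otimes>\<^bsub>G\<^esub> g = (\<lambda>i\<in>{..<m}. f i \<oplus>\<^bsub>N\<^esub> g i)" for f g by (simp add: G_def)
  have "group G" unfolding G_def by (rule product_group) (rule M.add.is_group)
  then interpret G: comm_group G
    by (rule group.group_comm_groupI) (auto simp: carG mulG intro!: restrict_ext M.a_comm)
  have oneG: "\<one>\<^bsub>G\<^esub> = (\<lambda>i\<in>{..<m}. \<zero>\<^bsub>N\<^esub>)" by (simp add: G_def)
  define L where "L b = (\<lambda>i\<in>{..<m}. \<Oplus>\<^bsub>N\<^esub>j\<in>{..<n}. r i j \<odot>\<^bsub>N\<^esub> b j)" for b
  define H where "H = L ` ({..<n} \<rightarrow> carrier N)"
  have LG: "L b \<in> carrier G" if "b \<in> {..<n} \<rightarrow> carrier N" for b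
    using that r by (auto simp: L_def carG intro!: M.finsum_closed)
  have Ladd: "L b \<otimes>\<^bsub>G\<^esub> L b' = L (\<lambda>j. b j \<oplus>\<^bsub>N\<^esub> b' j)"
    if b: "b \<in> {..<n} \<rightarrow> carrier N" "b' \<in> {..<n} \<rightarrow> carrier N" for b b'
  proof -
    have "(\<Oplus>\<^bsub>N\<^esub>j\<in>{..<n}. r i j \<odot>\<^bsub>N\<^esub> (b j \<oplus>\<^bsub>N\<^esub> b' j)) =
       (\<Oplus>\<^bsub>N\<^esub>j\<in>{..<n}. r i j \<odot>\<^bsub>N\<^esub> b j) \<oplus>\<^bsub>N\<^esub> (\<Oplus>\<^bsub>N\<^esub>j\<in>{..<n}. r i j \<odot>\<^bsub>N\<^esub> b' j)"
      if i: "i < m" for i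
    proof -
      have "(\<Oplus>\<^bsub>N\<^esub>j\<in>{..<n}. r i j \<odot>\<^bsub>N\<^esub> (b j \<oplus>\<^bsub>N\<^esub> b' j)) =
         (\<Oplus>\<^bsub>N\<^esub>j\<in>{..<n}. r i j \<odot>\<^bsub>N\<^esub> b j \<oplus>\<^bsub>N\<^esub> r i j \<odot>\<^bsub>N\<^esub> b' j)"
        by (rule M.finsum_cong') (use b r[OF i] in \<open>auto simp: smult_r_distr Pi_iff\<close>)
      also have "\<dots> = (\<Oplus>\<^bsub>N\<^esub>j\<in>{..<n}. r i j \<odot>\<^bsub>N\<^esub> b j) \<oplus>\<^bsub>N\<^esub> (\<Oplus>\<^bsub>N\<^esub>j\<in>{..<n}. r i j \<odot>\<^bsub>N\<^esub> b' j)"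
        by (rule M.finsum_addf) (use b r[OF i] in auto)
      finally show ?thesis .
    qed
    then show ?thesis by (auto simp: L_def mulG fun_eq_iff)
  qed
  have Lzero: "L (\<lambda>_. \<zero>\<^bsub>N\<^esub>) = \<one>\<^bsub>G\<^esub>"
    using r by (auto simp: L_def oneG fun_eq_iff intro!: M.add.finprod_one_eqI)
  have H: "subgroup H G"
  proof (rule G.subgroupI)
    show "H \<subseteq> carrier G" using LG by (auto simp: H_def)
    show "H \<noteq> {}" by (auto simp: H_def Pi_iff intro!: exI[of _ "\<lambda>_. \<zero>\<^bsub>N\<^esub>"])
    fix f assume "f \<in> H"
    then obtain b where b: "b \<in> {..<n} \<rightarrow> carrier N" "f = L b" by (auto simp: H_def)
    have b': "(\<lambda>j. \<ominus>\<^bsub>N\<^esub> b j) \<in> {..<n} \<rightarrow> carrier N" using b by auto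
    have "L (\<lambda>j. \<ominus>\<^bsub>N\<^esub> b j) \<otimes>\<^bsub>G\<^esub> L b = L (\<lambda>j. \<ominus>\<^bsub>N\<^esub> b j \<oplus>\<^bsub>N\<^esub> b j)"
      by (rule Ladd[OF b' b(1)])
    also have "\<dots> = L (\<lambda>_. \<zero>\<^bsub>N\<^esub>)"
      unfolding L_def
      by (intro restrict_ext M.finsum_cong') (use b r in \<open>auto simp: M.l_neg Pi_iff\<close>)
    finally have "inv\<^bsub>G\<^esub> f = L (\<lambda>j. \<ominus>\<^bsub>N\<^esub> b j)"
      using Lzero LG[OF b'] LG[OF b(1)] b(2) by (simp add: G.inv_equality)
    then show "inv\<^bsub>G\<^esub> f \<in> H" using b' by (auto simp: H_def)
    fix g assume "g \<in> H"
    then obtain d where d: "d \<in> {..<n} \<rightarrow> carrier N" "g = L d" by (auto simp: H_def)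
    have "(\<lambda>j. b j \<oplus>\<^bsub>N\<^esub> d j) \<in> {..<n} \<rightarrow> carrier N" using b d by auto
    then show "f \<otimes>\<^bsub>G\<^esub> g \<in> H" using Ladd[OF b(1) d(1)] b d by (auto simp: H_def)
  qed
  let ?a = "\<lambda>i\<in>{..<m}. a i"
  have aG: "?a \<in> carrier G" using a by (auto simp: carG)
  have aH: "?a \<notin> H"
  proof
    assume "?a \<in> H"
    then obtain b where b: "b \<in> {..<n} \<rightarrow> carrier N" "?a = L b" by (auto simp: H_def)
    have "(\<Oplus>\<^bsub>N\<^esub>j\<in>{..<n}. r i j \<odot>\<^bsub>N\<^esub> b j) = a i" if "i < m" for i
      using fun_cong[OF b(2), of i] that by (simp add: L_def)
    then show False using neg b(1) by auto
  qed
  obtain c where c: "\<And>f. f \<in> carrier G \<Longrightarrow> cmod (c f) = 1"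
    "\<And>f g. f \<in> carrier G \<Longrightarrow> g \<in> carrier G \<Longrightarrow> c (f \<otimes>\<^bsub>G\<^esub> g) = c f * c g"
    "\<And>f. f \<in> H \<Longrightarrow> c f = 1" "c ?a \<noteq> 1"
    using G.char_separate[OF H aG aH] by blast
  define E where "E k x = (\<lambda>i\<in>{..<m}. if i = k then x else \<zero>\<^bsub>N\<^esub>)" for k x
  have EG: "E k x \<in> carrier G" if "x \<in> carrier N" for k x using that by (auto simp: E_def carG)
  define q where "q k = (\<lambda>x\<in>carrier N. c (E k x))" for k
  have q: "q k \<in> carrier (dual N)" for k
  proof (rule dual_memI)
    fix x y assume xy: "x \<in> carrier N" "y \<in> carrier N"
    have "E k (x \<oplus>\<^bsub>N\<^esub> y) = E k x \<otimes>\<^bsub>G\<^esub> E k y"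
      using xy by (auto simp: E_def mulG fun_eq_iff)
    then show "q k (x \<oplus>\<^bsub>N\<^esub> y) = q k x * q k y" using xy c(2) EG by (simp add: q_def)
  qed (auto simp: q_def c EG)
  have c1: "c \<one>\<^bsub>G\<^esub> = 1" using c(3) subgroup.one_closed[OF H] by blast
  have decomp: "c f = (\<Prod>i\<in>{..<m}. q i (f i))" if f: "f \<in> carrier G" for f
  proof -
    define T where "T k = (\<lambda>i\<in>{..<m}. if i < k then f i else \<zero>\<^bsub>N\<^esub>)" for k
    have fN: "f i \<in> carrier N" if "i < m" for i using f that by (auto simp: carG)
    have TG: "T k \<in> carrier G" for k using fN by (auto simp: T_def carG)
    have "c (T k) = (\<Prod>i\<in>{..<k}. q i (f i))" if "k \<le> m" for k
      using that
    proof (induction k)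
      case 0
      have "T 0 = \<one>\<^bsub>G\<^esub>" by (auto simp: T_def oneG)
      then show ?case using c1 by simp
    next
      case (Suc k)
      have "T (Suc k) = T k \<otimes>\<^bsub>G\<^esub> E k (f k)"
        using Suc fN by (auto simp: T_def mulG E_def fun_eq_iff less_Suc_eq)
      then have "c (T (Suc k)) = c (T k) * c (E k (f k))" using c(2) TG EG fN Suc by simp
      then show ?case using Suc fN by (simp add: q_def)
    qed
    moreover have "T m = f" using f by (auto simp: T_def carG fun_eq_iff PiE_def extensional_def)
    ultimately show ?thesis by auto
  qed
  have zero: "(\<Oplus>\<^bsub>dual N\<^esub>i\<in>{..<m}. r i j \<odot>\<^bsub>dual N\<^esub> q i) = \<zero>\<^bsub>dual N\<^esub>" if j: "j < n" for j
  proof (rule extensionalityI[of _ "carrier N"])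
    have cl: "(\<Oplus>\<^bsub>dual N\<^esub>i\<in>{..<m}. r i j \<odot>\<^bsub>dual N\<^esub> q i) \<in> carrier (dual N)"
      using r j q by (intro D.finsum_closed) auto
    then show "(\<Oplus>\<^bsub>dual N\<^esub>i\<in>{..<m}. r i j \<odot>\<^bsub>dual N\<^esub> q i) \<in> extensional (carrier N)"
      by (rule dual_mem)
    fix x assume x: "x \<in> carrier N"
    let ?b = "\<lambda>k. if j = k then x else \<zero>\<^bsub>N\<^esub>"
    have "L ?b = (\<lambda>i\<in>{..<m}. r i j \<odot>\<^bsub>N\<^esub> x)"
      unfolding L_def
    proof (rule restrict_ext)
      fix i assume i: "i \<in> {..<m}"
      have "(\<Oplus>\<^bsub>N\<^esub>k\<in>{..<n}. r i k \<odot>\<^bsub>N\<^esub> ?b k) = (\<Oplus>\<^bsub>N\<^esub>k\<in>{..<n}. if j = k then r i k \<odot>\<^bsub>N\<^esub> x else \<zero>\<^bsub>N\<^esub>)"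
        by (rule M.finsum_cong') (use r i x in auto)
      also have "\<dots> = r i j \<odot>\<^bsub>N\<^esub> x"
        by (rule M.finsum_singleton) (use r i j x in auto)
      finally show "(\<Oplus>\<^bsub>N\<^esub>k\<in>{..<n}. r i k \<odot>\<^bsub>N\<^esub> ?b k) = r i j \<odot>\<^bsub>N\<^esub> x" .
    qed
    moreover have "L ?b \<in> H" using x by (auto simp: H_def)
    ultimately have "c (\<lambda>i\<in>{..<m}. r i j \<odot>\<^bsub>N\<^esub> x) = 1" using c(3) by metis
    moreover have "(\<lambda>i\<in>{..<m}. r i j \<odot>\<^bsub>N\<^esub> x) \<in> carrier G" using r j x by (auto simp: carG)
    ultimately have "(\<Prod>i\<in>{..<m}. q i (r i j \<odot>\<^bsub>N\<^esub> x)) = 1" using decomp by fastforce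
    moreover have "(\<Oplus>\<^bsub>dual N\<^esub>i\<in>{..<m}. r i j \<odot>\<^bsub>dual N\<^esub> q i) x = (\<Prod>i\<in>{..<m}. (r i j \<odot>\<^bsub>dual N\<^esub> q i) x)"
      by (rule dual_finsum[OF N]) (use r j q x in auto)
    ultimately show "(\<Oplus>\<^bsub>dual N\<^esub>i\<in>{..<m}. r i j \<odot>\<^bsub>dual N\<^esub> q i) x = \<zero>\<^bsub>dual N\<^esub> x"
      using x by (simp add: dual_ops)
  qed (rule dual_ops)
  have "c ?a = (\<Prod>i\<in>{..<m}. q i (a i))" using decomp[OF aG] by simp
  also have "\<dots> = (\<Prod>i\<in>{..<m}. \<Prod>j\<in>{..<n}. y j (r i j \<odot>\<^bsub>dual N\<^esub> q i))"
  proof (rule prod.cong[OF refl])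
    fix i assume i: "i \<in> {..<m}"
    have "q i (a i) = evaluation N (a i) (q i)" using q by (simp add: evaluation_def)
    also have "\<dots> = (\<Oplus>\<^bsub>dual (dual N)\<^esub>j\<in>{..<n}. r i j \<odot>\<^bsub>dual (dual N)\<^esub> y j) (q i)"
      using e i by simp
    also have "\<dots> = (\<Prod>j\<in>{..<n}. (r i j \<odot>\<^bsub>dual (dual N)\<^esub> y j) (q i))"
      by (rule dual_finsum[OF D.module_axioms]) (use r i y q in auto)
    also have "\<dots> = (\<Prod>j\<in>{..<n}. y j (r i j \<odot>\<^bsub>dual N\<^esub> q i))"
      using q by (simp add: dual_ops)
    finally show "q i (a i) = (\<Prod>j\<in>{..<n}. y j (r i j \<odot>\<^bsub>dual N\<^esub> q i))" .
  qed
  also have "\<dots> = (\<Prod>j\<in>{..<n}. \<Prod>i\<in>{..<m}. y j (r i j \<odot>\<^bsub>dual N\<^esub> q i))" by (rule prod.swap)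
  also have "\<dots> = (\<Prod>j\<in>{..<n}. y j (\<Oplus>\<^bsub>dual N\<^esub>i\<in>{..<m}. r i j \<odot>\<^bsub>dual N\<^esub> q i))"
  proof (rule prod.cong[OF refl])
    fix j assume j: "j \<in> {..<n}"
    show "(\<Prod>i\<in>{..<m}. y j (r i j \<odot>\<^bsub>dual N\<^esub> q i)) = y j (\<Oplus>\<^bsub>dual N\<^esub>i\<in>{..<m}. r i j \<odot>\<^bsub>dual N\<^esub> q i)"
      by (rule char_finsum[OF D.module_axioms, symmetric]) (use r j y q in auto)
  qed
  also have "\<dots> = 1"
    using zero char_zero[OF D.module_axioms y] by simp
  finally show False using c(4) by simp
qed

lemma dual_dual_extend:
  fixes R :: "('r, 'x) ring_scheme" and N :: "('r, 'a) module" and B :: "('r, 't) module"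
  assumes N: "module R N" and B: "module R B" and pure: "pure_submodule R A B"
    and h: "h \<in> mod_hom R (B\<lparr>carrier := A\<rparr>) N"
  shows "\<exists>k \<in> mod_hom R B (dual (dual N)). \<forall>x\<in>A. k x = evaluation N (h x)"
proof -
  interpret module R N by fact
  interpret D: module R "dual N" by (rule dual_module[OF N])
  interpret DD: module R "dual (dual N)" by (rule dual_module[OF D.module_axioms])
  interpret B: module R B by fact
  have sub: "submodule A R B" using pure by (simp add: pure_submodule_def)
  have AB: "A \<subseteq> carrier B" using B.submoduleE(1)[OF sub] .
  have hN: "h x \<in> carrier N" if "x \<in> A" for x using h that by (auto simp: mod_hom_def)
  have hadd: "h (x \<oplus>\<^bsub>B\<^esub> y) = h x \<oplus>\<^bsub>N\<^esub> h y" if "x \<in> A" "y \<in> A" for x y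
    using h that by (auto simp: mod_hom_def)
  have hsm: "h (r \<odot>\<^bsub>B\<^esub> x) = r \<odot>\<^bsub>N\<^esub> h x" if "r \<in> carrier R" "x \<in> A" for x r
    using h that by (auto simp: mod_hom_def)
  let ?D = "carrier (dual N)"
  define f1 where "f1 = (\<lambda>((b, b'), c). \<lambda>v :: 't \<times> ('a \<Rightarrow> complex) \<Rightarrow> complex.
    v (b \<oplus>\<^bsub>B\<^esub> b', c) - v (b, c) * v (b', c))"
  define f2 where "f2 = (\<lambda>((r, b), c). \<lambda>v :: 't \<times> ('a \<Rightarrow> complex) \<Rightarrow> complex.
    v (r \<odot>\<^bsub>B\<^esub> b, c) - v (b, r \<odot>\<^bsub>dual N\<^esub> c))"
  define f3 where "f3 = (\<lambda>(a, c). \<lambda>v :: 't \<times> ('a \<Rightarrow> complex) \<Rightarrow> complex. v (a, c) - c (h a))"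
  define f4 where "f4 = (\<lambda>(b, c, d). \<lambda>v :: 't \<times> ('a \<Rightarrow> complex) \<Rightarrow> complex.
    v (b, c \<oplus>\<^bsub>dual N\<^esub> d) - v (b, c) * v (b, d))"
  define I1 where "I1 = (carrier B \<times> carrier B) \<times> ?D"
  define I2 where "I2 = (carrier R \<times> carrier B) \<times> ?D"
  define I3 where "I3 = A \<times> ?D"
  define I4 where "I4 = carrier B \<times> ?D \<times> ?D"
  let ?F = "f1 ` I1 \<union> f2 ` I2 \<union> f3 ` I3 \<union> f4 ` I4"
  have "\<exists>v. (\<forall>x. cmod (v x) = 1) \<and> (\<forall>f\<in>?F. f v = 0)"
  proof (rule circle_compactness)
    show "continuous_on UNIV f" if "f \<in> ?F" for f
      using that by (auto simp: f1_def f2_def f3_def f4_def intro!: continuous_intros)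
    show "\<exists>v. (\<forall>x. cmod (v x) = 1) \<and> (\<forall>f\<in>F'. f v = 0)" if F': "finite F'" "F' \<subseteq> ?F" for F'
    proof -
      have fs: "\<exists>P. finite P \<and> P \<subseteq> I \<and> F' \<inter> f ` I = f ` P"
        for f :: "'z \<Rightarrow> ('t \<times> ('a \<Rightarrow> complex) \<Rightarrow> complex) \<Rightarrow> complex" and I
        using finite_subset_image[of "F' \<inter> f ` I" f I] F' by (metis finite_Int inf_le2)
      obtain P1 where P1: "finite P1" "P1 \<subseteq> I1" "F' \<inter> f1 ` I1 = f1 ` P1" using fs by meson
      obtain P2 where P2: "finite P2" "P2 \<subseteq> I2" "F' \<inter> f2 ` I2 = f2 ` P2" using fs by meson
      obtain P3 where P3: "finite P3" "P3 \<subseteq> I3" "F' \<inter> f3 ` I3 = f3 ` P3" using fs by meson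
      have "\<exists>t. (\<forall>x. t x \<in> A) \<and>
         (\<forall>(b, b')\<in>fst ` P1. t (b \<oplus>\<^bsub>B\<^esub> b') = t b \<oplus>\<^bsub>B\<^esub> t b') \<and>
         (\<forall>(r, b)\<in>fst ` P2. t (r \<odot>\<^bsub>B\<^esub> b) = r \<odot>\<^bsub>B\<^esub> t b) \<and> (\<forall>a\<in>fst ` P3. t a = a)"
        by (rule pure_retract_finite[OF B pure])
           (use P1 P2 P3 in \<open>auto simp: I1_def I2_def I3_def\<close>)
      then obtain t where tA: "\<And>x. t x \<in> A"
        and t1: "\<And>b b' c. ((b, b'), c) \<in> P1 \<Longrightarrow> t (b \<oplus>\<^bsub>B\<^esub> b') = t b \<oplus>\<^bsub>B\<^esub> t b'"
        and t2: "\<And>r b c. ((r, b), c) \<in> P2 \<Longrightarrow> t (r \<odot>\<^bsub>B\<^esub> b) = r \<odot>\<^bsub>B\<^esub> t b"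
        and t3: "\<And>a c. (a, c) \<in> P3 \<Longrightarrow> t a = a"
        by force
      define v where "v = (\<lambda>(b, c). if c \<in> ?D then c (h (t b)) else 1)"
      have "cmod (v p) = 1" for p
        using dual_mem(2)[OF _ hN[OF tA]] by (auto simp: v_def split: prod.splits)
      moreover have "f v = 0" if fF: "f \<in> F'" for f
      proof -
        consider "f \<in> f1 ` P1" | "f \<in> f2 ` P2" | "f \<in> f3 ` P3" | "f \<in> f4 ` I4"
        proof -
          have "f \<in> f1 ` I1 \<or> f \<in> f2 ` I2 \<or> f \<in> f3 ` I3 \<or> f \<in> f4 ` I4"
            using subsetD[OF F'(2) fF] by (simp only: Un_iff disj_assoc)
          then have "f \<in> f1 ` P1 \<or> f \<in> f2 ` P2 \<or> f \<in> f3 ` P3 \<or> f \<in> f4 ` I4"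
            unfolding P1(3)[symmetric] P2(3)[symmetric] P3(3)[symmetric] using fF by (simp only: Int_iff)  simp
          then show ?thesis using that by (elim disjE)
        qed
        then show ?thesis
        proof cases
          case 1
          then obtain b b' c where p: "((b, b'), c) \<in> P1" "f = f1 ((b, b'), c)" by auto
          then have "c \<in> ?D" using P1 by (auto simp: I1_def)
          then show ?thesis
            using t1[OF p(1)] tA hN by (simp add: p f1_def v_def hadd dual_mem)
        next
          case 2
          then obtain r b c where p: "((r, b), c) \<in> P2" "f = f2 ((r, b), c)" by auto
          then have "c \<in> ?D" "r \<in> carrier R" using P2 by (auto simp: I2_def)
          then show ?thesis
            using t2[OF p(1)] tA hN by (simp add: p f2_def v_def hsm dual_ops)
        next
          case 3
          then obtain a c where p: "(a, c) \<in> P3" "f = f3 (a, c)" by auto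
          then have "c \<in> ?D" using P3 by (auto simp: I3_def)
          then show ?thesis using t3[OF p(1)] by (simp add: p f3_def v_def)
        next
          case 4
          then show ?thesis using tA hN by (auto simp: I4_def f4_def v_def dual_ops)
        qed
      qed
      ultimately show ?thesis by blast
    qed
  qed
  then obtain v where v: "\<And>x. cmod (v x) = 1" and vF: "\<forall>f\<in>?F. f v = 0" by blast
  have v1: "v (b \<oplus>\<^bsub>B\<^esub> b', c) = v (b, c) * v (b', c)"
    if "b \<in> carrier B" "b' \<in> carrier B" "c \<in> ?D" for b b' c
  proof -
    have "f1 ((b, b'), c) \<in> ?F" using that by (intro UnI1 imageI) (auto simp: I1_def)
    then have "f1 ((b, b'), c) v = 0" using vF by blast
    then show ?thesis by (simp add: f1_def)
  qed
  have v2: "v (r \<odot>\<^bsub>B\<^esub> b, c) = v (b, r \<odot>\<^bsub>dual N\<^esub> c)"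
    if "r \<in> carrier R" "b \<in> carrier B" "c \<in> ?D" for r b c
  proof -
    have "((r, b), c) \<in> I2" using that by (auto simp: I2_def)
    then have "f2 ((r, b), c) v = 0" using vF by blast
    then show ?thesis by (simp add: f2_def)
  qed
  have v3: "v (a, c) = c (h a)" if "a \<in> A" "c \<in> ?D" for a c
  proof -
    have "(a, c) \<in> I3" using that by (auto simp: I3_def)
    then have "f3 (a, c) v = 0" using vF by blast
    then show ?thesis by (simp add: f3_def)
  qed
  have v4: "v (b, c \<oplus>\<^bsub>dual N\<^esub> d) = v (b, c) * v (b, d)"
    if "b \<in> carrier B" "c \<in> ?D" "d \<in> ?D" for b c d
  proof -
    have "(b, c, d) \<in> I4" using that by (auto simp: I4_def)
    then have "f4 (b, c, d) v = 0" using vF by blast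
    then show ?thesis by (simp add: f4_def)
  qed
  define k where "k b = (\<lambda>c\<in>?D. v (b, c))" for b
  have "k \<in> mod_hom R B (dual (dual N))"
    unfolding mod_hom_def
  proof (intro CollectI conjI ballI Pi_I)
    show "k b \<in> carrier (dual (dual N))" if "b \<in> carrier B" for b
      using that by (intro dual_memI) (auto simp: k_def v v4)
    show "k (b \<oplus>\<^bsub>B\<^esub> b') = k b \<oplus>\<^bsub>dual (dual N)\<^esub> k b'" if "b \<in> carrier B" "b' \<in> carrier B" for b b'
      by (rule extensionalityI[of _ "?D"]) (use that in \<open>auto simp: k_def dual_ops v1\<close>)
    show "k (r \<odot>\<^bsub>B\<^esub> b) = r \<odot>\<^bsub>dual (dual N)\<^esub> k b" if "r \<in> carrier R" "b \<in> carrier B" for r b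
      by (rule extensionalityI[of _ "?D"]) (use that in \<open>auto simp: k_def dual_ops v2\<close>)
  qed
  moreover have "k x = evaluation N (h x)" if "x \<in> A" for x
    unfolding k_def evaluation_def by (rule restrict_ext) (use that v3 in auto)
  ultimately show ?thesis by blast
qed

lemma evaluation_inj:
  assumes N: "module R N"
  shows "inj_on (evaluation N) (carrier N)"
proof (rule inj_onI)
  interpret module R N by fact
  interpret D: module R "dual N" by (rule dual_module[OF N])
  interpret DD: module R "dual (dual N)" by (rule dual_module[OF D.module_axioms])
  fix x y assume xy: "x \<in> carrier N" "y \<in> carrier N" and e: "evaluation N x = evaluation N y"
  let ?z = "x \<oplus>\<^bsub>N\<^esub> \<ominus>\<^bsub>N\<^esub> y"
  have z: "?z \<in> carrier N" using xy by simp
  have "evaluation N ?z = \<zero>\<^bsub>dual (dual N)\<^esub>"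
  proof (rule extensionalityI[of _ "carrier (dual N)"])
    fix c assume c: "c \<in> carrier (dual N)"
    have "c x = c y" using fun_cong[OF e, of c] c by (simp add: evaluation_def)
    moreover have "c (y \<oplus>\<^bsub>N\<^esub> \<ominus>\<^bsub>N\<^esub> y) = c y * c (\<ominus>\<^bsub>N\<^esub> y)" "c ?z = c x * c (\<ominus>\<^bsub>N\<^esub> y)"
      using c xy by (auto simp: dual_mem)
    ultimately have "c ?z = 1" using xy char_zero[OF N c] by (simp add: M.r_neg)
    then show "evaluation N ?z c = \<zero>\<^bsub>dual (dual N)\<^esub> c" using c by (simp add: evaluation_def dual_ops)
  qed (auto simp: evaluation_def dual_ops)
  then have "\<exists>b. (\<forall>j<0. b j \<in> carrier N) \<and>
      (\<forall>i<1. (\<Oplus>\<^bsub>N\<^esub>j\<in>{..<0::nat}. \<zero>\<^bsub>R\<^esub> \<odot>\<^bsub>N\<^esub> b j) = (\<lambda>_::nat. ?z) i)"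
    using z by (intro evaluation_pure[OF N, where y = "\<lambda>_. undefined"]) auto
  then have "?z = \<zero>\<^bsub>N\<^esub>" by simp
  then have "?z \<oplus>\<^bsub>N\<^esub> y = y" using xy by simp
  then show "x = y" using xy by (simp add: M.a_assoc M.l_neg)
qed

theorem pure_injective_extend:
  fixes R :: "('r, 'x) ring_scheme" and N :: "('r, 'a) module" and B :: "('r, 't) module"
  assumes PI: "pure_injective R N" and B: "module R B" and pure: "pure_submodule R A B"
    and h: "h \<in> mod_hom R (B\<lparr>carrier := A\<rparr>) N"
  shows "\<exists>k \<in> mod_hom R B N. \<forall>x\<in>A. k x = h x"
proof -
  have N: "module R N" using PI by (simp add: pure_injective_def)
  interpret module R N by fact
  interpret D: module R "dual N" by (rule dual_module[OF N])
  interpret DD: module R "dual (dual N)" by (rule dual_module[OF D.module_axioms])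
  let ?E = "evaluation N" and ?V = "evaluation N ` carrier N"
  have EH: "?E \<in> carrier N \<rightarrow> carrier (dual (dual N))"
    "\<And>x y. x \<in> carrier N \<Longrightarrow> y \<in> carrier N \<Longrightarrow> ?E x \<oplus>\<^bsub>dual (dual N)\<^esub> ?E y = ?E (x \<oplus>\<^bsub>N\<^esub> y)"
    "\<And>r x. r \<in> carrier R \<Longrightarrow> x \<in> carrier N \<Longrightarrow> r \<odot>\<^bsub>dual (dual N)\<^esub> ?E x = ?E (r \<odot>\<^bsub>N\<^esub> x)"
    using evaluation_hom[OF N] by (auto simp: mod_hom_def)
  have Ezero: "?E \<zero>\<^bsub>N\<^esub> = \<zero>\<^bsub>dual (dual N)\<^esub>"
    by (rule extensionalityI[of _ "carrier (dual N)"])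
       (auto simp: evaluation_def dual_ops char_zero[OF N])
  have Eneg: "\<ominus>\<^bsub>dual (dual N)\<^esub> ?E x = ?E (\<ominus>\<^bsub>N\<^esub> x)" if "x \<in> carrier N" for x
    using that EH Ezero by (intro DD.minus_equality) (auto simp: M.l_neg)
  have Efs: "(\<Oplus>\<^bsub>dual (dual N)\<^esub>j\<in>{..<n}. r j \<odot>\<^bsub>dual (dual N)\<^esub> ?E (b j)) = ?E (\<Oplus>\<^bsub>N\<^esub>j\<in>{..<n}. r j \<odot>\<^bsub>N\<^esub> b j)"
    if "\<And>j. j < n \<Longrightarrow> r j \<in> carrier R" "\<And>j. j < n \<Longrightarrow> b j \<in> carrier N" for n :: nat and r b
    using that
  proof (induction n)
    case 0
    then show ?case by (simp add: Ezero)
  next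
    case (Suc n)
    have 1: "(\<lambda>j. r j \<odot>\<^bsub>dual (dual N)\<^esub> ?E (b j)) \<in> {..<n} \<rightarrow> carrier (dual (dual N))"
      using Suc(2,3) EH(1)[THEN funcset_mem] by (intro Pi_I DD.smult_closed) auto
    have 2: "(\<lambda>j. r j \<odot>\<^bsub>N\<^esub> b j) \<in> {..<n} \<rightarrow> carrier N" using Suc(2,3) by auto
    have 3: "(\<Oplus>\<^bsub>N\<^esub>j\<in>{..<n}. r j \<odot>\<^bsub>N\<^esub> b j) \<in> carrier N" using 2 by (rule M.finsum_closed)
    show ?case
      using Suc 1 2 3 EH by (simp add: lessThan_Suc DD.finsum_insert M.finsum_insert Pi_iff)
  qed
  have "pure_submodule R ?V (dual (dual N))"
    unfolding pure_submodule_def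
  proof (intro conjI allI impI)
    show "submodule ?V R (dual (dual N))"
    proof (rule DD.submoduleI)
      show "\<zero>\<^bsub>dual (dual N)\<^esub> \<in> ?V" using Ezero by (metis M.zero_closed imageI)
    qed (use EH Eneg in auto)
    fix m n :: nat and r :: "nat \<Rightarrow> nat \<Rightarrow> 'r" and a
    assume r: "\<forall>i<m. \<forall>j<n. r i j \<in> carrier R" and a: "\<forall>i<m. a i \<in> ?V"
      and "\<exists>b. (\<forall>j<n. b j \<in> carrier (dual (dual N))) \<and>
        (\<forall>i<m. (\<Oplus>\<^bsub>dual (dual N)\<^esub>j\<in>{..<n}. r i j \<odot>\<^bsub>dual (dual N)\<^esub> b j) = a i)"
    then obtain y where y: "\<And>j. j < n \<Longrightarrow> y j \<in> carrier (dual (dual N))"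
      "\<And>i. i < m \<Longrightarrow> (\<Oplus>\<^bsub>dual (dual N)\<^esub>j\<in>{..<n}. r i j \<odot>\<^bsub>dual (dual N)\<^esub> y j) = a i" by blast
    have "\<forall>i. \<exists>x. i < m \<longrightarrow> x \<in> carrier N \<and> a i = ?E x" using a by blast
    then obtain a' where a': "\<And>i. i < m \<Longrightarrow> a' i \<in> carrier N" "\<And>i. i < m \<Longrightarrow> a i = ?E (a' i)" by metis
    have "\<exists>b. (\<forall>j<n. b j \<in> carrier N) \<and> (\<forall>i<m. (\<Oplus>\<^bsub>N\<^esub>j\<in>{..<n}. r i j \<odot>\<^bsub>N\<^esub> b j) = a' i)"
      by (rule evaluation_pure[OF N, of m n r a' y]) (use r y a' in auto)
    then obtain b where b: "\<And>j. j < n \<Longrightarrow> b j \<in> carrier N"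
      "\<And>i. i < m \<Longrightarrow> (\<Oplus>\<^bsub>N\<^esub>j\<in>{..<n}. r i j \<odot>\<^bsub>N\<^esub> b j) = a' i" by blast
    show "\<exists>b. (\<forall>j<n. b j \<in> ?V) \<and>
        (\<forall>i<m. (\<Oplus>\<^bsub>dual (dual N)\<^esub>j\<in>{..<n}. r i j \<odot>\<^bsub>dual (dual N)\<^esub> b j) = a i)"
    proof (intro exI[of _ "\<lambda>j. ?E (b j)"] conjI allI impI)
      show "?E (b j) \<in> ?V" if "j < n" for j using b(1)[OF that] by simp
      show "(\<Oplus>\<^bsub>dual (dual N)\<^esub>j\<in>{..<n}. r i j \<odot>\<^bsub>dual (dual N)\<^esub> ?E (b j)) = a i" if i: "i < m" for i
        using Efs[of n "r i" b] r b i a' by simp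
    qed
  qed
  moreover define g where "g = the_inv_into (carrier N) ?E"
  have gE: "g (?E x) = x" if "x \<in> carrier N" for x
    using the_inv_into_f_f[OF evaluation_inj[OF N] that] by (simp add: g_def)
  have "g \<in> mod_hom R ((dual (dual N))\<lparr>carrier := ?V\<rparr>) N"
    using gE EH by (auto simp: mod_hom_def)
  ultimately obtain \<rho> where \<rho>: "\<rho> \<in> mod_hom R (dual (dual N)) N" "\<forall>x\<in>?V. \<rho> x = g x"
    using PI[unfolded pure_injective_def, THEN conjunct2, rule_format] DD.module_axioms by blast
  obtain k where k: "k \<in> mod_hom R B (dual (dual N))" "\<And>x. x \<in> A \<Longrightarrow> k x = ?E (h x)"
    using dual_dual_extend[OF N B pure h] by blast
  have "\<rho> \<circ> k \<in> mod_hom R B N" using k(1) \<rho>(1) by (auto simp: mod_hom_def Pi_iff)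
  moreover have "(\<rho> \<circ> k) x = h x" if "x \<in> A" for x
  proof -
    have "h x \<in> carrier N" using h that by (auto simp: mod_hom_def)
    then show ?thesis using k(2)[OF that] \<rho>(2) gE by simp
  qed
  ultimately show ?thesis by blast
qed

end

theory Submission
  imports Defs
begin

text \<open>
  Everything rests on the ideal \<open>I\<close> being finitely presented.  Fix generators
  \<open>a\<^sub>0, \<dots>, a\<^sub>n\<^sub>-\<^sub>1\<close> of \<open>I\<close> and a finite set \<open>S\<close> generating the module of their syzygies.
  Then \<open>Hom(I, M)\<close> is the set of those \<open>n\<close>-tuples in \<open>M\<close> that satisfy the finitely many
  linear relations in \<open>S\<close> (\<open>extend_hom\<close>), and \<open>M\<close> is \<open>I\<close>-generated iff every \<open>x \<in> M\<close> has
  the form \<open>x = \<Sum>\<^sub>j h\<^sub>j(a\<^sub>j)\<close> with \<open>n\<close> homomorphisms \<open>h\<^sub>j : I \<rightarrow> M\<close> (\<open>I_generatedI_sums\<close>,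
  \<open>I_generatedD_sums\<close>).  So being \<open>I\<close>-generated says that each \<open>x\<close> is the parameter of a
  solvable finite linear system of one fixed shape.

  For a pure submodule \<open>A\<close> of \<open>B\<close> this system is solvable in \<open>A\<close> once it is solvable in
  \<open>B\<close>.  It is convenient to use purity through maps \<open>t : B \<rightarrow> A\<close> that respect any
  given finite set of linear combinations and fix any given finite subset of \<open>A\<close>
  (\<open>pure_retract_lincombs\<close>): such a \<open>t\<close> transports solutions.  For a pure extension,
  homomorphisms \<open>I \<rightarrow> C\<close> lift to \<open>B\<close>, because \<open>t\<close> corrects arbitrary lifts of the images
  of the generators so that the relations in \<open>S\<close> hold (\<open>pure_exact_lift\<close>); hence every
  element of \<open>B\<close> is a sum of the required form up to an element of \<open>A\<close>.

  For a pure-injective hull \<open>N\<close> of \<open>M\<close>, the partial retractions \<open>t : N \<rightarrow> M\<close> form a net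
  that is eventually linear and eventually the identity on \<open>M\<close>.  Pure-injectivity supplies
  a linear limit \<open>k : N\<^sup>J \<rightarrow> N\<close> along any proper filter on \<open>J\<close> (\<open>pure_injective_limit\<close>).  The
  limit of the net is an endomorphism \<open>e\<close> of \<open>N\<close> fixing \<open>M\<close>, so \<open>e\<close> is bijective by
  minimality of the hull.  Every \<open>t x\<close> lies in \<open>M\<close> and is a sum of \<open>n\<close> values \<open>h\<^sub>j(a\<^sub>j)\<close>;
  as \<open>n\<close> does not depend on the member of the net, the homomorphisms \<open>h\<^sub>j\<close> can be composed
  with \<open>k\<close> and show that \<open>e x\<close> is a sum of the same kind.
\<close>


section \<open>Finite sums and homomorphisms\<close>

text \<open>
  This sum depends only on the operations of \<open>M\<close>, unlike \<open>finsum\<close>, which consults the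
  carrier; passing to a submodule therefore does not change it.
\<close>

primrec nsum :: "('a, 'm) ring_scheme \<Rightarrow> (nat \<Rightarrow> 'a) \<Rightarrow> nat \<Rightarrow> 'a" where
  "nsum M f 0 = \<zero>\<^bsub>M\<^esub>"
| "nsum M f (Suc n) = nsum M f n \<oplus>\<^bsub>M\<^esub> f n"

lemma nsum_cong: "(\<And>i. i < n \<Longrightarrow> f i = g i) \<Longrightarrow> nsum M f n = nsum M g n"
  by (induction n) auto

lemma nsum_restrict [simp]: "nsum (M\<lparr>carrier := A\<rparr>) f n = nsum M f n"
  by (induction n) auto

context abelian_group
begin

lemma nsum_closed: "(\<And>i. i < n \<Longrightarrow> f i \<in> carrier G) \<Longrightarrow> nsum G f n \<in> carrier G"
  by (induction n) auto

lemma nsum_add: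
  assumes "\<And>i. i < n \<Longrightarrow> f i \<in> carrier G" "\<And>i. i < n \<Longrightarrow> g i \<in> carrier G"
  shows "nsum G (\<lambda>i. f i \<oplus> g i) n = nsum G f n \<oplus> nsum G g n"
  using assms
proof (induction n)
  case (Suc n)
  then show ?case by (simp add: nsum_closed a_ac)
qed simp

lemma nsum_zero: "(\<And>i. i < n \<Longrightarrow> f i = \<zero>) \<Longrightarrow> nsum G f n = \<zero>"
  by (induction n) auto

lemma nsum_single:
  assumes "i < n" "f i \<in> carrier G" "\<And>j. j < n \<Longrightarrow> j \<noteq> i \<Longrightarrow> f j = \<zero>"
  shows "nsum G f n = f i"
  using assms
proof (induction n)
  case (Suc n)
  show ?case
  proof (cases "i = n")
    case True
    then have "nsum G f n = \<zero>" using Suc.prems by (intro nsum_zero) auto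
    then show ?thesis using True Suc.prems by simp
  next
    case False
    then show ?thesis using Suc by simp
  qed
qed simp

end

lemma (in module) nsum_smult:
  assumes "r \<in> carrier R" "\<And>i. i < n \<Longrightarrow> f i \<in> carrier M"
  shows "r \<odot>\<^bsub>M\<^esub> nsum M f n = nsum M (\<lambda>i. r \<odot>\<^bsub>M\<^esub> f i) n"
  using assms
proof (induction n)
  case (Suc n)
  then show ?case by (simp add: M.nsum_closed smult_r_distr)
qed simp

lemma mod_hom_closed: "h \<in> mod_hom R M N \<Longrightarrow> x \<in> carrier M \<Longrightarrow> h x \<in> carrier N"
  by (auto simp: mod_hom_def)

lemma mod_hom_add:
  "h \<in> mod_hom R M N \<Longrightarrow> x \<in> carrier M \<Longrightarrow> y \<in> carrier M \<Longrightarrow> h (x \<oplus>\<^bsub>M\<^esub> y) = h x \<oplus>\<^bsub>N\<^esub> h y"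
  by (auto simp: mod_hom_def)

lemma mod_hom_smult:
  "h \<in> mod_hom R M N \<Longrightarrow> r \<in> carrier R \<Longrightarrow> x \<in> carrier M \<Longrightarrow> h (r \<odot>\<^bsub>M\<^esub> x) = r \<odot>\<^bsub>N\<^esub> h x"
  by (auto simp: mod_hom_def)

lemma mod_hom_zero:
  assumes "module R M" "module R N" "h \<in> mod_hom R M N"
  shows "h \<zero>\<^bsub>M\<^esub> = \<zero>\<^bsub>N\<^esub>"
proof -
  interpret M: module R M by fact
  interpret N: module R N by fact
  have "h (\<zero>\<^bsub>R\<^esub> \<odot>\<^bsub>M\<^esub> \<zero>\<^bsub>M\<^esub>) = \<zero>\<^bsub>R\<^esub> \<odot>\<^bsub>N\<^esub> h \<zero>\<^bsub>M\<^esub>"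
    using assms(3) by (intro mod_hom_smult) auto
  then show ?thesis using mod_hom_closed[OF assms(3)] by simp
qed

lemma mod_hom_nsum:
  assumes "module R M" "module R N" "h \<in> mod_hom R M N" "\<And>i. i < n \<Longrightarrow> f i \<in> carrier M"
  shows "h (nsum M f n) = nsum N (\<lambda>i. h (f i)) n"
proof -
  interpret M: module R M by fact
  show ?thesis
    using assms(4)
    by (induction n) (simp_all add: mod_hom_zero[OF assms(1-3)] mod_hom_add[OF assms(3)] M.nsum_closed)
qed

lemma mod_hom_comp:
  "h \<in> mod_hom R M N \<Longrightarrow> k \<in> mod_hom R N P \<Longrightarrow> (\<lambda>x. k (h x)) \<in> mod_hom R M P"
  by (auto simp: mod_hom_def Pi_iff)

lemma mod_hom_plus:
  assumes N: "module R N" and h: "h \<in> mod_hom R M N" and k: "k \<in> mod_hom R M N"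
  shows "(\<lambda>x. h x \<oplus>\<^bsub>N\<^esub> k x) \<in> mod_hom R M N"
proof -
  interpret N: module R N by fact
  show ?thesis
    unfolding mod_hom_def
    using mod_hom_closed[OF h] mod_hom_closed[OF k] mod_hom_add[OF h] mod_hom_add[OF k]
      mod_hom_smult[OF h] mod_hom_smult[OF k]
    by (auto simp: N.M.a_ac N.smult_r_distr)
qed

lemma mod_hom_scale:
  assumes N: "module R N" and h: "h \<in> mod_hom R M N" and r: "r \<in> carrier R"
  shows "(\<lambda>x. r \<odot>\<^bsub>N\<^esub> h x) \<in> mod_hom R M N"
proof -
  interpret N: module R N by fact
  have "r \<odot>\<^bsub>N\<^esub> (s \<odot>\<^bsub>N\<^esub> y) = s \<odot>\<^bsub>N\<^esub> (r \<odot>\<^bsub>N\<^esub> y)" if "s \<in> carrier R" "y \<in> carrier N" for s y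
    using that r by (simp add: N.smult_assoc1[symmetric] N.R.m_comm)
  then show ?thesis
    unfolding mod_hom_def
    using mod_hom_closed[OF h] mod_hom_add[OF h] mod_hom_smult[OF h] r
    by (auto simp: N.smult_r_distr)
qed

lemma mod_hom_lincomb:
  assumes "module R M" "module R N" "h \<in> mod_hom R M N"
    and "\<And>i. i < n \<Longrightarrow> r i \<in> carrier R" "\<And>i. i < n \<Longrightarrow> x i \<in> carrier M"
  shows "h (nsum M (\<lambda>i. r i \<odot>\<^bsub>M\<^esub> x i) n) = nsum N (\<lambda>i. r i \<odot>\<^bsub>N\<^esub> h (x i)) n"
proof -
  interpret M: module R M by fact
  have "h (nsum M (\<lambda>i. r i \<odot>\<^bsub>M\<^esub> x i) n) = nsum N (\<lambda>i. h (r i \<odot>\<^bsub>M\<^esub> x i)) n"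
    using assms by (intro mod_hom_nsum) auto
  also have "\<dots> = nsum N (\<lambda>i. r i \<odot>\<^bsub>N\<^esub> h (x i)) n"
    using assms by (intro nsum_cong mod_hom_smult) auto
  finally show ?thesis .
qed

lemma (in module) submoduleI_smult:
  assumes "H \<subseteq> carrier M" "\<zero>\<^bsub>M\<^esub> \<in> H" "\<And>a b. a \<in> H \<Longrightarrow> b \<in> H \<Longrightarrow> a \<oplus>\<^bsub>M\<^esub> b \<in> H"
    and sm: "\<And>r x. r \<in> carrier R \<Longrightarrow> x \<in> H \<Longrightarrow> r \<odot>\<^bsub>M\<^esub> x \<in> H"
  shows "submodule H R M"
proof (rule submoduleI)
  show "\<ominus>\<^bsub>M\<^esub> x \<in> H" if "x \<in> H" for x
    using sm[of "\<ominus>\<^bsub>R\<^esub> \<one>\<^bsub>R\<^esub>" x] that assms(1) by (auto simp: smult_l_minus)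
qed (use assms in auto)

lemma ideal_module_module:
  assumes "cring R" "ideal I R"
  shows "module R (ideal_module R I)"
proof -
  interpret cring R by fact
  interpret I: ideal I R by fact
  have IR: "\<And>x. x \<in> I \<Longrightarrow> x \<in> carrier R" by (rule I.a_Hcarr)
  show ?thesis
  proof (rule moduleI)
    show "abelian_group (ideal_module R I)"
    proof (rule abelian_groupI)
      fix x assume "x \<in> carrier (ideal_module R I)"
      then show "\<exists>y\<in>carrier (ideal_module R I). y \<oplus>\<^bsub>ideal_module R I\<^esub> x = \<zero>\<^bsub>ideal_module R I\<^esub>"
        using I.a_inv_closed[of x] IR by (auto simp: ideal_module_def l_neg intro!: bexI[of _ "\<ominus>\<^bsub>R\<^esub> x"])
    qed (use IR I.additive_subgroup_axioms in \<open>auto simp: ideal_module_def a_ac additive_subgroup.zero_closed\<close>)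
  qed (use IR I.I_l_closed in \<open>auto simp: ideal_module_def l_distr r_distr m_assoc \<open>cring R\<close>\<close>)
qed

section \<open>Function modules\<close>

definition function_module :: "('r, 'a) module \<Rightarrow> ('r, 'j \<Rightarrow> 'a) module" where
  "function_module M =
     \<lparr>carrier = {f. \<forall>j. f j \<in> carrier M}, monoid.mult = undefined, one = undefined,
      ring.zero = (\<lambda>_. \<zero>\<^bsub>M\<^esub>),
      ring.add = (\<lambda>f g j. f j \<oplus>\<^bsub>M\<^esub> g j),
      Module.module.smult = (\<lambda>r f j. r \<odot>\<^bsub>M\<^esub> f j)\<rparr>"

lemma function_module_simps [simp]:
  "f \<in> carrier (function_module M) \<longleftrightarrow> (\<forall>j. f j \<in> carrier M)"
  "\<zero>\<^bsub>function_module M\<^esub> j = \<zero>\<^bsub>M\<^esub>"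
  "(f \<oplus>\<^bsub>function_module M\<^esub> g) j = f j \<oplus>\<^bsub>M\<^esub> g j"
  "(r \<odot>\<^bsub>function_module M\<^esub> f) j = r \<odot>\<^bsub>M\<^esub> f j"
  by (simp_all add: function_module_def)

lemma function_module_module:
  assumes "module R M"
  shows "module R (function_module M)"
proof -
  interpret module R M by fact
  show ?thesis
  proof (rule moduleI)
    show "abelian_group (function_module M)"
    proof (rule abelian_groupI)
      fix f assume "f \<in> carrier (function_module M)"
      then show "\<exists>g\<in>carrier (function_module M). g \<oplus>\<^bsub>function_module M\<^esub> f = \<zero>\<^bsub>function_module M\<^esub>"
        by (intro bexI[of _ "\<lambda>j. \<ominus>\<^bsub>M\<^esub> f j"]) (auto simp: M.l_neg fun_eq_iff)
    qed (auto simp: fun_eq_iff M.a_ac)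
  qed (auto simp: fun_eq_iff smult_l_distr smult_r_distr smult_assoc1 R.is_cring)
qed

lemma function_module_nsum:
  "nsum (function_module M) f n j = nsum M (\<lambda>i. f i j) n"
  by (induction n) auto

lemma function_module_finsum:
  assumes "module R M" "finite K" "\<And>i. i \<in> K \<Longrightarrow> f i \<in> carrier (function_module M)"
  shows "(\<Oplus>\<^bsub>function_module M\<^esub>i\<in>K. f i) j = (\<Oplus>\<^bsub>M\<^esub>i\<in>K. f i j)"
proof -
  interpret module R M by fact
  interpret F: module R "function_module M" by (rule function_module_module) fact
  show ?thesis
    using assms(2,3)
  proof (induction K rule: finite_induct)
    case (insert i K)
    then have "f \<in> K \<rightarrow> carrier (function_module M)" "f i \<in> carrier (function_module M)" by blast+
    moreover from this have "(\<lambda>i. f i j) \<in> K \<rightarrow> carrier M" "f i j \<in> carrier M" by (auto simp: Pi_iff)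
    ultimately show ?case using insert by (simp add: F.finsum_insert M.finsum_insert del: function_module_simps(1))
  qed simp
qed

section \<open>Limits in pure-injective modules\<close>

text \<open>
  The eventually constant functions are pure in \<open>N\<^sup>J\<close>: a system whose right-hand sides are
  constant on a member of the filter is solved there by the values of a given solution at
  one single point of that member.  The eventual value is a homomorphism on them,
  which extends to \<open>N\<^sup>J\<close> by pure-injectivity.
\<close>

lemma pure_injective_limit:
  fixes N :: "('r, 'a) module" and F :: "'j filter"
  assumes PI: "pure_injective R N" and F: "F \<noteq> bot"
  obtains k where "k \<in> mod_hom R (function_module N) N"
    and "\<And>f c. \<forall>j. f j \<in> carrier N \<Longrightarrow> c \<in> carrier N \<Longrightarrow> eventually (\<lambda>j. f j = c) F \<Longrightarrow> k f = c"
    and "\<And>f g. \<forall>j. f j \<in> carrier N \<Longrightarrow> \<forall>j. g j \<in> carrier N \<Longrightarrow> eventually (\<lambda>j. f j = g j) F \<Longrightarrow> k f = k g"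
proof -
  have N: "module R N" using PI by (simp add: pure_injective_def)
  interpret module R N by fact
  let ?P = "function_module N :: ('r, 'j \<Rightarrow> 'a) module"
  interpret P: module R ?P by (rule function_module_module[OF N])
  define A where "A = {f. (\<forall>j. f j \<in> carrier N) \<and> (\<exists>c\<in>carrier N. eventually (\<lambda>j. f j = c) F)}"
  define l where "l f = (THE c. eventually (\<lambda>j. f j = c) F)" for f :: "'j \<Rightarrow> 'a"
  have l: "l f = c" if "eventually (\<lambda>j. f j = c) F" for f c
    unfolding l_def
  proof (rule the_equality[where P = "\<lambda>c. eventually (\<lambda>j. f j = c) F"])
    fix c' assume "eventually (\<lambda>j. f j = c') F"
    with that have "eventually (\<lambda>j. c' = c) F" by eventually_elim simp
    then show "c' = c" using F by simp
  qed (rule that)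
  have ev_add: "eventually (\<lambda>j. (f \<oplus>\<^bsub>?P\<^esub> g) j = c \<oplus>\<^bsub>N\<^esub> d) F"
    if "eventually (\<lambda>j. f j = c) F" "eventually (\<lambda>j. g j = d) F" for f g c d
    using that by eventually_elim simp
  have ev_sm: "eventually (\<lambda>j. (r \<odot>\<^bsub>?P\<^esub> f) j = r \<odot>\<^bsub>N\<^esub> c) F"
    if "eventually (\<lambda>j. f j = c) F" for f r c
    using that by eventually_elim simp
  have sub: "submodule A R ?P"
  proof (rule P.submoduleI_smult)
    show "f \<oplus>\<^bsub>?P\<^esub> g \<in> A" if fg: "f \<in> A" "g \<in> A" for f g
    proof -
      obtain c d where "c \<in> carrier N" "eventually (\<lambda>j. f j = c) F"
        "d \<in> carrier N" "eventually (\<lambda>j. g j = d) F"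
        using fg by (auto simp: A_def)
      then have "c \<oplus>\<^bsub>N\<^esub> d \<in> carrier N" "eventually (\<lambda>j. (f \<oplus>\<^bsub>?P\<^esub> g) j = c \<oplus>\<^bsub>N\<^esub> d) F"
        using ev_add by blast+
      moreover have "\<forall>j. (f \<oplus>\<^bsub>?P\<^esub> g) j \<in> carrier N" using fg by (simp add: A_def)
      ultimately show ?thesis unfolding A_def by blast
    qed
    show "r \<odot>\<^bsub>?P\<^esub> f \<in> A" if rf: "r \<in> carrier R" "f \<in> A" for r f
    proof -
      obtain c where "c \<in> carrier N" "eventually (\<lambda>j. f j = c) F"
        using rf by (auto simp: A_def)
      then have "r \<odot>\<^bsub>N\<^esub> c \<in> carrier N" "eventually (\<lambda>j. (r \<odot>\<^bsub>?P\<^esub> f) j = r \<odot>\<^bsub>N\<^esub> c) F"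
        using ev_sm rf by blast+
      moreover have "\<forall>j. (r \<odot>\<^bsub>?P\<^esub> f) j \<in> carrier N" using rf by (simp add: A_def)
      ultimately show ?thesis unfolding A_def by blast
    qed
  qed (auto simp: A_def intro!: bexI[of _ "\<zero>\<^bsub>N\<^esub>"])
  have "pure_submodule R A ?P"
    unfolding pure_submodule_def
  proof (intro conjI sub allI impI)
    fix m n :: nat and r :: "nat \<Rightarrow> nat \<Rightarrow> 'r" and a
    assume r: "\<forall>i<m. \<forall>j<n. r i j \<in> carrier R" and a: "\<forall>i<m. a i \<in> A"
      and "\<exists>b. (\<forall>j<n. b j \<in> carrier ?P) \<and> (\<forall>i<m. (\<Oplus>\<^bsub>?P\<^esub>j\<in>{..<n}. r i j \<odot>\<^bsub>?P\<^esub> b j) = a i)"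
    then obtain b where b: "\<forall>j<n. b j \<in> carrier ?P"
      and eq: "\<forall>i<m. (\<Oplus>\<^bsub>?P\<^esub>j\<in>{..<n}. r i j \<odot>\<^bsub>?P\<^esub> b j) = a i" by blast
    have pt: "(\<Oplus>\<^bsub>?P\<^esub>j\<in>{..<n}. r i j \<odot>\<^bsub>?P\<^esub> b' j) x = (\<Oplus>\<^bsub>N\<^esub>j\<in>{..<n}. r i j \<odot>\<^bsub>N\<^esub> b' j x)"
      if "i < m" "\<forall>j<n. b' j \<in> carrier ?P" for i b' x
      using that r by (subst function_module_finsum[OF N]) auto
    from a have "\<forall>i. \<exists>c. i < m \<longrightarrow> eventually (\<lambda>x. a i x = c) F" by (auto simp: A_def)
    then obtain c where c: "\<And>i. i < m \<Longrightarrow> eventually (\<lambda>x. a i x = c i) F" by metis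
    define Q where "Q x \<longleftrightarrow> (\<forall>i<m. a i x = c i)" for x
    have "eventually (\<lambda>x. \<forall>i\<in>{..<m}. a i x = c i) F"
      using c by (intro eventually_ball_finite) auto
    then have Q: "eventually Q F" by eventually_elim (auto simp: Q_def)
    then obtain x0 where x0: "Q x0" using F eventually_happens by blast
    \<comment> \<open>On \<open>Q\<close> the solution is frozen at its value in \<open>x0\<close>; elsewhere it is left as it is.\<close>
    define b' where "b' j x = (if Q x then b j x0 else b j x)" for j x
    have b'P: "\<forall>j<n. b' j \<in> carrier ?P" using b by (auto simp: b'_def)
    have "eventually (\<lambda>x. b' j x = b j x0) F" for j
      using Q by eventually_elim (simp add: b'_def)
    then have "\<forall>j<n. b' j \<in> A" using b b'P by (auto simp: A_def)
    moreover have "(\<Oplus>\<^bsub>?P\<^esub>j\<in>{..<n}. r i j \<odot>\<^bsub>?P\<^esub> b' j) = a i" if i: "i < m" for i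
    proof
      fix x
      have "(\<Oplus>\<^bsub>N\<^esub>j\<in>{..<n}. r i j \<odot>\<^bsub>N\<^esub> b j y) = a i y" for y
        using pt[OF i b] eq i by metis
      moreover have "Q x \<Longrightarrow> a i x = a i x0" using x0 i by (simp add: Q_def)
      ultimately show "(\<Oplus>\<^bsub>?P\<^esub>j\<in>{..<n}. r i j \<odot>\<^bsub>?P\<^esub> b' j) x = a i x"
        unfolding pt[OF i b'P] by (cases "Q x") (simp_all add: b'_def)
    qed
    ultimately show "\<exists>b. (\<forall>j<n. b j \<in> A) \<and> (\<forall>i<m. (\<Oplus>\<^bsub>?P\<^esub>j\<in>{..<n}. r i j \<odot>\<^bsub>?P\<^esub> b j) = a i)"
      by blast
  qed
  moreover have "l \<in> mod_hom R (?P\<lparr>carrier := A\<rparr>) N"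
    unfolding mod_hom_def
    by (auto simp: A_def l l[OF ev_add] l[OF ev_sm] simp del: function_module_simps(3,4))
  ultimately obtain k where k: "k \<in> mod_hom R ?P N" and kl: "\<forall>x\<in>A. k x = l x"
    using pure_injective_extend[OF PI P.module_axioms] by blast
  have const: "k f = c" if "\<forall>j. f j \<in> carrier N" "c \<in> carrier N" "eventually (\<lambda>j. f j = c) F" for f c
    using kl l that by (auto simp: A_def)
  have "k f = k g"
    if fg: "\<forall>j. f j \<in> carrier N" "\<forall>j. g j \<in> carrier N" "eventually (\<lambda>j. f j = g j) F" for f g
  proof -
    define d where "d = (\<lambda>j. f j \<oplus>\<^bsub>N\<^esub> \<ominus>\<^bsub>N\<^esub> g j)"
    have "eventually (\<lambda>j. d j = \<zero>\<^bsub>N\<^esub>) F"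
      using fg(3) by eventually_elim (use fg(2) in \<open>simp add: d_def M.r_neg\<close>)
    then have "k d = \<zero>\<^bsub>N\<^esub>" using fg by (intro const) (auto simp: d_def)
    moreover have "f = d \<oplus>\<^bsub>?P\<^esub> g" using fg by (auto simp: d_def fun_eq_iff M.a_assoc M.l_neg)
    moreover have "k (d \<oplus>\<^bsub>?P\<^esub> g) = k d \<oplus>\<^bsub>N\<^esub> k g"
      using fg by (intro mod_hom_add[OF k]) (auto simp: d_def)
    moreover have "k g \<in> carrier N" using fg by (intro mod_hom_closed[OF k]) auto
    ultimately show ?thesis by simp
  qed
  with that k const show ?thesis by blast
qed

section \<open>Submodules of free modules over a noetherian ring\<close>

abbreviation regular_module :: "('r, 'x) ring_scheme \<Rightarrow> ('r, 'r) module" where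
  "regular_module R \<equiv> ideal_module R (carrier R)"

lemma ideal_module_simps [simp]:
  "carrier (ideal_module R I) = I"
  "\<zero>\<^bsub>ideal_module R I\<^esub> = \<zero>\<^bsub>R\<^esub>"
  "x \<oplus>\<^bsub>ideal_module R I\<^esub> y = x \<oplus>\<^bsub>R\<^esub> y"
  "r \<odot>\<^bsub>ideal_module R I\<^esub> x = r \<otimes>\<^bsub>R\<^esub> x"
  by (simp_all add: ideal_module_def)

lemma nsum_ideal_module [simp]: "nsum (ideal_module R I) f n = nsum R f n"
  by (induction n) auto

lemma mod_hom_kernel:
  assumes "module R M" "module R N" "h \<in> mod_hom R M N"
  shows "submodule {x \<in> carrier M. h x = \<zero>\<^bsub>N\<^esub>} R M"
proof -
  interpret M: module R M by fact
  interpret N: module R N by fact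
  show ?thesis
    by (rule M.submoduleI_smult)
       (use assms in \<open>auto simp: mod_hom_zero mod_hom_add mod_hom_smult\<close>)
qed

lemma mod_hom_image:
  assumes "module R M" "module R N" "h \<in> mod_hom R M N" and S: "submodule S R M"
  shows "submodule (h ` S) R N"
proof -
  interpret M: module R M by fact
  interpret N: module R N by fact
  note SE = M.submoduleE[OF S]
  have "\<zero>\<^bsub>M\<^esub> \<in> S" using subgroup.one_closed[OF submodule.axioms(1)[OF S]] by simp
  then have z: "\<zero>\<^bsub>N\<^esub> \<in> h ` S" using mod_hom_zero[OF assms(1-3)] by (metis imageI)
  show ?thesis
  proof (rule N.submoduleI_smult)
    show "h ` S \<subseteq> carrier N" using SE(1) mod_hom_closed[OF assms(3)] by blast
    show "x \<oplus>\<^bsub>N\<^esub> y \<in> h ` S" if xy: "x \<in> h ` S" "y \<in> h ` S" for x y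
    proof -
      obtain u v where "u \<in> S" "v \<in> S" "x = h u" "y = h v" using xy by blast
      then have "x \<oplus>\<^bsub>N\<^esub> y = h (u \<oplus>\<^bsub>M\<^esub> v)" "u \<oplus>\<^bsub>M\<^esub> v \<in> S"
        using SE mod_hom_add[OF assms(3)] by (auto simp: subset_iff)
      then show ?thesis by blast
    qed
    show "r \<odot>\<^bsub>N\<^esub> x \<in> h ` S" if rx: "r \<in> carrier R" "x \<in> h ` S" for r x
    proof -
      obtain u where "u \<in> S" "x = h u" using rx by blast
      then have "r \<odot>\<^bsub>N\<^esub> x = h (r \<odot>\<^bsub>M\<^esub> u)" "r \<odot>\<^bsub>M\<^esub> u \<in> S"
        using SE rx mod_hom_smult[OF assms(3)] by (auto simp: subset_iff)
      then show ?thesis by blast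
    qed
  qed (rule z)
qed

lemma submodule_Int:
  assumes "module R M" "submodule S R M" "submodule T R M"
  shows "submodule (S \<inter> T) R M"
proof -
  interpret M: module R M by fact
  have "\<zero>\<^bsub>M\<^esub> \<in> S" "\<zero>\<^bsub>M\<^esub> \<in> T"
    using assms(2,3)[THEN submodule.axioms(1), THEN subgroup.one_closed] by simp_all
  then show ?thesis
    by (intro M.submoduleI_smult) (use M.submoduleE[OF assms(2)] M.submoduleE[OF assms(3)] in auto)
qed

lemma (in cring) regular_module_module: "module R (regular_module R)"
  by (rule ideal_module_module[OF is_cring oneideal])

lemma (in cring) ideal_of_submodule:
  assumes "submodule J R (regular_module R)"
  shows "ideal J R"
proof -
  interpret M: module R "regular_module R" by (rule regular_module_module)
  note SE = M.submoduleE[OF assms]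
  have z: "\<zero> \<in> J" using subgroup.one_closed[OF submodule.axioms(1)[OF assms]] by simp
  have JR: "x \<in> carrier R" if "x \<in> J" for x using SE(1) that by auto
  have sm: "r \<otimes> x \<in> J" if "r \<in> carrier R" "x \<in> J" for r x using SE(4) that by auto
  have neg: "\<ominus> x \<in> J" if "x \<in> J" for x
    using sm[of "\<ominus> \<one>" x] that JR by (simp add: l_minus)
  show ?thesis
  proof (rule idealI)
    show "subgroup J (add_monoid R)"
      by (rule subgroup.intro) (use JR z neg SE(5) in \<open>auto simp: a_inv_def\<close>)
    show "x \<otimes> r \<in> J" if "x \<in> J" "r \<in> carrier R" for x r
      using sm[of r x] that JR by (simp add: m_comm)
  qed (use sm ring_axioms in auto)
qed

abbreviation tuple_module :: "('r, 'x) ring_scheme \<Rightarrow> ('r, nat \<Rightarrow> 'r) module" where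
  "tuple_module R \<equiv> function_module (regular_module R)"

text \<open>
  The free module \<open>R\<^sup>n\<close>, for all \<open>n\<close> inside the single module of sequences: the induction
  on \<open>n\<close> below needs the tuples whose last entry vanishes to be shorter tuples.
\<close>

definition tuples :: "('r, 'x) ring_scheme \<Rightarrow> nat \<Rightarrow> (nat \<Rightarrow> 'r) set" where
  "tuples R n = {r. (\<forall>k. r k \<in> carrier R) \<and> (\<forall>k\<ge>n. r k = \<zero>\<^bsub>R\<^esub>)}"

lemma (in cring) tuple_module_module: "module R (tuple_module R)"
  by (rule function_module_module[OF regular_module_module])

lemma (in cring) tuples_submodule: "submodule (tuples R n) R (tuple_module R)"
proof -
  interpret T: module R "tuple_module R" by (rule tuple_module_module)
  show ?thesis by (rule T.submoduleI_smult) (auto simp: tuples_def)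
qed

lemma function_module_eval_hom: "(\<lambda>f. f j) \<in> mod_hom R (function_module M) M"
  by (auto simp: mod_hom_def)

lemma lincomb_hom:
  assumes "module R M" and c: "\<And>k. k < n \<Longrightarrow> c k \<in> carrier M"
  shows "(\<lambda>r. nsum M (\<lambda>k. r k \<odot>\<^bsub>M\<^esub> c k) n) \<in> mod_hom R (tuple_module R) M"
proof -
  interpret module R M by fact
  show ?thesis
    unfolding mod_hom_def
  proof (intro CollectI conjI ballI Pi_I)
    fix r s assume "r \<in> carrier (tuple_module R)" "s \<in> carrier (tuple_module R)"
    then have rs: "\<And>k. r k \<in> carrier R" "\<And>k. s k \<in> carrier R" by auto
    show "nsum M (\<lambda>k. r k \<odot>\<^bsub>M\<^esub> c k) n \<in> carrier M" using rs c by (intro M.nsum_closed) auto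
    have "nsum M (\<lambda>k. (r \<oplus>\<^bsub>tuple_module R\<^esub> s) k \<odot>\<^bsub>M\<^esub> c k) n
        = nsum M (\<lambda>k. r k \<odot>\<^bsub>M\<^esub> c k \<oplus>\<^bsub>M\<^esub> s k \<odot>\<^bsub>M\<^esub> c k) n"
      using rs c by (intro nsum_cong) (simp add: smult_l_distr)
    also have "\<dots> = nsum M (\<lambda>k. r k \<odot>\<^bsub>M\<^esub> c k) n \<oplus>\<^bsub>M\<^esub> nsum M (\<lambda>k. s k \<odot>\<^bsub>M\<^esub> c k) n"
      using rs c by (intro M.nsum_add) auto
    finally show "nsum M (\<lambda>k. (r \<oplus>\<^bsub>tuple_module R\<^esub> s) k \<odot>\<^bsub>M\<^esub> c k) n = \<dots>" .
  next
    fix x r assume x: "x \<in> carrier R" and "r \<in> carrier (tuple_module R)"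
    then have r: "\<And>k. r k \<in> carrier R" by auto
    have "x \<odot>\<^bsub>M\<^esub> nsum M (\<lambda>k. r k \<odot>\<^bsub>M\<^esub> c k) n = nsum M (\<lambda>k. x \<odot>\<^bsub>M\<^esub> (r k \<odot>\<^bsub>M\<^esub> c k)) n"
      using r c x by (intro nsum_smult) auto
    also have "\<dots> = nsum M (\<lambda>k. (x \<odot>\<^bsub>tuple_module R\<^esub> r) k \<odot>\<^bsub>M\<^esub> c k) n"
      using r c x by (intro nsum_cong) (simp add: smult_assoc1)
    finally show "nsum M (\<lambda>k. (x \<odot>\<^bsub>tuple_module R\<^esub> r) k \<odot>\<^bsub>M\<^esub> c k) n
        = x \<odot>\<^bsub>M\<^esub> nsum M (\<lambda>k. r k \<odot>\<^bsub>M\<^esub> c k) n" by simp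
  qed
qed

text \<open>
  A submodule of \<open>R\<^sup>n\<close> is finitely generated: the last entries form an ideal, finitely many
  tuples realise its generators, and what remains is a submodule of \<open>R\<^sup>n\<^sup>-\<^sup>1\<close>.  Generation is
  expressed by containment in every submodule \<open>W\<close> so that it can be applied to
  the kernel of a linear form with values in any module, whatever its type.
\<close>

lemma noetherian_tuples:
  assumes "cring R" "noetherian_ring R"
    and "submodule S R (tuple_module R)" "S \<subseteq> tuples R n"
  shows "\<exists>F. finite F \<and> F \<subseteq> S \<and> (\<forall>W. submodule W R (tuple_module R) \<longrightarrow> F \<subseteq> W \<longrightarrow> S \<subseteq> W)"
  using assms(3,4)
proof (induction n arbitrary: S)
  interpret cring R by fact
  interpret T: module R "tuple_module R" by (rule tuple_module_module)
  case 0
  then have "S \<subseteq> {\<zero>\<^bsub>tuple_module R\<^esub>}" by (auto simp: tuples_def fun_eq_iff)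
  moreover have "\<zero>\<^bsub>tuple_module R\<^esub> \<in> W" if "submodule W R (tuple_module R)" for W
    using subgroup.one_closed[OF submodule.axioms(1)[OF that]] by simp
  ultimately show ?case by (intro exI[of _ "{}"]) blast
next
  interpret cring R by fact
  interpret T: module R "tuple_module R" by (rule tuple_module_module)
  case (Suc n)
  let ?ev = "\<lambda>f :: nat \<Rightarrow> 'a. f n"
  have evh: "?ev \<in> mod_hom R (tuple_module R) (regular_module R)"
    by (rule function_module_eval_hom)
  have ev_ideal: "ideal (?ev ` V) R" if "submodule V R (tuple_module R)" for V
    by (rule ideal_of_submodule) (rule mod_hom_image[OF tuple_module_module regular_module_module evh that])
  obtain A where A: "A \<subseteq> carrier R" "finite A" "?ev ` S = genideal R A"
    using noetherian_ring.finetely_gen[OF assms(2) ev_ideal[OF Suc.prems(1)]] by blast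
  have "A \<subseteq> ?ev ` S" using A genideal_self by simp
  then obtain F1 where F1: "F1 \<subseteq> S" "finite F1" "A = ?ev ` F1"
    using finite_subset_image[OF A(2)] by metis
  define S0 where "S0 = S \<inter> {f \<in> carrier (tuple_module R). ?ev f = \<zero>\<^bsub>regular_module R\<^esub>}"
  have S0: "submodule S0 R (tuple_module R)"
    unfolding S0_def
    by (rule submodule_Int[OF tuple_module_module Suc.prems(1)
          mod_hom_kernel[OF tuple_module_module regular_module_module evh]])
  have "f k = \<zero>\<^bsub>R\<^esub>" if "f \<in> S0" "k \<ge> n" for f k
    using that Suc.prems(2) by (cases "k = n") (auto simp: S0_def tuples_def)
  then have "S0 \<subseteq> tuples R n" by (auto simp: tuples_def S0_def)
  from Suc.IH[OF S0 this] obtain F0 where F0: "finite F0" "F0 \<subseteq> S0"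
    "\<And>W. submodule W R (tuple_module R) \<Longrightarrow> F0 \<subseteq> W \<Longrightarrow> S0 \<subseteq> W" by blast
  have "S \<subseteq> W" if W: "submodule W R (tuple_module R)" and F: "F0 \<union> F1 \<subseteq> W" for W
  proof
    fix f assume f: "f \<in> S"
    note WE = T.submoduleE[OF W] and SE = T.submoduleE[OF Suc.prems(1)]
    have "genideal R A \<subseteq> ?ev ` (W \<inter> S)"
      by (rule genideal_minimal[OF ev_ideal[OF submodule_Int[OF tuple_module_module W Suc.prems(1)]]])
         (use F F1 in auto)
    then have "f n \<in> ?ev ` (W \<inter> S)" using A(3) f by blast
    then obtain w where w: "w \<in> W" "w \<in> S" "w n = f n" by auto
    have cl: "f \<in> carrier (tuple_module R)" "w \<in> carrier (tuple_module R)" using f w SE(1) by auto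
    define d where "d = f \<oplus>\<^bsub>tuple_module R\<^esub> \<ominus>\<^bsub>tuple_module R\<^esub> w"
    have fd: "f = d \<oplus>\<^bsub>tuple_module R\<^esub> w"
      using cl by (simp add: d_def T.M.a_assoc T.M.l_neg del: function_module_simps(1))
    have dc: "d \<in> carrier (tuple_module R)" and dS: "d \<in> S"
      using cl f w SE by (simp_all add: d_def del: function_module_simps(1))
    have "f n = d n \<oplus>\<^bsub>R\<^esub> w n" using fun_cong[OF fd, of n] by simp
    then have "d n = \<zero>\<^bsub>R\<^esub>" using w(3) cl dc by (simp add: add.r_cancel_one')
    then have "d \<in> S0" using dS dc by (simp add: S0_def)
    then have "d \<in> W" using F0(3)[OF W] F by blast
    then show "f \<in> W" using fd w(1) WE(5) by simp
  qed
  then show ?case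
    using F0 F1 by (intro exI[of _ "F0 \<union> F1"]) (auto simp: S0_def)
qed

section \<open>Finite presentations of ideals\<close>

definition syzygies :: "('r, 'x) ring_scheme \<Rightarrow> (nat \<Rightarrow> 'r) \<Rightarrow> nat \<Rightarrow> (nat \<Rightarrow> 'r) set" where
  "syzygies R a n = {r \<in> tuples R n. nsum R (\<lambda>k. r k \<otimes>\<^bsub>R\<^esub> a k) n = \<zero>\<^bsub>R\<^esub>}"

locale ideal_presentation = cring R + ideal I R for R (structure) and I +
  fixes a :: "nat \<Rightarrow> 'a" and n :: nat and S :: "(nat \<Rightarrow> 'a) set"
  assumes gen_mem: "k < n \<Longrightarrow> a k \<in> I"
    and span: "b \<in> I \<Longrightarrow> \<exists>r \<in> tuples R n. nsum R (\<lambda>k. r k \<otimes> a k) n = b"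
    and finite_S: "finite S"
    and S_syz: "S \<subseteq> syzygies R a n"
    and S_gen: "submodule W R (tuple_module R) \<Longrightarrow> S \<subseteq> W \<Longrightarrow> syzygies R a n \<subseteq> W"

lemma noetherian_presentation:
  fixes R (structure)
  assumes "cring R" "noetherian_ring R" "ideal I R"
  obtains a n S where "ideal_presentation R I a n S"
proof -
  interpret cring R by fact
  interpret I: ideal I R by fact
  obtain A where A: "A \<subseteq> carrier R" "finite A" "I = genideal R A"
    using noetherian_ring.finetely_gen[OF assms(2,3)] by blast
  obtain n and a :: "nat \<Rightarrow> 'a" where a: "A = a ` {..<n}"
    using A(2) by (auto simp: finite_conv_nat_seg_image lessThan_def)
  have aI: "a k \<in> I" if "k < n" for k using A genideal_self[OF A(1)] a that by auto
  let ?L = "\<lambda>r. nsum (regular_module R) (\<lambda>k. r k \<odot>\<^bsub>regular_module R\<^esub> a k) n"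
  have L: "?L \<in> mod_hom R (tuple_module R) (regular_module R)"
    by (rule lincomb_hom[OF regular_module_module]) (use aI I.a_Hcarr in auto)
  have "ideal (?L ` tuples R n) R"
    by (rule ideal_of_submodule) (rule mod_hom_image[OF tuple_module_module regular_module_module L tuples_submodule])
  moreover have "A \<subseteq> ?L ` tuples R n"
  proof
    fix x assume "x \<in> A"
    then obtain i where i: "i < n" "x = a i" using a by auto
    define e where "e = (\<lambda>k. if k = i then \<one> else \<zero>)"
    have "nsum R (\<lambda>k. e k \<otimes> a k) n = e i \<otimes> a i"
      by (rule nsum_single) (use i aI I.a_Hcarr in \<open>auto simp: e_def\<close>)
    then have "x = ?L e" using i aI I.a_Hcarr by (simp add: e_def)
    moreover have "e \<in> tuples R n" using i by (auto simp: tuples_def e_def)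
    ultimately show "x \<in> ?L ` tuples R n" by blast
  qed
  ultimately have "I \<subseteq> ?L ` tuples R n" using genideal_minimal A(3) by blast
  then have sp: "\<exists>r\<in>tuples R n. nsum R (\<lambda>k. r k \<otimes> a k) n = b" if "b \<in> I" for b
    using that by auto
  have eq: "syzygies R a n
      = tuples R n \<inter> {r \<in> carrier (tuple_module R). ?L r = \<zero>\<^bsub>regular_module R\<^esub>}"
    by (auto simp: syzygies_def tuples_def)
  have "submodule (syzygies R a n) R (tuple_module R)"
    unfolding eq
    by (rule submodule_Int[OF tuple_module_module tuples_submodule
          mod_hom_kernel[OF tuple_module_module regular_module_module L]])
  moreover have "syzygies R a n \<subseteq> tuples R n" by (auto simp: syzygies_def)
  ultimately obtain S where "finite S" "S \<subseteq> syzygies R a n"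
    "\<And>W. submodule W R (tuple_module R) \<Longrightarrow> S \<subseteq> W \<Longrightarrow> syzygies R a n \<subseteq> W"
    using noetherian_tuples[OF assms(1,2)] by metis
  then have "ideal_presentation R I a n S"
    using aI sp by unfold_locales auto
  then show ?thesis by (rule that)
qed

context ideal_presentation
begin

text \<open>
  The tuples \<open>r\<close> with \<open>\<Sum> r\<^sub>k c\<^sub>k = 0\<close> form a submodule containing \<open>S\<close>, hence all syzygies;
  so the value \<open>\<Sum> r\<^sub>k c\<^sub>k\<close> depends only on \<open>\<Sum> r\<^sub>k a\<^sub>k\<close>.
\<close>

lemma extend_hom:
  assumes M: "module R M" and c: "\<And>k. k < n \<Longrightarrow> c k \<in> carrier M"
    and rel: "\<And>s. s \<in> S \<Longrightarrow> nsum M (\<lambda>k. s k \<odot>\<^bsub>M\<^esub> c k) n = \<zero>\<^bsub>M\<^esub>"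
  shows "\<exists>h \<in> mod_hom R (ideal_module R I) M. \<forall>k<n. h (a k) = c k"
proof -
  interpret M: module R M by fact
  interpret T: module R "tuple_module R" by (rule tuple_module_module)
  let ?L = "\<lambda>r. nsum M (\<lambda>k. r k \<odot>\<^bsub>M\<^esub> c k) n"
  let ?A = "\<lambda>r. nsum (regular_module R) (\<lambda>k. r k \<odot>\<^bsub>regular_module R\<^esub> a k) n"
  have L: "?L \<in> mod_hom R (tuple_module R) M" by (rule lincomb_hom[OF M c])
  have A: "?A \<in> mod_hom R (tuple_module R) (regular_module R)"
    by (rule lincomb_hom[OF regular_module_module]) (use gen_mem a_Hcarr in auto)
  have TC: "r \<in> carrier (tuple_module R)" if "r \<in> tuples R n" for r
    using that by (auto simp: tuples_def)
  have "S \<subseteq> {r \<in> carrier (tuple_module R). ?L r = \<zero>\<^bsub>M\<^esub>}"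
    using rel S_syz TC by (auto simp: syzygies_def tuples_def)
  then have syz: "?L r = \<zero>\<^bsub>M\<^esub>" if "r \<in> syzygies R a n" for r
    using S_gen[OF mod_hom_kernel[OF tuple_module_module M L]] that by blast
  note TE = T.submoduleE[OF tuples_submodule[of n]]
  have wd: "?L r = ?L r'" if r: "r \<in> tuples R n" "r' \<in> tuples R n" and e: "?A r = ?A r'" for r r'
  proof -
    let ?d = "r \<oplus>\<^bsub>tuple_module R\<^esub> \<ominus> \<one> \<odot>\<^bsub>tuple_module R\<^esub> r'"
    have d: "?d \<in> tuples R n" using r TE(4,5) by simp
    \<comment> \<open>Needed twice, for the combinations of the \<open>a\<^sub>k\<close> and for those of the \<open>c\<^sub>k\<close>.\<close>
    have diff: "h ?d = h r \<oplus>\<^bsub>P\<^esub> \<ominus>\<^bsub>P\<^esub> h r'"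
      if "module R P" "h \<in> mod_hom R (tuple_module R) P" for P :: "('a, 'z) module" and h
    proof -
      interpret P: module R P by fact
      have "h ?d = h r \<oplus>\<^bsub>P\<^esub> h (\<ominus> \<one> \<odot>\<^bsub>tuple_module R\<^esub> r')"
        using TC r by (intro mod_hom_add[OF that(2)] T.smult_closed) auto
      also have "\<dots> = h r \<oplus>\<^bsub>P\<^esub> \<ominus> \<one> \<odot>\<^bsub>P\<^esub> h r'"
        using TC r by (subst mod_hom_smult[OF that(2)]) auto
      also have "\<dots> = h r \<oplus>\<^bsub>P\<^esub> \<ominus>\<^bsub>P\<^esub> h r'"
        using mod_hom_closed[OF that(2) TC[OF r(2)]] by (simp add: P.smult_l_minus)
      finally show ?thesis .
    qed
    interpret G: module R "regular_module R" by (rule regular_module_module)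
    have "?A ?d = \<zero>"
      using diff[OF regular_module_module A] e G.M.r_neg[OF mod_hom_closed[OF A TC[OF r(2)]]] by simp
    then have "?d \<in> syzygies R a n" using d by (simp add: syzygies_def)
    then have 0: "?L ?d = \<zero>\<^bsub>M\<^esub>" by (rule syz)
    have "?L ?d = ?L r \<oplus>\<^bsub>M\<^esub> \<ominus>\<^bsub>M\<^esub> ?L r'" by (rule diff[OF M L])
    from this 0 have "?L r \<oplus>\<^bsub>M\<^esub> \<ominus>\<^bsub>M\<^esub> ?L r' = \<zero>\<^bsub>M\<^esub>" by (rule trans[OF sym])
    moreover have "?L r \<in> carrier M" "?L r' \<in> carrier M"
      using mod_hom_closed[OF L] TC r by auto
    moreover from this have "?L r = (?L r \<oplus>\<^bsub>M\<^esub> \<ominus>\<^bsub>M\<^esub> ?L r') \<oplus>\<^bsub>M\<^esub> ?L r'"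
      by (simp add: M.M.a_assoc M.M.l_neg)
    ultimately show ?thesis by simp
  qed
  define \<rho> where "\<rho> b = (SOME r. r \<in> tuples R n \<and> ?A r = b)" for b
  have \<rho>: "\<rho> b \<in> tuples R n" "?A (\<rho> b) = b" if "b \<in> I" for b
    using someI_ex[of "\<lambda>r. r \<in> tuples R n \<and> ?A r = b"] span[OF that]
    unfolding \<rho>_def by auto
  define h where "h b = ?L (\<rho> b)" for b
  have h: "h (?A r) = ?L r" if "r \<in> tuples R n" "?A r \<in> I" for r
    unfolding h_def using that \<rho>[OF that(2)] by (intro wd) auto
  have "h \<in> mod_hom R (ideal_module R I) M"
    unfolding mod_hom_def
  proof (intro CollectI conjI ballI Pi_I)
    fix x y assume "x \<in> carrier (ideal_module R I)" "y \<in> carrier (ideal_module R I)"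
    then have xy: "x \<in> I" "y \<in> I" by simp_all
    show "h x \<in> carrier M" unfolding h_def by (rule mod_hom_closed[OF L TC[OF \<rho>(1)[OF xy(1)]]])
    have "?A (\<rho> x \<oplus>\<^bsub>tuple_module R\<^esub> \<rho> y) = x \<oplus> y"
      using mod_hom_add[OF A TC[OF \<rho>(1)[OF xy(1)]] TC[OF \<rho>(1)[OF xy(2)]]] \<rho>(2) xy by simp
    then have "h (x \<oplus> y) = ?L (\<rho> x \<oplus>\<^bsub>tuple_module R\<^esub> \<rho> y)"
      using h[of "\<rho> x \<oplus>\<^bsub>tuple_module R\<^esub> \<rho> y"] TE(5) \<rho>(1) xy a_closed by metis
    then show "h (x \<oplus>\<^bsub>ideal_module R I\<^esub> y) = h x \<oplus>\<^bsub>M\<^esub> h y"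
      using mod_hom_add[OF L TC[OF \<rho>(1)[OF xy(1)]] TC[OF \<rho>(1)[OF xy(2)]]] by (simp add: h_def)
  next
    fix u x assume u: "u \<in> carrier R" and "x \<in> carrier (ideal_module R I)"
    then have x: "x \<in> I" by simp
    have "?A (u \<odot>\<^bsub>tuple_module R\<^esub> \<rho> x) = u \<otimes> x"
      using mod_hom_smult[OF A u TC[OF \<rho>(1)[OF x]]] \<rho>(2) x by simp
    then have "h (u \<otimes> x) = ?L (u \<odot>\<^bsub>tuple_module R\<^esub> \<rho> x)"
      using h[of "u \<odot>\<^bsub>tuple_module R\<^esub> \<rho> x"] TE(4) \<rho>(1) x u I_l_closed by metis
    then show "h (u \<odot>\<^bsub>ideal_module R I\<^esub> x) = u \<odot>\<^bsub>M\<^esub> h x"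
      using mod_hom_smult[OF L u TC[OF \<rho>(1)[OF x]]] by (simp add: h_def)
  qed
  moreover have "h (a i) = c i" if i: "i < n" for i
  proof -
    let ?e = "\<lambda>k. if k = i then \<one> else \<zero>"
    have "nsum R (\<lambda>k. ?e k \<otimes> a k) n = ?e i \<otimes> a i"
      by (rule nsum_single) (use i gen_mem a_Hcarr in auto)
    then have "?A ?e = a i" using i gen_mem a_Hcarr by simp
    moreover have "nsum M (\<lambda>k. ?e k \<odot>\<^bsub>M\<^esub> c k) n = ?e i \<odot>\<^bsub>M\<^esub> c i"
      by (rule M.M.nsum_single) (use i c in auto)
    moreover have "?e \<in> tuples R n" using i by (auto simp: tuples_def)
    ultimately show ?thesis using h[of ?e] gen_mem[OF i] c[OF i] by simp
  qed
  ultimately show ?thesis by blast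
qed

text \<open>
  The index set is \<open>Hom(I, M)\<close> itself, and \<open>\<phi>\<close> adds up the values of the homomorphisms at
  the components that they index.
\<close>

lemma I_generatedI_sums:
  assumes M: "module R M"
    and sums: "\<And>x. x \<in> carrier M \<Longrightarrow>
      \<exists>h. (\<forall>j<n. h j \<in> mod_hom R (ideal_module R I) M) \<and> x = nsum M (\<lambda>j. h j (a j)) n"
  shows "I_generated R I M"
proof -
  interpret M: module R M by fact
  have Im: "module R (ideal_module R I)" by (rule ideal_module_module[OF is_cring ideal_axioms])
  define \<Lambda> where "\<Lambda> = mod_hom R (ideal_module R I) M"
  let ?P = "copower \<Lambda> (ideal_module R I)"
  have mem: "f \<in> carrier ?P \<longleftrightarrow> f \<in> \<Lambda> \<rightarrow>\<^sub>E I \<and> finite {h\<in>\<Lambda>. f h \<noteq> \<zero>}" for f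
    by (simp add: copower_def)
  have add: "f \<oplus>\<^bsub>?P\<^esub> g = (\<lambda>h\<in>\<Lambda>. f h \<oplus> g h)" for f g by (simp add: copower_def)
  have sm: "r \<odot>\<^bsub>?P\<^esub> f = (\<lambda>h\<in>\<Lambda>. r \<otimes> f h)" for r f by (simp add: copower_def)
  define \<phi> where "\<phi> f = (\<Oplus>\<^bsub>M\<^esub>h\<in>{h\<in>\<Lambda>. f h \<noteq> \<zero>}. h (f h))" for f
  have hz: "h \<zero> = \<zero>\<^bsub>M\<^esub>" if "h \<in> \<Lambda>" for h
    using mod_hom_zero[OF Im M] that by (auto simp: \<Lambda>_def)
  have hI: "h x \<in> carrier M" if "h \<in> \<Lambda>" "x \<in> I" for h x
    using that mod_hom_closed[of h R "ideal_module R I" M x] by (auto simp: \<Lambda>_def)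
  have fI: "f h \<in> I" if "f \<in> carrier ?P" "h \<in> \<Lambda>" for f h using that by (auto simp: mem)
  have \<phi>: "\<phi> f = (\<Oplus>\<^bsub>M\<^esub>h\<in>Y. h (f h))"
    if "f \<in> carrier ?P" "finite Y" "Y \<subseteq> \<Lambda>" "{h\<in>\<Lambda>. f h \<noteq> \<zero>} \<subseteq> Y" for f Y
    unfolding \<phi>_def
    by (rule M.M.add.finprod_mono_neutral_cong_left) (use that hz hI fI in auto)
  have Padd: "f \<oplus>\<^bsub>?P\<^esub> g \<in> carrier ?P \<and> \<phi> (f \<oplus>\<^bsub>?P\<^esub> g) = \<phi> f \<oplus>\<^bsub>M\<^esub> \<phi> g"
    if f: "f \<in> carrier ?P" and g: "g \<in> carrier ?P" for f g
  proof -
    define Y where "Y = {h\<in>\<Lambda>. f h \<noteq> \<zero>} \<union> {h\<in>\<Lambda>. g h \<noteq> \<zero>}"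
    have Y: "finite Y" "Y \<subseteq> \<Lambda>" using f g by (auto simp: Y_def mem)
    have sub: "{h\<in>\<Lambda>. (f \<oplus>\<^bsub>?P\<^esub> g) h \<noteq> \<zero>} \<subseteq> Y" by (auto simp: Y_def add)
    then have "finite {h\<in>\<Lambda>. (f \<oplus>\<^bsub>?P\<^esub> g) h \<noteq> \<zero>}" using Y finite_subset by blast
    moreover have "f \<oplus>\<^bsub>?P\<^esub> g \<in> \<Lambda> \<rightarrow>\<^sub>E I" using f g fI by (auto simp: add)
    ultimately have fg: "f \<oplus>\<^bsub>?P\<^esub> g \<in> carrier ?P" by (simp add: mem)
    have "\<phi> (f \<oplus>\<^bsub>?P\<^esub> g) = (\<Oplus>\<^bsub>M\<^esub>h\<in>Y. h ((f \<oplus>\<^bsub>?P\<^esub> g) h))" by (rule \<phi>[OF fg Y sub])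
    also have "\<dots> = (\<Oplus>\<^bsub>M\<^esub>h\<in>Y. h (f h) \<oplus>\<^bsub>M\<^esub> h (g h))"
    proof (rule M.M.finsum_cong')
      show "h ((f \<oplus>\<^bsub>?P\<^esub> g) h) = h (f h) \<oplus>\<^bsub>M\<^esub> h (g h)" if "h \<in> Y" for h
      proof -
        have h: "h \<in> \<Lambda>" using that Y by blast
        then have "h (f h \<oplus> g h) = h (f h) \<oplus>\<^bsub>M\<^esub> h (g h)"
          using mod_hom_add[of h R "ideal_module R I" M "f h" "g h"] fI f g by (simp add: \<Lambda>_def)
        then show ?thesis using h by (simp add: add)
      qed
    qed (use Y hI fI f g in auto)
    also have "\<dots> = (\<Oplus>\<^bsub>M\<^esub>h\<in>Y. h (f h)) \<oplus>\<^bsub>M\<^esub> (\<Oplus>\<^bsub>M\<^esub>h\<in>Y. h (g h))"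
      by (rule M.M.finsum_addf) (use Y hI fI f g in auto)
    also have "(\<Oplus>\<^bsub>M\<^esub>h\<in>Y. h (f h)) = \<phi> f" by (rule \<phi>[OF f Y, symmetric]) (auto simp: Y_def)
    also have "(\<Oplus>\<^bsub>M\<^esub>h\<in>Y. h (g h)) = \<phi> g" by (rule \<phi>[OF g Y, symmetric]) (auto simp: Y_def)
    finally show ?thesis using fg by simp
  qed
  have \<phi>sm: "\<phi> (r \<odot>\<^bsub>?P\<^esub> f) = r \<odot>\<^bsub>M\<^esub> \<phi> f" if r: "r \<in> carrier R" and f: "f \<in> carrier ?P" for r f
  proof -
    define Y where "Y = {h\<in>\<Lambda>. f h \<noteq> \<zero>}"
    have Y: "finite Y" "Y \<subseteq> \<Lambda>" using f by (auto simp: Y_def mem)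
    have sub: "{h\<in>\<Lambda>. (r \<odot>\<^bsub>?P\<^esub> f) h \<noteq> \<zero>} \<subseteq> Y" using r by (auto simp: Y_def sm)
    then have "finite {h\<in>\<Lambda>. (r \<odot>\<^bsub>?P\<^esub> f) h \<noteq> \<zero>}" using Y finite_subset by blast
    moreover have "r \<odot>\<^bsub>?P\<^esub> f \<in> \<Lambda> \<rightarrow>\<^sub>E I" using f fI r I_l_closed by (auto simp: sm)
    ultimately have rf: "r \<odot>\<^bsub>?P\<^esub> f \<in> carrier ?P" by (simp add: mem)
    have "\<phi> (r \<odot>\<^bsub>?P\<^esub> f) = (\<Oplus>\<^bsub>M\<^esub>h\<in>Y. h ((r \<odot>\<^bsub>?P\<^esub> f) h))" by (rule \<phi>[OF rf Y sub])
    also have "\<dots> = (\<Oplus>\<^bsub>M\<^esub>h\<in>Y. r \<odot>\<^bsub>M\<^esub> h (f h))"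
    proof (rule M.M.finsum_cong')
      show "h ((r \<odot>\<^bsub>?P\<^esub> f) h) = r \<odot>\<^bsub>M\<^esub> h (f h)" if "h \<in> Y" for h
      proof -
        have h: "h \<in> \<Lambda>" using that Y by blast
        then have "h (r \<otimes> f h) = r \<odot>\<^bsub>M\<^esub> h (f h)"
          using mod_hom_smult[of h R "ideal_module R I" M r "f h"] fI f r by (simp add: \<Lambda>_def)
        then show ?thesis using h by (simp add: sm)
      qed
    qed (use Y hI fI f r in auto)
    also have "\<dots> = r \<odot>\<^bsub>M\<^esub> \<phi> f"
      unfolding \<phi>_def Y_def[symmetric]
      by (rule M.finsum_smult_ldistr[symmetric]) (use Y r hI fI f in auto)
    finally show ?thesis .
  qed
  have \<phi>cl: "\<phi> f \<in> carrier M" if "f \<in> carrier ?P" for f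
    unfolding \<phi>_def by (rule M.M.finsum_closed) (use that hI fI in auto)
  have hom: "\<phi> \<in> mod_hom R ?P M"
    using \<phi>cl Padd \<phi>sm by (auto simp: mod_hom_def)
  have zero: "\<zero>\<^bsub>M\<^esub> \<in> \<phi> ` carrier ?P"
  proof (rule image_eqI)
    show "(\<lambda>h\<in>\<Lambda>. \<zero>) \<in> carrier ?P" by (auto simp: mem additive_subgroup.zero_closed[OF additive_subgroup_axioms])
    have "{h \<in> \<Lambda>. (\<lambda>h\<in>\<Lambda>. \<zero>) h \<noteq> \<zero>} = {}" by auto
    then show "\<zero>\<^bsub>M\<^esub> = \<phi> (\<lambda>h\<in>\<Lambda>. \<zero>)" unfolding \<phi>_def by (simp only: M.M.finsum_empty)
  qed
  have single: "h b \<in> \<phi> ` carrier ?P" if h: "h \<in> \<Lambda>" and b: "b \<in> I" for h b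
  proof (rule image_eqI)
    let ?f = "\<lambda>g\<in>\<Lambda>. if g = h then b else \<zero>"
    have s: "{g\<in>\<Lambda>. ?f g \<noteq> \<zero>} \<subseteq> {h}" by auto
    show f: "?f \<in> carrier ?P"
      using b finite_subset[OF s] by (auto simp: mem additive_subgroup.zero_closed[OF additive_subgroup_axioms])
    have "\<phi> ?f = (\<Oplus>\<^bsub>M\<^esub>g\<in>{h}. g (?f g))" by (rule \<phi>[OF f _ _ s]) (use h in auto)
    then show "h b = \<phi> ?f" using h b hI by simp
  qed
  have "x \<in> \<phi> ` carrier ?P" if x: "x \<in> carrier M" for x
  proof -
    obtain h where h: "\<forall>j<n. h j \<in> \<Lambda>" and xe: "x = nsum M (\<lambda>j. h j (a j)) n"
      using sums[OF x] by (auto simp: \<Lambda>_def)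
    have "nsum M (\<lambda>j. h j (a j)) k \<in> \<phi> ` carrier ?P" if "k \<le> n" for k
      using that
    proof (induction k)
      case (Suc k)
      then obtain f where f: "f \<in> carrier ?P" "nsum M (\<lambda>j. h j (a j)) k = \<phi> f" by auto
      have "h k (a k) \<in> \<phi> ` carrier ?P" using Suc.prems h gen_mem by (intro single) auto
      then obtain g where g: "g \<in> carrier ?P" "h k (a k) = \<phi> g" by auto
      have "nsum M (\<lambda>j. h j (a j)) (Suc k) = \<phi> (f \<oplus>\<^bsub>?P\<^esub> g)" using f g Padd by simp
      then show ?case using Padd[OF f(1) g(1)] by blast
    qed (use zero in simp)
    then show ?thesis using xe by blast
  qed
  then have "\<phi> ` carrier ?P = carrier M" using \<phi>cl by blast
  then show ?thesis using I_generatedI[OF ideal_axioms M hom] by blast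
qed

text \<open>
  The bound \<open>n\<close> on the number of summands is uniform: if \<open>b = \<Sum> r\<^sub>k a\<^sub>k\<close> then
  \<open>h(b) = \<Sum> (r\<^sub>k h)(a\<^sub>k)\<close>, so the homomorphisms of an arbitrarily long sum can be collected
  according to the generator at which they are evaluated.
\<close>

lemma I_generatedD_sums:
  assumes gen: "I_generated R I M" and x: "x \<in> carrier M"
  shows "\<exists>h. (\<forall>j<n. h j \<in> mod_hom R (ideal_module R I) M) \<and> x = nsum M (\<lambda>j. h j (a j)) n"
proof -
  obtain \<Lambda> :: "('a \<Rightarrow> 'c) set" and \<phi> where M: "module R M"
    and \<phi>: "\<phi> \<in> mod_hom R (copower \<Lambda> (ideal_module R I)) M"
    and surj: "\<phi> ` carrier (copower \<Lambda> (ideal_module R I)) = carrier M"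
    using gen unfolding I_generated_def by blast
  interpret M: module R M by fact
  have Im: "module R (ideal_module R I)" by (rule ideal_module_module[OF is_cring ideal_axioms])
  interpret Im: module R "ideal_module R I" by (rule Im)
  have IR: "\<And>b. b \<in> I \<Longrightarrow> b \<in> carrier R" by (rule a_Hcarr)
  have zI: "\<zero> \<in> I" by (rule additive_subgroup.zero_closed[OF additive_subgroup_axioms])
  let ?H = "mod_hom R (ideal_module R I) M"
  define T where "T = {nsum M (\<lambda>j. h j (a j)) n | h. \<forall>j<n. h j \<in> ?H}"
  have TI: "nsum M (\<lambda>j. h j (a j)) n \<in> T" if "\<And>j. j < n \<Longrightarrow> h j \<in> ?H" for h
    using that by (auto simp: T_def)
  have Hzero: "(\<lambda>_. \<zero>\<^bsub>M\<^esub>) \<in> ?H" by (auto simp: mod_hom_def)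
  have Tadd: "u \<oplus>\<^bsub>M\<^esub> v \<in> T" if uv: "u \<in> T" "v \<in> T" for u v
  proof -
    obtain g h where g: "\<And>j. j < n \<Longrightarrow> g j \<in> ?H" "u = nsum M (\<lambda>j. g j (a j)) n"
      and h: "\<And>j. j < n \<Longrightarrow> h j \<in> ?H" "v = nsum M (\<lambda>j. h j (a j)) n"
      using uv by (auto simp: T_def)
    have "u \<oplus>\<^bsub>M\<^esub> v = nsum M (\<lambda>j. g j (a j) \<oplus>\<^bsub>M\<^esub> h j (a j)) n"
      unfolding g(2) h(2)
      by (rule M.M.nsum_add[symmetric]) (use mod_hom_closed[OF g(1)] mod_hom_closed[OF h(1)] gen_mem in auto)
    also have "\<dots> \<in> T"
      using TI[of "\<lambda>j b. g j b \<oplus>\<^bsub>M\<^esub> h j b"] mod_hom_plus[OF M g(1) h(1)] by simp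
    finally show ?thesis .
  qed
  have Tzero: "\<zero>\<^bsub>M\<^esub> \<in> T"
    using TI[of "\<lambda>_ _. \<zero>\<^bsub>M\<^esub>"] Hzero M.M.nsum_zero[of n "\<lambda>_. \<zero>\<^bsub>M\<^esub>"] by simp
  have Thom: "h b \<in> T" if h: "h \<in> ?H" and b: "b \<in> I" for h b
  proof -
    obtain r where r: "r \<in> tuples R n" "nsum R (\<lambda>k. r k \<otimes> a k) n = b" using span[OF b] by blast
    have rR: "r k \<in> carrier R" for k using r by (simp add: tuples_def)
    have "h b = nsum M (\<lambda>k. r k \<odot>\<^bsub>M\<^esub> h (a k)) n"
      using mod_hom_lincomb[OF Im M h, of n r a] rR gen_mem r by simp
    moreover have "(\<lambda>b. r j \<odot>\<^bsub>M\<^esub> h b) \<in> ?H" for j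
      by (rule mod_hom_scale[OF M h rR])
    ultimately show ?thesis using TI[of "\<lambda>j b. r j \<odot>\<^bsub>M\<^esub> h b"] by simp
  qed
  let ?P = "copower \<Lambda> (ideal_module R I)"
  have mem: "f \<in> carrier ?P \<longleftrightarrow> f \<in> \<Lambda> \<rightarrow>\<^sub>E I \<and> finite {l\<in>\<Lambda>. f l \<noteq> \<zero>}" for f
    by (simp add: copower_def)
  have add: "f \<oplus>\<^bsub>?P\<^esub> g = (\<lambda>l\<in>\<Lambda>. f l \<oplus> g l)" for f g by (simp add: copower_def)
  have sm: "r \<odot>\<^bsub>?P\<^esub> f = (\<lambda>l\<in>\<Lambda>. r \<otimes> f l)" for r f by (simp add: copower_def)
  define \<iota> where "\<iota> l b = (\<lambda>i\<in>\<Lambda>. if i = l then b else \<zero>)" for l and b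
  have \<iota>: "\<iota> l b \<in> carrier ?P" if "b \<in> I" for l b
  proof -
    have "{i\<in>\<Lambda>. \<iota> l b i \<noteq> \<zero>} \<subseteq> {l}" by (auto simp: \<iota>_def)
    then have "finite {i\<in>\<Lambda>. \<iota> l b i \<noteq> \<zero>}" by (rule finite_subset) simp
    then show ?thesis using that zI by (auto simp: mem \<iota>_def)
  qed
  have \<iota>hom: "\<iota> l \<in> mod_hom R (ideal_module R I) ?P" for l
    unfolding mod_hom_def
    using \<iota> by (auto simp: add sm \<iota>_def fun_eq_iff)
  have "\<phi> f \<in> T" if "finite Y" "Y \<subseteq> \<Lambda>" "f \<in> carrier ?P" "\<forall>l\<in>\<Lambda> - Y. f l = \<zero>" for f Y
    using that
  proof (induction Y arbitrary: f rule: finite_induct)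
    case empty
    have "\<zero> \<odot>\<^bsub>?P\<^esub> f = f"
    proof (rule extensionalityI[of _ \<Lambda>])
      show "f \<in> extensional \<Lambda>" using empty(2) by (simp add: mem PiE_iff)
      show "(\<zero> \<odot>\<^bsub>?P\<^esub> f) l = f l" if "l \<in> \<Lambda>" for l
        using that empty(3) IR[OF zI] by (simp add: sm)
    qed (simp add: sm)
    then have "\<phi> f = \<phi> (\<zero> \<odot>\<^bsub>?P\<^esub> f)" by (simp only:)
    also have "\<dots> = \<zero> \<odot>\<^bsub>M\<^esub> \<phi> f" by (rule mod_hom_smult[OF \<phi> IR[OF zI] empty(2)])
    also have "\<dots> = \<zero>\<^bsub>M\<^esub>" by (rule M.smult_l_null[OF mod_hom_closed[OF \<phi> empty(2)]])
    finally show ?case using Tzero by (simp only:)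
  next
    case (insert l Y)
    define g where "g = (\<lambda>i\<in>\<Lambda>. if i = l then \<zero> else f i)"
    have f: "f \<in> \<Lambda> \<rightarrow>\<^sub>E I" "finite {i\<in>\<Lambda>. f i \<noteq> \<zero>}" and l: "l \<in> \<Lambda>" "Y \<subseteq> \<Lambda>"
      using insert.prems by (simp_all add: mem)
    have fl: "f l \<in> I" using f l by auto
    have fR: "\<And>i. i \<in> \<Lambda> \<Longrightarrow> f i \<in> carrier R" using f IR by (auto simp: PiE_iff)
    have "finite {i\<in>\<Lambda>. g i \<noteq> \<zero>}" by (rule finite_subset[OF _ f(2)]) (auto simp: g_def)
    then have g: "g \<in> carrier ?P" using f zI by (auto simp: mem g_def PiE_iff)
    have "f = \<iota> l (f l) \<oplus>\<^bsub>?P\<^esub> g"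
    proof (rule extensionalityI[of _ \<Lambda>])
      show "f \<in> extensional \<Lambda>" using f by (auto simp: PiE_iff)
    qed (use fR in \<open>auto simp: add \<iota>_def g_def\<close>)
    then have "\<phi> f = \<phi> (\<iota> l (f l)) \<oplus>\<^bsub>M\<^esub> \<phi> g"
      by (rule trans[OF arg_cong[of _ _ \<phi>] mod_hom_add[OF \<phi> \<iota>[OF fl] g]])
    moreover have "\<phi> (\<iota> l (f l)) \<in> T" by (rule Thom[OF mod_hom_comp[OF \<iota>hom \<phi>] fl])
    moreover have "\<phi> g \<in> T"
      by (rule insert.IH[OF l(2) g]) (use insert.prems(3) in \<open>simp add: g_def\<close>)
    ultimately show ?case using Tadd by simp
  qed
  note supp = this
  obtain f where f: "f \<in> carrier ?P" "x = \<phi> f" using x surj by blast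
  have "\<phi> f \<in> T"
    by (rule supp[of "{l\<in>\<Lambda>. f l \<noteq> \<zero>}"]) (use f in \<open>auto simp: mem\<close>)
  then show ?thesis using f by (auto simp: T_def)
qed

end

section \<open>Pure submodules and extensions\<close>

text \<open>
  A linear combination is built by finitely many additions and scalar multiplications, so
  a map that respects these operations at the partial sums respects the combination.
\<close>

lemma pure_retract_lincombs:
  fixes R :: "('r, 'x) ring_scheme" and B :: "('r, 'b) module" and E :: "((nat \<Rightarrow> 'r) \<times> (nat \<Rightarrow> 'b)) set"
  assumes B: "module R B" and pure: "pure_submodule R A B"
    and E: "finite E" "\<And>r b k. (r, b) \<in> E \<Longrightarrow> k < n \<Longrightarrow> r k \<in> carrier R \<and> b k \<in> carrier B"
    and F: "finite F" "F \<subseteq> A"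
  obtains t where "\<And>x. t x \<in> A" "\<And>x. x \<in> F \<Longrightarrow> t x = x"
    and "\<And>r b. (r, b) \<in> E \<Longrightarrow>
      t (nsum B (\<lambda>k. r k \<odot>\<^bsub>B\<^esub> b k) n) = nsum B (\<lambda>k. r k \<odot>\<^bsub>B\<^esub> t (b k)) n"
proof -
  interpret B: module R B by fact
  have sub: "submodule A R B" using pure by (simp add: pure_submodule_def)
  have z: "\<zero>\<^bsub>B\<^esub> \<in> A" using subgroup.one_closed[OF submodule.axioms(1)[OF sub]] by simp
  let ?EA = "(\<lambda>((r, b), m). (nsum B (\<lambda>k. r k \<odot>\<^bsub>B\<^esub> b k) m, r m \<odot>\<^bsub>B\<^esub> b m)) ` (E \<times> {..<n})"
  let ?ES = "(\<lambda>((r, b), m). (r m, b m)) ` (E \<times> {..<n})"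
  have cl: "nsum B (\<lambda>k. r k \<odot>\<^bsub>B\<^esub> b k) m \<in> carrier B" if "(r, b) \<in> E" "m \<le> n" for r b m
    using that E(2) by (intro B.M.nsum_closed) auto
  have "\<exists>t. (\<forall>x. t x \<in> A) \<and>
     (\<forall>(b, b')\<in>?EA. t (b \<oplus>\<^bsub>B\<^esub> b') = t b \<oplus>\<^bsub>B\<^esub> t b') \<and>
     (\<forall>(r, b)\<in>?ES. t (r \<odot>\<^bsub>B\<^esub> b) = r \<odot>\<^bsub>B\<^esub> t b) \<and> (\<forall>a\<in>insert \<zero>\<^bsub>B\<^esub> F. t a = a)"
    by (rule pure_retract_finite[OF B pure]) (use E F z cl in auto)
  then obtain t where t: "\<And>x. t x \<in> A" "\<And>x. x \<in> F \<Longrightarrow> t x = x" "t \<zero>\<^bsub>B\<^esub> = \<zero>\<^bsub>B\<^esub>"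
    and tadd: "\<And>r b m. (r, b) \<in> E \<Longrightarrow> m < n \<Longrightarrow> t (nsum B (\<lambda>k. r k \<odot>\<^bsub>B\<^esub> b k) m \<oplus>\<^bsub>B\<^esub> r m \<odot>\<^bsub>B\<^esub> b m)
      = t (nsum B (\<lambda>k. r k \<odot>\<^bsub>B\<^esub> b k) m) \<oplus>\<^bsub>B\<^esub> t (r m \<odot>\<^bsub>B\<^esub> b m)"
    and tsm: "\<And>r b m. (r, b) \<in> E \<Longrightarrow> m < n \<Longrightarrow> t (r m \<odot>\<^bsub>B\<^esub> b m) = r m \<odot>\<^bsub>B\<^esub> t (b m)"
    by force
  have "t (nsum B (\<lambda>k. r k \<odot>\<^bsub>B\<^esub> b k) m) = nsum B (\<lambda>k. r k \<odot>\<^bsub>B\<^esub> t (b k)) m"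
    if "(r, b) \<in> E" "m \<le> n" for r b m
    using that(2) by (induction m) (use that(1) t tadd tsm in auto)
  then show ?thesis using that t by blast
qed

context ideal_presentation
begin

lemma S_carrier: "s \<in> S \<Longrightarrow> s k \<in> carrier R"
  using S_syz by (auto simp: syzygies_def tuples_def)

lemma hom_syzygy:
  assumes "module R M" "h \<in> mod_hom R (ideal_module R I) M" "s \<in> S"
  shows "nsum M (\<lambda>k. s k \<odot>\<^bsub>M\<^esub> h (a k)) n = \<zero>\<^bsub>M\<^esub>"
proof -
  have Im: "module R (ideal_module R I)" by (rule ideal_module_module[OF is_cring ideal_axioms])
  have "nsum R (\<lambda>k. s k \<otimes> a k) n = \<zero>" using S_syz assms(3) by (auto simp: syzygies_def)
  then show ?thesis
    using mod_hom_lincomb[OF Im assms(1,2), of n s a] S_carrier[OF assms(3)] gen_mem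
      mod_hom_zero[OF Im assms(1,2)] by simp
qed

lemma I_generated_pure_submodule:
  assumes gen: "I_generated R I B" and pure: "pure_submodule R A B"
  shows "I_generated R I (B\<lparr>carrier := A\<rparr>)"
proof -
  have B: "module R B" using gen by (simp add: I_generated_def)
  interpret B: module R B by fact
  have sub: "submodule A R B" using pure by (simp add: pure_submodule_def)
  have AB: "A \<subseteq> carrier B" using B.submoduleE(1)[OF sub] .
  have zA: "\<zero>\<^bsub>B\<^esub> \<in> A" using subgroup.one_closed[OF submodule.axioms(1)[OF sub]] by simp
  let ?A = "B\<lparr>carrier := A\<rparr>"
  have A: "module R ?A" by (rule submodule.submodule_is_module[OF sub B])
  show ?thesis
  proof (rule I_generatedI_sums[OF A])
    fix x assume "x \<in> carrier ?A"
    then have x: "x \<in> A" by simp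
    obtain h where h: "\<And>j. j < n \<Longrightarrow> h j \<in> mod_hom R (ideal_module R I) B"
      and xe: "x = nsum B (\<lambda>j. h j (a j)) n"
      using I_generatedD_sums[OF gen, of x] x AB by blast
    have hB: "h j (a k) \<in> carrier B" if "j < n" "k < n" for j k
      using mod_hom_closed[OF h[OF that(1)]] gen_mem[OF that(2)] by simp
    \<comment> \<open>The first part makes the images \<open>t (h j (a k))\<close> satisfy the relations in \<open>S\<close>; the
      last combination, with all coefficients \<open>1\<close>, keeps their sum equal to \<open>x\<close>.\<close>
    define E where "E = (\<lambda>(s, j). (s, \<lambda>k. h j (a k))) ` (S \<times> {..<n}) \<union> {(\<lambda>_. \<one>, \<lambda>j. h j (a j))}"
    obtain t where tA: "\<And>x. t x \<in> A" and tF: "\<And>y. y \<in> {\<zero>\<^bsub>B\<^esub>, x} \<Longrightarrow> t y = y"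
      and tE: "\<And>r b. (r, b) \<in> E \<Longrightarrow>
        t (nsum B (\<lambda>k. r k \<odot>\<^bsub>B\<^esub> b k) n) = nsum B (\<lambda>k. r k \<odot>\<^bsub>B\<^esub> t (b k)) n"
      by (rule pure_retract_lincombs[OF B pure, of E n "{\<zero>\<^bsub>B\<^esub>, x}"])
         (use finite_S S_carrier hB x zA in \<open>auto simp: E_def\<close>)
    have "\<exists>g \<in> mod_hom R (ideal_module R I) ?A. \<forall>k<n. g (a k) = t (h j (a k))" if j: "j < n" for j
    proof (rule extend_hom[OF A])
      fix s assume s: "s \<in> S"
      have "nsum B (\<lambda>k. s k \<odot>\<^bsub>B\<^esub> t (h j (a k))) n = t (nsum B (\<lambda>k. s k \<odot>\<^bsub>B\<^esub> h j (a k)) n)"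
        by (rule tE[symmetric]) (use s j in \<open>auto simp: E_def\<close>)
      then show "nsum ?A (\<lambda>k. s k \<odot>\<^bsub>?A\<^esub> t (h j (a k))) n = \<zero>\<^bsub>?A\<^esub>"
        using hom_syzygy[OF B h[OF j] s] tF by simp
    qed (use tA in simp)
    then obtain g where g: "\<And>j. j < n \<Longrightarrow> g j \<in> mod_hom R (ideal_module R I) ?A"
      "\<And>j k. j < n \<Longrightarrow> k < n \<Longrightarrow> g j (a k) = t (h j (a k))" by metis
    have one: "nsum B (\<lambda>j. \<one> \<odot>\<^bsub>B\<^esub> f j) n = nsum B f n" if "\<And>j. j < n \<Longrightarrow> f j \<in> carrier B" for f
      using that by (intro nsum_cong) simp
    have "x = t (nsum B (\<lambda>j. \<one> \<odot>\<^bsub>B\<^esub> h j (a j)) n)" using one hB xe tF by simp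
    also have "\<dots> = nsum B (\<lambda>j. \<one> \<odot>\<^bsub>B\<^esub> t (h j (a j))) n" by (rule tE) (simp add: E_def)
    also have "\<dots> = nsum B (\<lambda>j. t (h j (a j))) n" by (rule one) (use tA AB in auto)
    also have "\<dots> = nsum ?A (\<lambda>j. g j (a j)) n" using g by (auto intro: nsum_cong)
    finally show "\<exists>h. (\<forall>j<n. h j \<in> mod_hom R (ideal_module R I) ?A) \<and> x = nsum ?A (\<lambda>j. h j (a j)) n"
      using g(1) by blast
  qed
qed

text \<open>
  For lifts \<open>b\<^sub>k\<close> of \<open>h(a\<^sub>k)\<close> the relations \<open>\<Sum> s\<^sub>k b\<^sub>k\<close> lie in the kernel \<open>K\<close> but need not
  vanish.  A map \<open>t\<close> into \<open>K\<close> that respects and fixes them gives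
  \<open>\<Sum> s\<^sub>k t(b\<^sub>k) = \<Sum> s\<^sub>k b\<^sub>k\<close>, so the differences \<open>b\<^sub>k - t(b\<^sub>k)\<close> are again lifts and satisfy
  the relations.
\<close>

lemma pure_exact_lift:
  assumes ex: "pure_exact R A f B g C" and h: "h \<in> mod_hom R (ideal_module R I) C"
  shows "\<exists>h' \<in> mod_hom R (ideal_module R I) B. \<forall>k<n. g (h' (a k)) = h (a k)"
proof -
  have mods: "module R A" "module R B" "module R C" and f: "f \<in> mod_hom R A B"
    and g: "g \<in> mod_hom R B C" and gs: "g ` carrier B = carrier C"
    and im: "f ` carrier A = {b \<in> carrier B. g b = \<zero>\<^bsub>C\<^esub>}"
    and pure: "pure_submodule R (f ` carrier A) B"
    using ex by (auto simp: pure_exact_def)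
  interpret B: module R B by (rule mods)
  interpret C: module R C by (rule mods)
  let ?K = "f ` carrier A"
  have "\<forall>k. \<exists>b. k < n \<longrightarrow> b \<in> carrier B \<and> g b = h (a k)"
    using mod_hom_closed[OF h] gen_mem gs by (simp, metis imageE)
  then obtain b where b: "\<And>k. k < n \<Longrightarrow> b k \<in> carrier B" "\<And>k. k < n \<Longrightarrow> g (b k) = h (a k)" by metis
  let ?r = "\<lambda>s c. nsum B (\<lambda>k. s k \<odot>\<^bsub>B\<^esub> c k) n"
  have rK: "?r s b \<in> ?K" if s: "s \<in> S" for s
  proof -
    have "g (?r s b) = nsum C (\<lambda>k. s k \<odot>\<^bsub>C\<^esub> g (b k)) n"
      using S_carrier[OF s] b by (intro mod_hom_lincomb[OF mods(2,3) g]) auto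
    also have "\<dots> = nsum C (\<lambda>k. s k \<odot>\<^bsub>C\<^esub> h (a k)) n" using b by (auto intro: nsum_cong)
    finally have "g (?r s b) = \<zero>\<^bsub>C\<^esub>" using hom_syzygy[OF mods(3) h s] by simp
    moreover have "?r s b \<in> carrier B" using S_carrier[OF s] b by (intro B.M.nsum_closed) auto
    ultimately show ?thesis using im by simp
  qed
  obtain t where tK: "\<And>x. t x \<in> ?K" and tF: "\<And>y. y \<in> (\<lambda>s. ?r s b) ` S \<Longrightarrow> t y = y"
    and tE: "\<And>s b'. (s, b') \<in> (\<lambda>s. (s, b)) ` S \<Longrightarrow> t (?r s b') = ?r s (\<lambda>k. t (b' k))"
    by (rule pure_retract_lincombs[OF mods(2) pure, of "(\<lambda>s. (s, b)) ` S" n "(\<lambda>s. ?r s b) ` S"])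
       (use finite_S S_carrier b rK in auto)
  have tB: "t x \<in> carrier B" "g (t x) = \<zero>\<^bsub>C\<^esub>" for x using tK im by auto
  define c where "c k = b k \<oplus>\<^bsub>B\<^esub> \<ominus>\<^bsub>B\<^esub> t (b k)" for k
  have gneg: "g (\<ominus>\<^bsub>B\<^esub> t x) = \<zero>\<^bsub>C\<^esub>" for x
  proof -
    have "\<ominus>\<^bsub>B\<^esub> t x = \<ominus> \<one> \<odot>\<^bsub>B\<^esub> t x" using tB by (simp add: B.smult_l_minus)
    then show ?thesis using mod_hom_smult[OF g _ tB(1), of "\<ominus> \<one>" x] tB by simp
  qed
  have "\<exists>h' \<in> mod_hom R (ideal_module R I) B. \<forall>k<n. h' (a k) = c k"
  proof (rule extend_hom[OF mods(2)])
    fix s assume s: "s \<in> S"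
    have sc: "?r s b \<in> carrier B" "?r s (\<lambda>k. t (b k)) \<in> carrier B"
      using S_carrier[OF s] b tB by (auto intro!: B.M.nsum_closed)
    have "?r s b = ?r s (\<lambda>k. t (b k))" using tE[of s b] tF s by auto
    moreover have "?r s b = ?r s c \<oplus>\<^bsub>B\<^esub> ?r s (\<lambda>k. t (b k))"
    proof -
      have "?r s b = nsum B (\<lambda>k. s k \<odot>\<^bsub>B\<^esub> c k \<oplus>\<^bsub>B\<^esub> s k \<odot>\<^bsub>B\<^esub> t (b k)) n"
        using S_carrier[OF s] b tB
        by (intro nsum_cong) (simp add: c_def B.smult_r_distr[symmetric] B.M.a_assoc B.M.l_neg)
      also have "\<dots> = ?r s c \<oplus>\<^bsub>B\<^esub> ?r s (\<lambda>k. t (b k))"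
        using S_carrier[OF s] b tB by (intro B.M.nsum_add) (auto simp: c_def)
      finally show ?thesis .
    qed
    moreover have "?r s c \<in> carrier B"
      using S_carrier[OF s] b tB by (auto intro!: B.M.nsum_closed simp: c_def)
    ultimately show "?r s c = \<zero>\<^bsub>B\<^esub>" using sc by (metis B.M.add.r_cancel_one')
  qed (use b tB in \<open>simp add: c_def\<close>)
  then obtain h' where h': "h' \<in> mod_hom R (ideal_module R I) B" "\<And>k. k < n \<Longrightarrow> h' (a k) = c k" by blast
  have "g (c k) = h (a k)" if "k < n" for k
    using mod_hom_add[OF g b(1)[OF that], of "\<ominus>\<^bsub>B\<^esub> t (b k)"] gneg tB b that
      mod_hom_closed[OF g b(1)[OF that]] by (simp add: c_def)
  then show ?thesis using h' by (intro bexI[of _ h']) auto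
qed

lemma I_generated_pure_extension:
  assumes ex: "pure_exact R A f B g C" and genA: "I_generated R I A" and genC: "I_generated R I C"
  shows "I_generated R I B"
proof -
  have mods: "module R A" "module R B" "module R C" and f: "f \<in> mod_hom R A B"
    and g: "g \<in> mod_hom R B C"
    and im: "f ` carrier A = {b \<in> carrier B. g b = \<zero>\<^bsub>C\<^esub>}"
    using ex by (auto simp: pure_exact_def)
  interpret B: module R B by (rule mods)
  interpret C: module R C by (rule mods)
  let ?H = "mod_hom R (ideal_module R I)"
  show ?thesis
  proof (rule I_generatedI_sums[OF mods(2)])
    fix x assume x: "x \<in> carrier B"
    obtain h where h: "\<And>j. j < n \<Longrightarrow> h j \<in> ?H C" and gx: "g x = nsum C (\<lambda>j. h j (a j)) n"
      using I_generatedD_sums[OF genC mod_hom_closed[OF g x]] by blast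
    obtain h' where h': "\<And>j. j < n \<Longrightarrow> h' j \<in> ?H B"
      "\<And>j k. j < n \<Longrightarrow> k < n \<Longrightarrow> g (h' j (a k)) = h j (a k)"
      using pure_exact_lift[OF ex h] by metis
    have h'B: "h' j (a j) \<in> carrier B" if "j < n" for j
      using mod_hom_closed[OF h'(1)[OF that]] gen_mem[OF that] by simp
    \<comment> \<open>\<open>y\<close> is a sum of the required form that agrees with \<open>x\<close> modulo the image of \<open>A\<close>.\<close>
    define y where "y = nsum B (\<lambda>j. h' j (a j)) n"
    have y: "y \<in> carrier B" unfolding y_def by (rule B.M.nsum_closed[OF h'B])
    have "g y = nsum C (\<lambda>j. g (h' j (a j))) n"
      unfolding y_def by (rule mod_hom_nsum[OF mods(2,3) g h'B])
    also have "\<dots> = g x" unfolding gx using h'(2) by (auto intro: nsum_cong)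
    finally have gy: "g y = g x" .
    let ?d = "x \<oplus>\<^bsub>B\<^esub> \<ominus>\<^bsub>B\<^esub> y"
    have d: "?d \<in> carrier B" using x y by simp
    have xd: "x = ?d \<oplus>\<^bsub>B\<^esub> y" using x y by (simp add: B.M.a_assoc B.M.l_neg)
    have "g x = g ?d \<oplus>\<^bsub>C\<^esub> g y" using mod_hom_add[OF g d y] xd by simp
    then have "g ?d = \<zero>\<^bsub>C\<^esub>"
      using gy mod_hom_closed[OF g] d x by (metis C.M.add.r_cancel_one')
    then obtain u where u: "u \<in> carrier A" "f u = ?d" using im d by (metis (mono_tags, lifting) imageE mem_Collect_eq)
    obtain v where v: "\<And>j. j < n \<Longrightarrow> v j \<in> ?H A" and ue: "u = nsum A (\<lambda>j. v j (a j)) n"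
      using I_generatedD_sums[OF genA u(1)] by blast
    have vA: "v j (a j) \<in> carrier A" if "j < n" for j
      using mod_hom_closed[OF v[OF that]] gen_mem[OF that] by simp
    have "?d = nsum B (\<lambda>j. f (v j (a j))) n"
      unfolding u(2)[symmetric] ue by (rule mod_hom_nsum[OF mods(1,2) f vA])
    then have "x = nsum B (\<lambda>j. f (v j (a j))) n \<oplus>\<^bsub>B\<^esub> nsum B (\<lambda>j. h' j (a j)) n"
      using xd by (simp add: y_def)
    also have "\<dots> = nsum B (\<lambda>j. f (v j (a j)) \<oplus>\<^bsub>B\<^esub> h' j (a j)) n"
      by (rule B.M.nsum_add[symmetric]) (use h'B mod_hom_closed[OF f vA] in auto)
    finally show "\<exists>h. (\<forall>j<n. h j \<in> ?H B) \<and> x = nsum B (\<lambda>j. h j (a j)) n"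
      using mod_hom_plus[OF mods(2) mod_hom_comp[OF v f] h'(1)]
      by (intro exI[of _ "\<lambda>j b. f (v j b) \<oplus>\<^bsub>B\<^esub> h' j b"]) auto
  qed
qed

end

section \<open>Pure-injective hulls\<close>

text \<open>
  The index of the net is a finite set of demands: pairs at which addition, pairs at which
  scalar multiplication is to be respected, and elements of \<open>M\<close> to be fixed.
\<close>

lemma pure_retraction_net:
  fixes R :: "('r, 'x) ring_scheme" and N :: "('r, 'a) module"
  assumes N: "module R N" and pure: "pure_submodule R M N"
  obtains F :: "(('a \<times> 'a) set \<times> ('r \<times> 'a) set \<times> 'a set) filter" and t
  where "F \<noteq> bot" "\<And>j x. t j x \<in> M"
    and "\<And>x y. x \<in> carrier N \<Longrightarrow> y \<in> carrier N \<Longrightarrow> \<forall>\<^sub>F j in F. t j (x \<oplus>\<^bsub>N\<^esub> y) = t j x \<oplus>\<^bsub>N\<^esub> t j y"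
    and "\<And>r x. r \<in> carrier R \<Longrightarrow> x \<in> carrier N \<Longrightarrow> \<forall>\<^sub>F j in F. t j (r \<odot>\<^bsub>N\<^esub> x) = r \<odot>\<^bsub>N\<^esub> t j x"
    and "\<And>x. x \<in> M \<Longrightarrow> \<forall>\<^sub>F j in F. t j x = x"
proof -
  let ?XA = "carrier N \<times> carrier N" and ?XS = "carrier R \<times> carrier N"
  define good where "good = (\<lambda>(EA, ES, EF) t. (\<forall>x. t x \<in> M) \<and>
     (\<forall>(b, b')\<in>EA. t (b \<oplus>\<^bsub>N\<^esub> b') = t b \<oplus>\<^bsub>N\<^esub> t b') \<and>
     (\<forall>(r, b)\<in>ES. t (r \<odot>\<^bsub>N\<^esub> b) = r \<odot>\<^bsub>N\<^esub> t b) \<and> (\<forall>a\<in>EF. t a = a))"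
  define adm where "adm = (\<lambda>(EA, ES, EF). finite EA \<and> EA \<subseteq> ?XA \<and> finite ES \<and> ES \<subseteq> ?XS \<and> finite EF \<and> EF \<subseteq> M)"
  have ex: "\<exists>t. good j t" if "adm j" for j
    using that pure_retract_finite[OF N pure] by (cases j) (auto simp: good_def adm_def)
  have "adm ({}, {}, {})" by (simp add: adm_def)
  then obtain t0 where t0: "good ({}, {}, {}) t0" using ex by blast
  \<comment> \<open>Off the admissible indices only membership of the values in \<open>M\<close> matters.\<close>
  define t where "t j = (if adm j then SOME t. good j t else t0)" for j
  have t: "good j (t j)" if "adm j" for j
    using someI_ex[OF ex[OF that]] that by (simp add: t_def)
  have tadd: "t j (x \<oplus>\<^bsub>N\<^esub> y) = t j x \<oplus>\<^bsub>N\<^esub> t j y" if "adm j" "(x, y) \<in> fst j" for j x y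
    using t[OF that(1)] that(2) unfolding good_def by (cases j) fastforce
  have tsm: "t j (r \<odot>\<^bsub>N\<^esub> x) = r \<odot>\<^bsub>N\<^esub> t j x" if "adm j" "(r, x) \<in> fst (snd j)" for j r x
    using t[OF that(1)] that(2) unfolding good_def by (cases j) fastforce
  have tfix: "t j x = x" if "adm j" "x \<in> snd (snd j)" for j x
    using t[OF that(1)] that(2) unfolding good_def by (cases j) fastforce
  have tM: "t j x \<in> M" for j x
    using t[of j] t0 by (cases "adm j") (auto simp: good_def t_def split: prod.splits)
  define F where "F = finite_subsets_at_top ?XA \<times>\<^sub>F finite_subsets_at_top ?XS \<times>\<^sub>F finite_subsets_at_top M"
  have F: "F \<noteq> bot" by (simp add: F_def prod_filter_eq_bot)
  have ev: "\<forall>\<^sub>F j in F. adm j \<and> EA \<subseteq> fst j \<and> ES \<subseteq> fst (snd j) \<and> EF \<subseteq> snd (snd j)"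
    if "finite EA" "EA \<subseteq> ?XA" "finite ES" "ES \<subseteq> ?XS" "finite EF" "EF \<subseteq> M" for EA ES EF
  proof -
    have 1: "\<forall>\<^sub>F Z in finite_subsets_at_top Y. finite Z \<and> X0 \<subseteq> Z \<and> Z \<subseteq> Y" if "finite X0" "X0 \<subseteq> Y" for X0 Y :: "'z set"
      using that unfolding eventually_finite_subsets_at_top by blast
    show ?thesis
      unfolding F_def
      by (rule eventually_mono[OF eventually_prodI[OF 1[OF that(1,2)] eventually_prodI[OF 1[OF that(3,4)] 1[OF that(5,6)]]]])
         (auto simp: adm_def)
  qed
  show ?thesis
  proof (rule that[OF F tM])
    show "\<forall>\<^sub>F j in F. t j (x \<oplus>\<^bsub>N\<^esub> y) = t j x \<oplus>\<^bsub>N\<^esub> t j y" if "x \<in> carrier N" "y \<in> carrier N" for x y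
      by (rule eventually_mono[OF ev[of "{(x, y)}" "{}" "{}"]]) (use that tadd in auto)
    show "\<forall>\<^sub>F j in F. t j (r \<odot>\<^bsub>N\<^esub> x) = r \<odot>\<^bsub>N\<^esub> t j x" if "r \<in> carrier R" "x \<in> carrier N" for r x
      by (rule eventually_mono[OF ev[of "{}" "{(r, x)}" "{}"]]) (use that tsm in auto)
    show "\<forall>\<^sub>F j in F. t j x = x" if "x \<in> M" for x
      by (rule eventually_mono[OF ev[of "{}" "{}" "{x}"]]) (use that tfix in auto)
  qed
qed

lemma (in ideal_presentation) I_generated_pure_injective_hull:
  assumes gen: "I_generated R I (N\<lparr>carrier := M\<rparr>)" and hull: "pure_injective_hull R M N"
  shows "I_generated R I N"
proof -
  let ?M = "N\<lparr>carrier := M\<rparr>" and ?H = "mod_hom R (ideal_module R I)"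
  have PI: "pure_injective R N" and pure: "pure_submodule R M N"
    and min: "\<And>e. e \<in> mod_hom R N N \<Longrightarrow> \<forall>x\<in>M. e x = x \<Longrightarrow> bij_betw e (carrier N) (carrier N)"
    using hull by (auto simp: pure_injective_hull_def)
  have N: "module R N" using PI by (simp add: pure_injective_def)
  interpret N: module R N by fact
  have MN: "M \<subseteq> carrier N"
    using pure N.submoduleE(1) by (simp add: pure_submodule_def)
  obtain F :: "(('c \<times> 'c) set \<times> ('a \<times> 'c) set \<times> 'c set) filter" and t
    where F: "F \<noteq> bot" and tM: "\<And>j x. t j x \<in> M"
      and tadd: "\<And>x y. x \<in> carrier N \<Longrightarrow> y \<in> carrier N \<Longrightarrow> \<forall>\<^sub>F j in F. t j (x \<oplus>\<^bsub>N\<^esub> y) = t j x \<oplus>\<^bsub>N\<^esub> t j y"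
      and tsm: "\<And>r x. r \<in> carrier R \<Longrightarrow> x \<in> carrier N \<Longrightarrow> \<forall>\<^sub>F j in F. t j (r \<odot>\<^bsub>N\<^esub> x) = r \<odot>\<^bsub>N\<^esub> t j x"
      and tfix: "\<And>x. x \<in> M \<Longrightarrow> \<forall>\<^sub>F j in F. t j x = x"
    by (rule pure_retraction_net[OF N pure]) (rule that)
  obtain k where k: "k \<in> mod_hom R (function_module N) N"
    and kconst: "\<And>f c. \<forall>j. f j \<in> carrier N \<Longrightarrow> c \<in> carrier N \<Longrightarrow> eventually (\<lambda>j. f j = c) F \<Longrightarrow> k f = c"
    and kcong: "\<And>f g. \<forall>j. f j \<in> carrier N \<Longrightarrow> \<forall>j. g j \<in> carrier N \<Longrightarrow> eventually (\<lambda>j. f j = g j) F \<Longrightarrow> k f = k g"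
    by (rule pure_injective_limit[OF PI F]) (rule that)
  have tN: "t j x \<in> carrier N" for j x using tM MN by blast
  let ?P = "function_module N :: ('a, (('c \<times> 'c) set \<times> ('a \<times> 'c) set \<times> 'c set) \<Rightarrow> 'c) module"
  have P: "module R ?P" by (rule function_module_module[OF N])
  \<comment> \<open>No single \<open>t j\<close> need be linear, but each defect vanishes eventually, so the limit is.\<close>
  define e where "e x = k (\<lambda>j. t j x)" for x
  have tP: "(\<lambda>j. t j x) \<in> carrier ?P" for x using tN by simp
  have e: "e \<in> mod_hom R N N"
    unfolding mod_hom_def
  proof (intro CollectI conjI ballI Pi_I)
    show "e x \<in> carrier N" for x unfolding e_def by (rule mod_hom_closed[OF k tP])
    show "e (x \<oplus>\<^bsub>N\<^esub> y) = e x \<oplus>\<^bsub>N\<^esub> e y" if "x \<in> carrier N" "y \<in> carrier N" for x y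
    proof -
      have "e (x \<oplus>\<^bsub>N\<^esub> y) = k ((\<lambda>j. t j x) \<oplus>\<^bsub>?P\<^esub> (\<lambda>j. t j y))"
        unfolding e_def by (rule kcong) (use tN tadd that in auto)
      then show ?thesis by (simp only: e_def mod_hom_add[OF k tP tP])
    qed
    show "e (r \<odot>\<^bsub>N\<^esub> x) = r \<odot>\<^bsub>N\<^esub> e x" if "r \<in> carrier R" "x \<in> carrier N" for r x
    proof -
      have "e (r \<odot>\<^bsub>N\<^esub> x) = k (r \<odot>\<^bsub>?P\<^esub> (\<lambda>j. t j x))"
        unfolding e_def by (rule kcong) (use tN tsm that in auto)
      then show ?thesis by (simp only: e_def mod_hom_smult[OF k that(1) tP])
    qed
  qed
  have "e x = x" if "x \<in> M" for x
    unfolding e_def by (rule kconst) (use tN tfix that MN in auto)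
  then have surj: "e ` carrier N = carrier N" using min[OF e] by (simp add: bij_betw_def)
  show ?thesis
  proof (rule I_generatedI_sums[OF N])
    fix y assume "y \<in> carrier N"
    then obtain x where y: "y = e x" using surj by blast
    have "\<forall>j. \<exists>h. (\<forall>i<n. h i \<in> ?H ?M) \<and> t j x = nsum ?M (\<lambda>i. h i (a i)) n"
      using I_generatedD_sums[OF gen] tM by simp
    then obtain h where h: "\<And>j i. i < n \<Longrightarrow> h j i \<in> ?H ?M"
      and tx: "\<And>j. t j x = nsum ?M (\<lambda>i. h j i (a i)) n" by metis
    \<comment> \<open>The \<open>i\<close>-th homomorphisms for all members of the net form one homomorphism to \<open>N\<^sup>J\<close>.\<close>
    have hP: "(\<lambda>b j. h j i b) \<in> ?H ?P" if "i < n" for i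
      unfolding mod_hom_def
      using mod_hom_closed[OF h[OF that]] mod_hom_add[OF h[OF that]] mod_hom_smult[OF h[OF that]] MN
      by (auto simp: fun_eq_iff subset_iff)
    have "(\<lambda>j. t j x) = nsum ?P (\<lambda>i j. h j i (a i)) n"
      by (simp add: fun_eq_iff function_module_nsum tx)
    then have "y = k (nsum ?P (\<lambda>i j. h j i (a i)) n)" by (simp add: y e_def)
    also have "\<dots> = nsum N (\<lambda>i. k (\<lambda>j. h j i (a i))) n"
      by (rule mod_hom_nsum[OF P N k]) (use mod_hom_closed[OF hP] gen_mem in auto)
    finally show "\<exists>h. (\<forall>i<n. h i \<in> ?H N) \<and> y = nsum N (\<lambda>i. h i (a i)) n"
      using mod_hom_comp[OF hP k] by (intro exI[of _ "\<lambda>i b. k (\<lambda>j. h j i b)"]) auto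
  qed
qed

theorem lemma2p1:
  fixes R :: "('r, 'x) ring_scheme" and m I :: "'r set"
  assumes "local_ring R m" and "noetherian_ring R" and "ideal I R"
  shows
    "(\<forall>(B :: ('r, 'b) module) A.
        I_generated R I B \<and> pure_submodule R A B \<longrightarrow> I_generated R I (B\<lparr>carrier := A\<rparr>)) \<and>
     (\<forall>(A :: ('r, 'a) module) (B :: ('r, 'b) module) (C :: ('r, 'c) module) f g.
        pure_exact R A f B g C \<and> I_generated R I A \<and> I_generated R I C \<longrightarrow> I_generated R I B) \<and>
     (\<forall>(N :: ('r, 'b) module) M.
        I_generated R I (N\<lparr>carrier := M\<rparr>) \<and> pure_injective_hull R M N \<longrightarrow> I_generated R I N)"
proof -
  have "cring R" using assms(1) by (simp add: local_ring_def)
  then obtain a n S where "ideal_presentation R I a n S"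
    using noetherian_presentation assms(2,3) by blast
  then interpret ideal_presentation R I a n S .
  show ?thesis
    using I_generated_pure_submodule I_generated_pure_extension I_generated_pure_injective_hull
    by blast
qed

end
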